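(* Let $k$ be a non-archimedean local field of characteristic different from two, let $\pi$ be a supercuspidal representation of $\mathrm{Sp}(4)=\mathrm{Sp}(4,k)$, and let $\psi$ be a nontrivial character of $Z\cong k$ such that $\pi_\psi\neq 0$. Then the representation $\pi_\psi$ of $J$ has an irreducible quotient.
   Context: Representations are smooth and over $\mathbb{C}$, and supercuspidal representations are understood to be irreducible. $\mathrm{Sp}(4)$ is the group of automorphisms of a non-degenerate skew-symmetric form on a $4$-dimensional $k$-vector space $V$. Fix a nonzero $e_1\in V$; $J$ is the stabilizer of $e_1$ in $\mathrm{Sp}(4)$, so $J\cong\mathrm{SL}(2)\ltimes H$ with $H$ the $3$-dimensional Heisenberg group, and $Z\cong k$ is the center of $H$ (also the center of $J$). For a character $\psi:Z\to\mathbb{C}^\times$, the twisted Jacquet module is $$\pi_\psi=\pi\big/\operatorname{span}\{zv-\psi(z)v : z\in Z,\ v\in\pi\},$$ which is a smooth representation of $J$ on which $Z$ acts by $\psi$. *)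

theory Defs
  imports "HOL-Analysis.Analysis" "HOL-Algebra.Algebraic_Closure_Type"
begin

section \<open>Non-archimedean local fields\<close>

text \<open>A non-archimedean local field is a field with a nontrivial ultrametric absolute value whose
  topology is locally compact; completeness, discreteness of the valuation and finiteness of its
  residue field follow. Any characteristic is allowed.\<close>

class nonarch_local_field = field + metric_space +
  fixes absval :: "'a \<Rightarrow> real"
  assumes dist_absval: "dist x y = absval (x - y)"
    and absval_mult: "absval (x * y) = absval x * absval y"
    and absval_add_le_max: "absval (x + y) \<le> max (absval x) (absval y)"
    and absval_nontrivial: "\<exists>x. x \<noteq> 0 \<and> absval x \<noteq> 1"
    and locally_compact: "\<exists>r>0. compact {x. absval x \<le> r}"


section \<open>Smooth complex representations\<close>

abbreviation complex_ring :: "complex ring"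
  where "complex_ring \<equiv> ring_of_type_algebra"

text \<open>The topology on \<open>G\<close> is the one induced from its ambient type.\<close>

locale smooth_rep = G?: group G + V?: Module.module complex_ring V
  for G :: "'g::topological_space monoid" and V :: "(complex, 'v) module"
    and \<rho> :: "'g \<Rightarrow> 'v \<Rightarrow> 'v" +
  assumes rep_closed: "\<lbrakk>g \<in> carrier G; v \<in> carrier V\<rbrakk> \<Longrightarrow> \<rho> g v \<in> carrier V"
    and rep_add: "\<lbrakk>g \<in> carrier G; v \<in> carrier V; w \<in> carrier V\<rbrakk>
      \<Longrightarrow> \<rho> g (v \<oplus>\<^bsub>V\<^esub> w) = \<rho> g v \<oplus>\<^bsub>V\<^esub> \<rho> g w"
    and rep_smult: "\<lbrakk>g \<in> carrier G; v \<in> carrier V\<rbrakk> \<Longrightarrow> \<rho> g (a \<odot>\<^bsub>V\<^esub> v) = a \<odot>\<^bsub>V\<^esub> \<rho> g v"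
    and rep_one: "v \<in> carrier V \<Longrightarrow> \<rho> \<one>\<^bsub>G\<^esub> v = v"
    and rep_mult: "\<lbrakk>g \<in> carrier G; h \<in> carrier G; v \<in> carrier V\<rbrakk>
      \<Longrightarrow> \<rho> (g \<otimes>\<^bsub>G\<^esub> h) v = \<rho> g (\<rho> h v)"
    and smooth: "v \<in> carrier V
      \<Longrightarrow> openin (top_of_set (carrier G)) {g \<in> carrier G. \<rho> g v = v}"

definition subrep ::
    "'g monoid \<Rightarrow> (complex, 'v) module \<Rightarrow> ('g \<Rightarrow> 'v \<Rightarrow> 'v) \<Rightarrow> 'v set \<Rightarrow> bool"
  where "subrep G V \<rho> W \<longleftrightarrow>
    submodule W complex_ring V \<and> (\<forall>g\<in>carrier G. \<forall>w\<in>W. \<rho> g w \<in> W)"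

definition irreducible_rep ::
    "'g::topological_space monoid \<Rightarrow> (complex, 'v) module \<Rightarrow> ('g \<Rightarrow> 'v \<Rightarrow> 'v) \<Rightarrow> bool"
  where "irreducible_rep G V \<rho> \<longleftrightarrow>
    smooth_rep G V \<rho> \<and> carrier V \<noteq> {\<zero>\<^bsub>V\<^esub>} \<and>
    (\<forall>W. subrep G V \<rho> W \<longrightarrow> W = {\<zero>\<^bsub>V\<^esub>} \<or> W = carrier V)"

text \<open>The quotient \<open>V / W\<close>, whose elements are the cosets of \<open>W\<close>. The ring fields \<open>mult\<close> and \<open>one\<close>
  of a module record carry no meaning. The union in \<open>smult\<close> makes \<open>0 \<odot> S\<close> the coset \<open>W\<close> rather than
  the singleton of zero.\<close>

definition quot_module :: "(complex, 'v) module \<Rightarrow> 'v set \<Rightarrow> (complex, 'v set) module"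
  where "quot_module V W =
    \<lparr>carrier = a_rcosets\<^bsub>V\<^esub> W, mult = undefined, one = undefined,
     zero = W, add = set_add V,
     smult = (\<lambda>a S. \<Union>x\<in>S. W +>\<^bsub>V\<^esub> (a \<odot>\<^bsub>V\<^esub> x))\<rparr>"

text \<open>The action induced on cosets: if \<open>W\<close> is stable then \<open>\<rho> g\<close> maps \<open>v + W\<close> onto \<open>\<rho> g v + W\<close>.\<close>

definition quot_act :: "('g \<Rightarrow> 'v \<Rightarrow> 'v) \<Rightarrow> 'g \<Rightarrow> 'v set \<Rightarrow> 'v set"
  where "quot_act \<rho> g S = \<rho> g ` S"

definition has_irreducible_quotient ::
    "'g::topological_space monoid \<Rightarrow> (complex, 'v) module \<Rightarrow> ('g \<Rightarrow> 'v \<Rightarrow> 'v) \<Rightarrow> bool"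
  where "has_irreducible_quotient G V \<rho> \<longleftrightarrow>
    (\<exists>W. subrep G V \<rho> W \<and> irreducible_rep G (quot_module V W) (quot_act \<rho>))"

text \<open>The twisted Jacquet module for a subgroup \<open>N\<close> and a function \<open>\<psi>\<close> on it, with the ordinary
  Jacquet module as the case of the trivial character.\<close>

definition twisted_span ::
    "(complex, 'v) module \<Rightarrow> ('g \<Rightarrow> 'v \<Rightarrow> 'v) \<Rightarrow> 'g set \<Rightarrow> ('g \<Rightarrow> complex) \<Rightarrow> 'v set"
  where "twisted_span V \<rho> N \<psi> =
    (\<lambda>W. submodule W complex_ring V) hull
      {\<rho> n v \<ominus>\<^bsub>V\<^esub> \<psi> n \<odot>\<^bsub>V\<^esub> v | n v. n \<in> N \<and> v \<in> carrier V}"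

definition twisted_jacquet ::
    "(complex, 'v) module \<Rightarrow> ('g \<Rightarrow> 'v \<Rightarrow> 'v) \<Rightarrow> 'g set \<Rightarrow> ('g \<Rightarrow> complex) \<Rightarrow> (complex, 'v set) module"
  where "twisted_jacquet V \<rho> N \<psi> = quot_module V (twisted_span V \<rho> N \<psi>)"

abbreviation jacquet ::
    "(complex, 'v) module \<Rightarrow> ('g \<Rightarrow> 'v \<Rightarrow> 'v) \<Rightarrow> 'g set \<Rightarrow> (complex, 'v set) module"
  where "jacquet V \<rho> N \<equiv> twisted_jacquet V \<rho> N (\<lambda>_. 1)"


section \<open>Symplectic groups and their subgroups\<close>

text \<open>Linearity in the first argument follows from skew-symmetry.\<close>

definition symplectic_form :: "('k::field ^ 'n \<Rightarrow> 'k ^ 'n \<Rightarrow> 'k) \<Rightarrow> bool"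
  where "symplectic_form B \<longleftrightarrow>
    (\<forall>x. Vector_Spaces.linear (*s) (*) (B x)) \<and>
    (\<forall>x y. B x y = - B y x) \<and>
    (\<forall>x. (\<forall>y. B x y = 0) \<longrightarrow> x = 0)"

definition Sp_group :: "('k::field ^ 'n \<Rightarrow> 'k ^ 'n \<Rightarrow> 'k) \<Rightarrow> ('k ^ 'n ^ 'n) monoid"
  where "Sp_group B =
    \<lparr>carrier = {g. \<forall>x y. B (g *v x) (g *v y) = B x y}, mult = (**), one = mat 1\<rparr>"

definition J_group ::
    "('k::field ^ 'n \<Rightarrow> 'k ^ 'n \<Rightarrow> 'k) \<Rightarrow> 'k ^ 'n \<Rightarrow> ('k ^ 'n ^ 'n) monoid"
  where "J_group B e = (Sp_group B)\<lparr>carrier := {g \<in> carrier (Sp_group B). g *v e = e}\<rparr>"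

text \<open>The Heisenberg group \<open>H\<close> is the unipotent radical of \<open>J\<close>, that is, the kernel of the action
  of \<open>J\<close> on \<open>e\<^sup>\<bottom> / \<langle>e\<rangle>\<close>.\<close>

definition H_group ::
    "('k::field ^ 'n \<Rightarrow> 'k ^ 'n \<Rightarrow> 'k) \<Rightarrow> 'k ^ 'n \<Rightarrow> ('k ^ 'n ^ 'n) monoid"
  where "H_group B e = (Sp_group B)\<lparr>carrier :=
    {g \<in> carrier (J_group B e). \<forall>v. B e v = 0 \<longrightarrow> g *v v - v \<in> vec.span {e}}\<rparr>"

definition center :: "('g, 'm) monoid_scheme \<Rightarrow> 'g set"
  where "center G = {z \<in> carrier G. \<forall>g\<in>carrier G. z \<otimes>\<^bsub>G\<^esub> g = g \<otimes>\<^bsub>G\<^esub> z}"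

abbreviation Z_subgroup ::
    "('k::field ^ 'n \<Rightarrow> 'k ^ 'n \<Rightarrow> 'k) \<Rightarrow> 'k ^ 'n \<Rightarrow> ('k ^ 'n ^ 'n) set"
  where "Z_subgroup B e \<equiv> center (H_group B e)"

definition character ::
    "('k::{field, topological_space} ^ 'n ^ 'n) set \<Rightarrow> ('k ^ 'n ^ 'n \<Rightarrow> complex) \<Rightarrow> bool"
  where "character N \<psi> \<longleftrightarrow>
    continuous_on N \<psi> \<and> (\<forall>z\<in>N. \<psi> z \<noteq> 0) \<and> (\<forall>z\<in>N. \<forall>w\<in>N. \<psi> (z ** w) = \<psi> z * \<psi> w)"


section \<open>Supercuspidal representations\<close>

definition perp :: "('k::field ^ 'n \<Rightarrow> 'k ^ 'n \<Rightarrow> 'k) \<Rightarrow> ('k ^ 'n) set \<Rightarrow> ('k ^ 'n) set"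
  where "perp B W = {v. \<forall>w\<in>W. B v w = 0}"

text \<open>The proper parabolic subgroups of a symplectic group are the stabilizers of the nonempty
  flags \<open>F\<close> of nonzero totally isotropic subspaces. Such a stabilizer also preserves the members of
  \<open>full_flag B F\<close>, and its unipotent radical consists of the elements acting trivially on the
  successive quotients of that chain.\<close>

definition isotropic_flag ::
    "('k::field ^ 'n \<Rightarrow> 'k ^ 'n \<Rightarrow> 'k) \<Rightarrow> ('k ^ 'n) set set \<Rightarrow> bool"
  where "isotropic_flag B F \<longleftrightarrow>
    F \<noteq> {} \<and>
    (\<forall>W\<in>F. vec.subspace W \<and> W \<noteq> {0} \<and> W \<subseteq> perp B W) \<and>
    (\<forall>U\<in>F. \<forall>W\<in>F. U \<subseteq> W \<or> W \<subseteq> U)"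

definition full_flag ::
    "('k::field ^ 'n \<Rightarrow> 'k ^ 'n \<Rightarrow> 'k) \<Rightarrow> ('k ^ 'n) set set \<Rightarrow> ('k ^ 'n) set set"
  where "full_flag B F = {{0}, UNIV} \<union> F \<union> perp B ` F"

definition unipotent_radical ::
    "('k::field ^ 'n \<Rightarrow> 'k ^ 'n \<Rightarrow> 'k) \<Rightarrow> ('k ^ 'n) set set \<Rightarrow> ('k ^ 'n ^ 'n) set"
  where "unipotent_radical B F = {g \<in> carrier (Sp_group B).
    \<forall>W\<in>full_flag B F - {{0}}. \<forall>v\<in>W. \<exists>W'\<in>full_flag B F. W' \<subset> W \<and> g *v v - v \<in> W'}"

definition supercuspidal ::
    "('k::{field, topological_space} ^ 'n \<Rightarrow> 'k ^ 'n \<Rightarrow> 'k) \<Rightarrow> (complex, 'v) module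
      \<Rightarrow> ('k ^ 'n ^ 'n \<Rightarrow> 'v \<Rightarrow> 'v) \<Rightarrow> bool"
  where "supercuspidal B V \<pi> \<longleftrightarrow>
    irreducible_rep (Sp_group B) V \<pi> \<and>
    (\<forall>F. isotropic_flag B F \<longrightarrow>
      carrier (jacquet V \<pi> (unipotent_radical B F)) = {\<zero>\<^bsub>jacquet V \<pi> (unipotent_radical B F)\<^esub>})"

end

theory Submission
  imports Defs "HOL-Library.Function_Algebras"
begin

text \<open>A supercuspidal \<open>\<pi>\<close> is compact: by the Cartan decomposition and the vanishing of the Jacquet
  modules, its matrix coefficients against a functional invariant under a small compact open
  subgroup have finite support on the set \<open>X\<close> of right cosets of that subgroup. So \<open>\<pi>\<close> embeds into the
  permutation representation on finitely supported functions on \<open>X\<close>, and the pointwise inner product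
  makes it a direct summand. Restricted to \<open>J\<close>, the permutation representation is a direct sum of
  representations induced from compact open subgroups, hence projective, and \<open>\<pi>\<^sub>\<psi>\<close> is therefore a
  nonzero projective object. As Bass showed for modules over a ring, such an object has a maximal
  proper submodule.\<close>

section \<open>Finitely supported functions on a set with a group action\<close>

text \<open>The obstacle is that finite generation of the twisted Jacquet module over J is not at
  hand, so Zorn's lemma alone gives no maximal proper submodule. Projectivity takes its place. A
  vector outside the subspace \<open>T\<close> to be divided out lives on finitely many orbits, and
  the idempotent compressed to these orbits is an endomorphism \<open>\<phi>\<close> of a finitely
  generated module. Either 1 - \<open>\<phi>\<close> fails to be onto modulo \<open>T\<close>, or it
  is onto and splits, and then its kernel modulo \<open>T\<close> is finitely generated and contains
  the vector. In both cases Zorn's lemma applies to a finitely generated module, and the maximal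
  submodule found there is pulled back. Quotients are avoided meanwhile: the argument runs inside
  the permutation representation, relative to a subspace that all J-endomorphisms preserve. The
  projection onto the supercuspidal representation is built over Sp(4), where irreducibility is
  available, and only then regarded as a J-map. Integration is avoided as well: compact open
  subgroups have finite orbits on the coset space, so every average is a finite sum.\<close>

definition fscale :: "complex \<Rightarrow> ('x \<Rightarrow> complex) \<Rightarrow> 'x \<Rightarrow> complex" (infixr \<open>*\<^sub>f\<close> 75)
  where "c *\<^sub>f f = (\<lambda>x. c * f x)"

lemma fscale_apply [simp]: "(c *\<^sub>f f) x = c * f x"
  by (simp add: fscale_def)

lemma fscale_add: "c *\<^sub>f (f + h) = c *\<^sub>f f + c *\<^sub>f h"
  and fscale_add_left: "(a + b) *\<^sub>f f = a *\<^sub>f f + b *\<^sub>f f"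
  and fscale_diff: "c *\<^sub>f (f - h) = c *\<^sub>f f - c *\<^sub>f h"
  and fscale_fscale: "a *\<^sub>f b *\<^sub>f f = (a * b) *\<^sub>f f"
  and fscale_one [simp]: "1 *\<^sub>f f = f"
  and fscale_zero [simp]: "0 *\<^sub>f f = 0"
  by (auto simp: fun_eq_iff algebra_simps)

lemma sum_fun_apply: "(\<Sum>a\<in>A. h a) x = (\<Sum>a\<in>A. h a x)"
  by (induction A rule: infinite_finite_induct) auto

lemma fscale_sum: "c *\<^sub>f (\<Sum>a\<in>A. h a) = (\<Sum>a\<in>A. c *\<^sub>f h a)"
  by (auto simp: fun_eq_iff sum_fun_apply sum_distrib_left)

definition fsubspace :: "('x \<Rightarrow> complex) set \<Rightarrow> bool"
  where "fsubspace S \<longleftrightarrow> 0 \<in> S \<and> (\<forall>f\<in>S. \<forall>h\<in>S. f + h \<in> S) \<and> (\<forall>c. \<forall>f\<in>S. c *\<^sub>f f \<in> S)"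

lemma fsubspaceD:
  assumes "fsubspace S"
  shows "0 \<in> S" "\<And>f h. f \<in> S \<Longrightarrow> h \<in> S \<Longrightarrow> f + h \<in> S" "\<And>c f. f \<in> S \<Longrightarrow> c *\<^sub>f f \<in> S"
    "\<And>f h. f \<in> S \<Longrightarrow> h \<in> S \<Longrightarrow> f - h \<in> S"
    "\<And>A h. (\<And>a. a \<in> A \<Longrightarrow> h a \<in> S) \<Longrightarrow> (\<Sum>a\<in>A. h a) \<in> S"
proof -
  show S: "0 \<in> S" "\<And>f h. f \<in> S \<Longrightarrow> h \<in> S \<Longrightarrow> f + h \<in> S" "\<And>c f. f \<in> S \<Longrightarrow> c *\<^sub>f f \<in> S"
    using assms unfolding fsubspace_def by blast+
  show "f - h \<in> S" if "f \<in> S" "h \<in> S" for f h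
  proof -
    have "f + (-1) *\<^sub>f h \<in> S" using that S by blast
    also have "f + (-1) *\<^sub>f h = f - h" by (simp add: fun_eq_iff)
    finally show ?thesis .
  qed
  show "(\<Sum>a\<in>A. h a) \<in> S" if "\<And>a. a \<in> A \<Longrightarrow> h a \<in> S" for A and h :: "'b \<Rightarrow> 'a \<Rightarrow> complex"
    using that by (induction A rule: infinite_finite_induct) (simp_all add: S)
qed

definition supp :: "('x \<Rightarrow> complex) \<Rightarrow> 'x set"
  where "supp f = {x. f x \<noteq> 0}"

definition finsupp :: "'x set \<Rightarrow> ('x \<Rightarrow> complex) set"
  where "finsupp \<Omega> = {f. finite (supp f) \<and> supp f \<subseteq> \<Omega>}"

definition delta :: "'x \<Rightarrow> 'x \<Rightarrow> complex"
  where "delta x = (\<lambda>y. if y = x then 1 else 0)"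

lemma finsuppI: "finite A \<Longrightarrow> A \<subseteq> \<Omega> \<Longrightarrow> (\<And>x. x \<notin> A \<Longrightarrow> f x = 0) \<Longrightarrow> f \<in> finsupp \<Omega>"
  unfolding finsupp_def supp_def by (auto intro: finite_subset[of _ A])

lemma finsuppD:
  assumes "f \<in> finsupp \<Omega>"
  shows "finite (supp f)" "supp f \<subseteq> \<Omega>" "\<And>x. x \<notin> \<Omega> \<Longrightarrow> f x = 0"
  using assms by (auto simp: finsupp_def supp_def)

lemma subspace_finsupp: "fsubspace (finsupp \<Omega>)"
  unfolding fsubspace_def
proof (intro conjI ballI allI)
  show "0 \<in> finsupp \<Omega>" by (rule finsuppI[of "{}"]) auto
next
  fix f g assume fg: "f \<in> finsupp \<Omega>" "g \<in> finsupp \<Omega>"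
  show "f + g \<in> finsupp \<Omega>"
    by (rule finsuppI[of "supp f \<union> supp g"]) (use fg in \<open>auto simp: finsupp_def supp_def\<close>)
next
  fix c f assume f: "f \<in> finsupp \<Omega>"
  show "c *\<^sub>f f \<in> finsupp \<Omega>"
    by (rule finsuppI[of "supp f"]) (use f in \<open>auto simp: finsupp_def supp_def\<close>)
qed

lemma delta_finsupp: "x \<in> \<Omega> \<Longrightarrow> delta x \<in> finsupp \<Omega>"
  by (rule finsuppI[of "{x}"]) (auto simp: delta_def)

lemma finsupp_expand: "(\<Sum>x\<in>supp f. f x *\<^sub>f delta x) = f" if "f \<in> finsupp \<Omega>"
proof
  fix y
  have "(\<Sum>x\<in>supp f. f x *\<^sub>f delta x) y = (\<Sum>x\<in>supp f. if y = x then f x else 0)"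
    by (simp add: sum_fun_apply delta_def if_distrib cong: if_cong)
  also have "\<dots> = f y"
    using finsuppD(1)[OF that] by (auto simp: sum.delta' supp_def)
  finally show "(\<Sum>x\<in>supp f. f x *\<^sub>f delta x) y = f y" .
qed

section \<open>Right translation on finitely supported functions\<close>

locale right_action = group G for G :: "('g, 'm) monoid_scheme" (structure) +
  fixes \<Omega> :: "'x set" and act :: "'x \<Rightarrow> 'g \<Rightarrow> 'x"
  assumes act_closed: "x \<in> \<Omega> \<Longrightarrow> g \<in> carrier G \<Longrightarrow> act x g \<in> \<Omega>"
    and act_one: "x \<in> \<Omega> \<Longrightarrow> act x \<one> = x"
    and act_mult: "x \<in> \<Omega> \<Longrightarrow> g \<in> carrier G \<Longrightarrow> h \<in> carrier G \<Longrightarrow> act x (g \<otimes> h) = act (act x g) h"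
begin

text \<open>Right translation of functions for a right action is a left action of the group. The
  value 0 outside \<open>\<Omega>\<close> keeps translates in \<open>finsupp \<Omega>\<close>, since
  nothing is assumed about \<open>act\<close> there.\<close>

definition R :: "'g \<Rightarrow> ('x \<Rightarrow> complex) \<Rightarrow> 'x \<Rightarrow> complex"
  where "R g f = (\<lambda>x. if x \<in> \<Omega> then f (act x g) else 0)"

definition stable :: "('x \<Rightarrow> complex) set \<Rightarrow> bool"
  where "stable S \<longleftrightarrow> fsubspace S \<and> (\<forall>g\<in>carrier G. \<forall>f\<in>S. R g f \<in> S)"

definition maximal_in :: "('x \<Rightarrow> complex) set \<Rightarrow> ('x \<Rightarrow> complex) set \<Rightarrow> bool"
  where "maximal_in D N \<longleftrightarrow> stable N \<and> N \<subset> D \<and>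
    (\<forall>N'. stable N' \<longrightarrow> N \<subseteq> N' \<longrightarrow> N' \<subseteq> D \<longrightarrow> N' = N \<or> N' = D)"

definition ghom :: "(('x \<Rightarrow> complex) \<Rightarrow> 'x \<Rightarrow> complex) \<Rightarrow> bool"
  where "ghom \<theta> \<longleftrightarrow> (\<forall>f\<in>finsupp \<Omega>. \<theta> f \<in> finsupp \<Omega>) \<and>
    (\<forall>f\<in>finsupp \<Omega>. \<forall>h\<in>finsupp \<Omega>. \<theta> (f + h) = \<theta> f + \<theta> h) \<and>
    (\<forall>f\<in>finsupp \<Omega>. \<forall>c. \<theta> (c *\<^sub>f f) = c *\<^sub>f \<theta> f) \<and>
    (\<forall>f\<in>finsupp \<Omega>. \<forall>g\<in>carrier G. \<theta> (R g f) = R g (\<theta> f))"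

abbreviation "F \<equiv> finsupp \<Omega>"

lemma act_inv [simp]:
  assumes "x \<in> \<Omega>" "g \<in> carrier G"
  shows "act (act x g) (inv g) = x" "act (act x (inv g)) g = x"
  using assms act_mult[of x g "inv g"] act_mult[of x "inv g" g] by (simp_all add: act_one)

lemma R_add: "R g (f + h) = R g f + R g h"
  and R_scale: "R g (c *\<^sub>f f) = c *\<^sub>f R g f"
  and R_diff: "R g (f - h) = R g f - R g h"
  and R_zero: "R g 0 = 0"
  by (auto simp: R_def fun_eq_iff)

lemma R_sum: "R g (\<Sum>a\<in>A. h a) = (\<Sum>a\<in>A. R g (h a))"
  by (auto simp: R_def sum_fun_apply fun_eq_iff)

lemma R_finsupp [simp, intro]:
  assumes "g \<in> carrier G" "f \<in> F" shows "R g f \<in> F"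
proof (rule finsuppI[of "(\<lambda>y. act y (inv g)) ` supp f"])
  show "finite ((\<lambda>y. act y (inv g)) ` supp f)" using finsuppD[OF assms(2)] by simp
  show "(\<lambda>y. act y (inv g)) ` supp f \<subseteq> \<Omega>"
    using finsuppD[OF assms(2)] assms(1) act_closed by auto
  fix x assume x: "x \<notin> (\<lambda>y. act y (inv g)) ` supp f"
  show "R g f x = 0"
  proof (cases "x \<in> \<Omega>")
    case True
    then have "act (act x g) (inv g) = x" using assms by simp
    with x have "act x g \<notin> supp f" by (metis imageI)
    then show ?thesis by (simp add: R_def supp_def)
  qed (simp add: R_def)
qed

lemma R_one [simp]: "f \<in> F \<Longrightarrow> R \<one> f = f"
  by (auto simp: R_def fun_eq_iff act_one finsuppD(3))

lemma R_mult: "g \<in> carrier G \<Longrightarrow> h \<in> carrier G \<Longrightarrow> R (g \<otimes> h) f = R g (R h f)"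
  by (auto simp: R_def fun_eq_iff act_mult act_closed)

lemma R_inv [simp]:
  assumes "g \<in> carrier G" "f \<in> F"
  shows "R (inv g) (R g f) = f" "R g (R (inv g) f) = f"
  using assms R_mult[of g "inv g" f] R_mult[of "inv g" g f] by simp_all

lemma R_delta:
  assumes "x \<in> \<Omega>" "g \<in> carrier G"
  shows "R g (delta x) = delta (act x (inv g))"
proof
  fix y
  have "act y g = x \<longleftrightarrow> y = act x (inv g)" if "y \<in> \<Omega>"
    using that assms by auto
  moreover have "act x (inv g) \<in> \<Omega>" using assms act_closed by simp
  ultimately show "R g (delta x) y = delta (act x (inv g)) y"
    using assms by (auto simp: R_def delta_def)
qed

lemma stableD:
  assumes "stable S"
  shows "fsubspace S" "0 \<in> S" "\<And>f h. f \<in> S \<Longrightarrow> h \<in> S \<Longrightarrow> f + h \<in> S"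
    "\<And>f h. f \<in> S \<Longrightarrow> h \<in> S \<Longrightarrow> f - h \<in> S"
    "\<And>c f. f \<in> S \<Longrightarrow> c *\<^sub>f f \<in> S" "\<And>g f. g \<in> carrier G \<Longrightarrow> f \<in> S \<Longrightarrow> R g f \<in> S"
    "\<And>A h. (\<And>a. a \<in> A \<Longrightarrow> h a \<in> S) \<Longrightarrow> (\<Sum>a\<in>A. h a) \<in> S"
proof -
  show S: "fsubspace S" using assms by (simp add: stable_def)
  show "0 \<in> S" "\<And>f h. f \<in> S \<Longrightarrow> h \<in> S \<Longrightarrow> f + h \<in> S"
    "\<And>f h. f \<in> S \<Longrightarrow> h \<in> S \<Longrightarrow> f - h \<in> S"
    "\<And>c f. f \<in> S \<Longrightarrow> c *\<^sub>f f \<in> S" "\<And>A h. (\<And>a. a \<in> A \<Longrightarrow> h a \<in> S) \<Longrightarrow> (\<Sum>a\<in>A. h a) \<in> S"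
    by (fact fsubspaceD[OF S])+
  show "g \<in> carrier G \<Longrightarrow> f \<in> S \<Longrightarrow> R g f \<in> S" for g f using assms by (simp add: stable_def)
qed

lemma stableI:
  assumes "0 \<in> S" "\<And>f h. f \<in> S \<Longrightarrow> h \<in> S \<Longrightarrow> f + h \<in> S"
    "\<And>c f. f \<in> S \<Longrightarrow> c *\<^sub>f f \<in> S" "\<And>g f. g \<in> carrier G \<Longrightarrow> f \<in> S \<Longrightarrow> R g f \<in> S"
  shows "stable S"
  using assms unfolding stable_def fsubspace_def by blast

lemma stable_finsupp: "stable F"
  using subspace_finsupp unfolding stable_def by auto

lemma stable_Int: "stable S \<Longrightarrow> stable T \<Longrightarrow> stable (S \<inter> T)"
  unfolding stable_def by (auto simp: fsubspace_def)

lemma ghomD: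
  assumes "ghom \<theta>"
  shows "\<And>f. f \<in> F \<Longrightarrow> \<theta> f \<in> F" "\<And>f h. f \<in> F \<Longrightarrow> h \<in> F \<Longrightarrow> \<theta> (f + h) = \<theta> f + \<theta> h"
    "\<And>c f. f \<in> F \<Longrightarrow> \<theta> (c *\<^sub>f f) = c *\<^sub>f \<theta> f"
    "\<And>g f. g \<in> carrier G \<Longrightarrow> f \<in> F \<Longrightarrow> \<theta> (R g f) = R g (\<theta> f)"
  using assms unfolding ghom_def by blast+

lemma ghom_zero: "ghom \<theta> \<Longrightarrow> \<theta> 0 = 0"
  using ghomD(3)[of \<theta> 0 0] stableD(2)[OF stable_finsupp] by simp

lemma ghom_diff:
  assumes "ghom \<theta>" "f \<in> F" "h \<in> F" shows "\<theta> (f - h) = \<theta> f - \<theta> h"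
proof -
  have "f - h \<in> F" using assms stableD(4)[OF stable_finsupp] by blast
  from ghomD(2)[OF assms(1) this assms(3)] show ?thesis by (simp add: algebra_simps)
qed

lemma ghom_sum:
  assumes "ghom \<theta>" "\<And>a. a \<in> A \<Longrightarrow> h a \<in> F"
  shows "\<theta> (\<Sum>a\<in>A. c a *\<^sub>f h a) = (\<Sum>a\<in>A. c a *\<^sub>f \<theta> (h a))"
  using assms(2)
proof (induction A rule: infinite_finite_induct)
  case (insert a A)
  have "(\<Sum>a\<in>A. c a *\<^sub>f h a) \<in> F"
    using insert.prems by (intro stableD(7)[OF stable_finsupp] stableD(5)[OF stable_finsupp]) auto
  moreover have IH: "\<theta> (\<Sum>a\<in>A. c a *\<^sub>f h a) = (\<Sum>a\<in>A. c a *\<^sub>f \<theta> (h a))"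
    using insert.prems by (intro insert.IH) auto
  moreover have "h a \<in> F" "c a *\<^sub>f h a \<in> F"
    using insert.prems stableD(5)[OF stable_finsupp] by auto
  ultimately have "\<theta> (c a *\<^sub>f h a + (\<Sum>a\<in>A. c a *\<^sub>f h a)) = c a *\<^sub>f \<theta> (h a) + (\<Sum>a\<in>A. c a *\<^sub>f \<theta> (h a))"
    using IH ghomD(3)[OF assms(1), of "h a" "c a"] \<open>(\<Sum>a\<in>A. c a *\<^sub>f h a) \<in> F\<close>
    by (subst ghomD(2)[OF assms(1)]) (simp_all del: fscale_apply)
  then show ?case unfolding sum.insert[OF insert.hyps] .
next
  case empty
  show ?case unfolding sum.empty by (rule ghom_zero[OF assms(1)])
next
  case (infinite A)
  show ?case unfolding sum.infinite[OF infinite(1)] by (rule ghom_zero[OF assms(1)])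
qed

lemma ghom_comp: "ghom \<theta> \<Longrightarrow> ghom \<eta> \<Longrightarrow> ghom (\<lambda>f. \<theta> (\<eta> f))"
  unfolding ghom_def by simp

lemma ghom_id: "ghom (\<lambda>f. f)"
  unfolding ghom_def by simp

lemma ghom_minus:
  assumes "ghom \<theta>" "ghom \<eta>" shows "ghom (\<lambda>f. \<theta> f - \<eta> f)"
  unfolding ghom_def
  using stableD(4)[OF stable_finsupp]
  by (simp add: R_diff ghomD[OF assms(1)] ghomD[OF assms(2)] fscale_diff)

text \<open>The summand \<open>T\<close> allows images to be taken modulo \<open>T\<close> without
  forming a quotient.\<close>

lemma ghom_image_plus_stable:
  assumes \<theta>: "ghom \<theta>" and S: "stable S" "S \<subseteq> F" and T: "stable T"
  shows "stable {\<theta> f + t | f t. f \<in> S \<and> t \<in> T}" (is "stable ?M")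
proof (rule stableI)
  have "0 = \<theta> 0 + 0" by (simp add: ghom_zero[OF \<theta>])
  then show "0 \<in> ?M" using stableD(2)[OF S(1)] stableD(2)[OF T] by blast
next
  fix a b assume "a \<in> ?M" "b \<in> ?M"
  then obtain f t f' t' where *: "f \<in> S" "f' \<in> S" "t \<in> T" "t' \<in> T" "a = \<theta> f + t" "b = \<theta> f' + t'"
    by blast
  then have "\<theta> (f + f') = \<theta> f + \<theta> f'" using ghomD(2)[OF \<theta>] S(2) by blast
  then have "a + b = \<theta> (f + f') + (t + t')" using * by (simp add: fun_eq_iff)
  then show "a + b \<in> ?M" using * stableD(3)[OF S(1)] stableD(3)[OF T] by blast
next
  fix c a assume "a \<in> ?M"
  then obtain f t where *: "f \<in> S" "t \<in> T" "a = \<theta> f + t" by blast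
  then have "c *\<^sub>f a = \<theta> (c *\<^sub>f f) + c *\<^sub>f t"
    using ghomD(3)[OF \<theta>, of f c] S(2) by (auto simp: fscale_add)
  then show "c *\<^sub>f a \<in> ?M" using * stableD(5)[OF S(1)] stableD(5)[OF T] by blast
next
  fix g a assume g: "g \<in> carrier G" and "a \<in> ?M"
  then obtain f t where *: "f \<in> S" "t \<in> T" "a = \<theta> f + t" by blast
  then have "R g a = \<theta> (R g f) + R g t"
    using ghomD(4)[OF \<theta> g, of f] S(2) by (auto simp: R_add)
  then show "R g a \<in> ?M" using * g stableD(6)[OF S(1)] stableD(6)[OF T] by blast
qed

lemma stable_vimage:
  assumes \<theta>: "ghom \<theta>" and S: "stable S" "S \<subseteq> F" and M: "stable M"
  shows "stable {f \<in> S. \<theta> f \<in> M}" (is "stable ?W")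
proof (rule stableI)
  show "0 \<in> ?W" using stableD(2)[OF S(1)] stableD(2)[OF M] by (simp add: ghom_zero[OF \<theta>])
next
  fix f h assume "f \<in> ?W" "h \<in> ?W"
  moreover from this have "\<theta> (f + h) = \<theta> f + \<theta> h" using S(2) by (intro ghomD(2)[OF \<theta>]) auto
  ultimately show "f + h \<in> ?W" using stableD(3)[OF S(1)] stableD(3)[OF M] by simp
next
  fix c f assume "f \<in> ?W"
  moreover from this have "\<theta> (c *\<^sub>f f) = c *\<^sub>f \<theta> f" using S(2) by (intro ghomD(3)[OF \<theta>]) auto
  ultimately show "c *\<^sub>f f \<in> ?W" using stableD(5)[OF S(1)] stableD(5)[OF M] by simp
next
  fix g f assume "g \<in> carrier G" "f \<in> ?W"
  moreover from this have "\<theta> (R g f) = R g (\<theta> f)" using S(2) by (intro ghomD(4)[OF \<theta>]) auto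
  ultimately show "R g f \<in> ?W" using stableD(6)[OF S(1)] stableD(6)[OF M] by simp
qed

text \<open>Zorn's lemma applies because \<open>B\<close> is finite: if the union of a chain
  contains \<open>B\<close>, then so does a member of the chain, and by \<open>gen\<close> that
  member is all of \<open>D\<close>.\<close>

lemma exists_maximal:
  assumes T: "stable T" "T \<subset> D" and D: "stable D" and B: "finite B" "B \<subseteq> D"
    and gen: "\<And>M. stable M \<Longrightarrow> T \<subseteq> M \<Longrightarrow> B \<subseteq> M \<Longrightarrow> D \<subseteq> M"
  shows "\<exists>N. maximal_in D N \<and> T \<subseteq> N"
proof -
  define A where "A = {N. stable N \<and> T \<subseteq> N \<and> N \<subseteq> D \<and> \<not> B \<subseteq> N}"
  have "T \<in> A" using T gen[OF T(1)] by (auto simp: A_def)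
  then have "A \<noteq> {}" by auto
  moreover have "\<Union>C \<in> A" if C: "C \<noteq> {}" "subset.chain A C" for C
  proof -
    have st: "\<And>N. N \<in> C \<Longrightarrow> stable N \<and> T \<subseteq> N \<and> N \<subseteq> D \<and> \<not> B \<subseteq> N"
      using C(2) unfolding subset.chain_def A_def by blast
    have lin: "\<And>M N. M \<in> C \<Longrightarrow> N \<in> C \<Longrightarrow> M \<subseteq> N \<or> N \<subseteq> M"
      using C(2) by (auto simp: subset_chain_def)
    have "stable (\<Union>C)"
    proof (rule stableI)
      show "0 \<in> \<Union>C" using C(1) st stableD(2) by blast
    next
      fix f h assume "f \<in> \<Union>C" "h \<in> \<Union>C"
      then obtain M N where "M \<in> C" "N \<in> C" "f \<in> M" "h \<in> N" by blast
      then obtain P where "P \<in> C" "f \<in> P" "h \<in> P" using lin by blast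
      then show "f + h \<in> \<Union>C" using st stableD(3) by blast
    next
      fix c f assume "f \<in> \<Union>C" then show "c *\<^sub>f f \<in> \<Union>C" using st stableD(5) by blast
    next
      fix g f assume "g \<in> carrier G" "f \<in> \<Union>C" then show "R g f \<in> \<Union>C" using st stableD(6) by blast
    qed
    moreover have "\<not> B \<subseteq> \<Union>C"
    proof
      assume "B \<subseteq> \<Union>C"
      then obtain M where "M \<in> C" "B \<subseteq> M"
        using finite_subset_Union_chain[OF B(1) _ C(1), of A] C(2) by blast
      then show False using st by blast
    qed
    ultimately show ?thesis using C(1) st unfolding A_def by blast
  qed
  ultimately obtain N where N: "N \<in> A" "\<forall>M\<in>A. N \<subseteq> M \<longrightarrow> M = N"
    using subset_Zorn_nonempty[of A] by blast
  have "maximal_in D N"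
    unfolding maximal_in_def
  proof (intro conjI allI impI)
    show "stable N" "N \<subset> D" using N(1) B(2) by (auto simp: A_def)
    fix N' assume N': "stable N'" "N \<subseteq> N'" "N' \<subseteq> D"
    show "N' = N \<or> N' = D"
    proof (cases "B \<subseteq> N'")
      case True
      then have "D \<subseteq> N'" using gen[OF N'(1)] N'(2) N(1) by (auto simp: A_def)
      then show ?thesis using N'(3) by blast
    next
      case False
      then show ?thesis using N N' unfolding A_def by blast
    qed
  qed
  then show ?thesis using N(1) unfolding A_def by blast
qed

text \<open>By maximality of \<open>N\<close>, the image of \<open>E\<close> together with
  \<open>N\<close> spans \<open>D\<close>. So \<open>E\<close> modulo the preimage of
  \<open>N\<close> is isomorphic to the simple \<open>D / N\<close>, although
  \<open>\<theta>\<close> need not be onto \<open>D\<close>.\<close>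

lemma maximal_pullback:
  assumes max: "maximal_in D N" and D: "stable D" and \<theta>: "ghom \<theta>" and E: "stable E" "E \<subseteq> F"
    and img: "\<theta> ` E \<subseteq> D" "\<not> \<theta> ` E \<subseteq> N" and T: "\<theta> ` (E \<inter> T) \<subseteq> N"
  shows "\<exists>W. maximal_in E W \<and> E \<inter> T \<subseteq> W"
proof -
  define W where "W = {u \<in> E. \<theta> u \<in> N}"
  have N: "stable N" using max by (simp add: maximal_in_def)
  have W: "stable W" unfolding W_def by (rule stable_vimage[OF \<theta> E N])
  have "maximal_in E W"
    unfolding maximal_in_def
  proof (intro conjI allI impI)
    show "stable W" "W \<subset> E" using W img(2) by (auto simp: W_def)
    fix W' assume W': "stable W'" "W \<subseteq> W'" "W' \<subseteq> E"
    define N' where "N' = {\<theta> f + t | f t. f \<in> W' \<and> t \<in> N}"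
    have "stable N'" unfolding N'_def
      using ghom_image_plus_stable[OF \<theta> W'(1) _ N] W'(3) E(2) by blast
    moreover have "N \<subseteq> N'"
    proof
      fix t assume "t \<in> N"
      moreover have "t = \<theta> 0 + t" by (simp add: ghom_zero[OF \<theta>])
      ultimately show "t \<in> N'" unfolding N'_def using stableD(2)[OF W'(1)] by blast
    qed
    moreover have "N' \<subseteq> D"
    proof
      fix x assume "x \<in> N'"
      then obtain f t where "f \<in> W'" "t \<in> N" "x = \<theta> f + t" unfolding N'_def by blast
      then show "x \<in> D"
        using W'(3) img(1) max stableD(3)[OF D] unfolding maximal_in_def by blast
    qed
    ultimately consider "N' = N" | "N' = D" using max unfolding maximal_in_def by blast
    then show "W' = W \<or> W' = E"
    proof cases
      case 1
      have "W' \<subseteq> W"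
      proof
        fix u assume u: "u \<in> W'"
        have "\<theta> u = \<theta> u + 0" by simp
        then have "\<theta> u \<in> N'" unfolding N'_def using u stableD(2)[OF N] by blast
        then show "u \<in> W" using 1 u W'(3) by (auto simp: W_def)
      qed
      then show ?thesis using W'(2) by blast
    next
      case 2
      have "E \<subseteq> W'"
      proof
        fix u assume u: "u \<in> E"
        then have "\<theta> u \<in> N'" using 2 img(1) by blast
        then obtain w n where w: "w \<in> W'" "n \<in> N" "\<theta> u = \<theta> w + n" unfolding N'_def by blast
        have "\<theta> (u - w) = n" using ghom_diff[OF \<theta>, of u w] w u W'(3) E(2) by auto
        then have "u - w \<in> W" using w u W'(3) stableD(4)[OF E(1)] by (auto simp: W_def)
        then have "(u - w) + w \<in> W'" using W' w stableD(3)[OF W'(1)] by blast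
        then show "u \<in> W'" by simp
      qed
      then show ?thesis using W'(3) by blast
    qed
  qed
  moreover have "E \<inter> T \<subseteq> W" using T by (auto simp: W_def)
  ultimately show ?thesis by blast
qed

text \<open>The linear extension of the assignment of \<open>s x\<close> to the point mass at
  \<open>x\<close>.\<close>

definition lift :: "('x \<Rightarrow> 'x \<Rightarrow> complex) \<Rightarrow> ('x \<Rightarrow> complex) \<Rightarrow> 'x \<Rightarrow> complex"
  where "lift s f = (\<Sum>x\<in>supp f. f x *\<^sub>f s x)"

lemma lift_superset:
  assumes "finite A" "supp f \<subseteq> A" shows "lift s f = (\<Sum>x\<in>A. f x *\<^sub>f s x)"
  unfolding lift_def using assms by (intro sum.mono_neutral_left) (auto simp: supp_def)

text \<open>By \<open>R_delta\<close>, the hypothesis \<open>eq\<close> is equivariance on point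
  masses, and these span.\<close>

lemma ghom_lift:
  assumes s: "\<And>x. x \<in> \<Omega> \<Longrightarrow> s x \<in> F"
    and eq: "\<And>x g. x \<in> \<Omega> \<Longrightarrow> g \<in> carrier G \<Longrightarrow> R g (s x) = s (act x (inv g))"
  shows "ghom (lift s)"
  unfolding ghom_def
proof (intro conjI ballI allI)
  fix f assume f: "f \<in> F"
  note fin = finsuppD[OF f]
  show "lift s f \<in> F" unfolding lift_def
    using s fin by (intro stableD(7)[OF stable_finsupp] stableD(5)[OF stable_finsupp]) auto
  show "lift s (c *\<^sub>f f) = c *\<^sub>f lift s f" for c
    by (subst lift_superset[of "supp f"])
      (use fin in \<open>auto simp: supp_def lift_def fscale_sum fscale_fscale\<close>)
  show "lift s (f + h) = lift s f + lift s h" if h: "h \<in> F" for h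
  proof -
    have A: "finite (supp f \<union> supp h)" using fin finsuppD[OF h] by simp
    show ?thesis
      by (subst (1 2 3) lift_superset[OF A])
        (auto simp: supp_def sum.distrib[symmetric] fscale_add_left)
  qed
  show "lift s (R g f) = R g (lift s f)" if g: "g \<in> carrier G" for g
  proof -
    let ?i = "\<lambda>y. act y (inv g)"
    have inj: "inj_on ?i (supp f)"
      by (rule inj_on_inverseI[where g = "\<lambda>y. act y g"]) (use fin(2) g in auto)
    have sub: "supp (R g f) \<subseteq> ?i ` supp f"
    proof
      fix x assume "x \<in> supp (R g f)"
      then have "x \<in> \<Omega>" "act x g \<in> supp f" by (auto simp: supp_def R_def split: if_splits)
      then show "x \<in> ?i ` supp f" using g by (intro image_eqI[of _ _ "act x g"]) auto
    qed
    have "lift s (R g f) = (\<Sum>x\<in>?i ` supp f. R g f x *\<^sub>f s x)"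
      using fin(1) sub by (intro lift_superset) auto
    also have "\<dots> = (\<Sum>y\<in>supp f. R g f (?i y) *\<^sub>f s (?i y))"
      using inj by (simp add: sum.reindex)
    also have "\<dots> = (\<Sum>y\<in>supp f. f y *\<^sub>f R g (s y))"
      using fin(2) g eq act_closed by (intro sum.cong) (auto simp: R_def subset_iff)
    finally show ?thesis by (simp add: lift_def R_sum R_scale)
  qed
qed

text \<open>A translate of \<open>f\<close> is determined by where the finitely many points of its
  support go, and each has finitely many possible images. Inverses enter because translation by
  \<open>g\<close> moves supports by \<open>inv g\<close>.\<close>

lemma finite_orbit:
  assumes H: "H \<subseteq> carrier G" "\<And>g. g \<in> H \<Longrightarrow> inv g \<in> H" and f: "f \<in> F"
    and fin: "\<And>y. y \<in> \<Omega> \<Longrightarrow> finite {act y g | g. g \<in> H}"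
  shows "finite {R g f | g. g \<in> H}"
proof -
  let ?P = "PiE (supp f) (\<lambda>y. {act y g | g. g \<in> H})"
  let ?m = "\<lambda>p. \<Sum>y\<in>supp f. f y *\<^sub>f delta (p y)"
  note fd = finsuppD[OF f]
  have "{R g f | g. g \<in> H} \<subseteq> ?m ` ?P"
  proof clarify
    fix g assume g: "g \<in> H"
    have "R g f = R g (\<Sum>x\<in>supp f. f x *\<^sub>f delta x)" using finsupp_expand[OF f] by simp
    also have "\<dots> = (\<Sum>x\<in>supp f. f x *\<^sub>f R g (delta x))" by (simp add: R_sum R_scale)
    also have "\<dots> = (\<Sum>x\<in>supp f. f x *\<^sub>f delta (act x (inv g)))"
      using g H(1) fd(2) by (intro sum.cong arg_cong[of _ _ "fscale _"] refl R_delta) auto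
    also have "\<dots> = ?m (\<lambda>y\<in>supp f. act y (inv g))" by (intro sum.cong) auto
    finally have "R g f = ?m (\<lambda>y\<in>supp f. act y (inv g))" .
    moreover have "(\<lambda>y\<in>supp f. act y (inv g)) \<in> ?P"
      unfolding restrict_PiE_iff using H(2)[OF g] by blast
    ultimately show "R g f \<in> ?m ` ?P" by (rule image_eqI)
  qed
  moreover have "finite ?P" using fd fin by (intro finite_PiE) auto
  ultimately show ?thesis using finite_surj by blast
qed

text \<open>The mean over the finite orbit of \<open>f\<close> replaces an integral over
  \<open>H\<close>, which may be infinite. The second property says that a congruence modulo a
  subspace shared by all translates of \<open>f\<close> is inherited by the mean.\<close>

lemma average:
  assumes H: "subgroup H G" and fin: "finite {R g f | g. g \<in> H}" and f: "f \<in> F"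
  obtains q where "\<And>h. h \<in> H \<Longrightarrow> R h q = q"
    "\<And>U p. fsubspace U \<Longrightarrow> (\<And>g. g \<in> H \<Longrightarrow> R g f - p \<in> U) \<Longrightarrow> q - p \<in> U"
proof
  let ?O = "{R g f | g. g \<in> H}"
  define q where "q = (1 / of_nat (card ?O)) *\<^sub>f (\<Sum>o'\<in>?O. o')"
  have sub: "H \<subseteq> carrier G" using H by (rule subgroup.subset)
  have "R \<one> f \<in> ?O" using subgroup.one_closed[OF H] by blast
  then have ne: "card ?O \<noteq> 0" using fin card_gt_0_iff[of ?O] by blast
  show "R h q = q" if h: "h \<in> H" for h
  proof -
    have OF: "u \<in> F" if "u \<in> ?O" for u using that f sub by auto
    have "inj_on (R h) ?O"
    proof (rule inj_on_inverseI[where g = "R (inv h)"])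
      fix u assume "u \<in> ?O"
      then show "R (inv h) (R h u) = u" using OF h sub R_inv(1)[of h u] by (simp add: subset_iff)
    qed
    moreover have "R h ` ?O \<subseteq> ?O"
    proof clarify
      fix g assume g: "g \<in> H"
      have "R h (R g f) = R (h \<otimes> g) f" 
        using g h sub R_mult[of h g f] by (simp add: subset_iff)
      then show "\<exists>g'. R h (R g f) = R g' f \<and> g' \<in> H" using subgroup.m_closed[OF H h g] by blast
    qed
    ultimately have "bij_betw (R h) ?O ?O" using fin by (simp add: bij_betw_def endo_inj_surj)
    then have "(\<Sum>o'\<in>?O. R h o') = (\<Sum>o'\<in>?O. o')" by (rule sum.reindex_bij_betw)
    then show ?thesis unfolding q_def R_scale R_sum by (rule arg_cong)
  qed
  show "q - p \<in> U" if U: "fsubspace U" and p: "\<And>g. g \<in> H \<Longrightarrow> R g f - p \<in> U" for U p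
  proof -
    let ?c = "of_nat (card ?O) :: complex"
    have "q - p = (1 / ?c) *\<^sub>f (\<Sum>o'\<in>?O. o' - p)"
    proof
      fix x
      have "(\<Sum>o'\<in>?O. o' - p) x = (\<Sum>o'\<in>?O. o' x) - ?c * p x"
        unfolding sum_fun_apply minus_apply sum_subtractf by (subst sum_constant) (rule refl)
      then show "(q - p) x = ((1 / ?c) *\<^sub>f (\<Sum>o'\<in>?O. o' - p)) x"
        using ne by (simp only: q_def minus_apply fscale_apply sum_fun_apply) (simp add: field_simps)
    qed
    moreover have "(\<Sum>o'\<in>?O. o' - p) \<in> U" using p by (intro fsubspaceD(5)[OF U]) auto
    then have "(1 / ?c) *\<^sub>f (\<Sum>o'\<in>?O. o' - p) \<in> U" by (rule fsubspaceD(3)[OF U])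
    ultimately show ?thesis by (simp only:)
  qed
qed

end

section \<open>Maximal submodules of direct summands\<close>

context right_action begin

lemma stabilizer_subgroup:
  assumes x: "x \<in> \<Omega>" shows "subgroup {g \<in> carrier G. act x g = x} G"
proof (rule subgroup.intro)
  show "\<one> \<in> {g \<in> carrier G. act x g = x}" using act_one[OF x] by simp
next
  fix g h assume g: "g \<in> {g \<in> carrier G. act x g = x}" and h: "h \<in> {g \<in> carrier G. act x g = x}"
  have "act x (g \<otimes> h) = act (act x g) h" using g h by (intro act_mult x) auto
  then show "g \<otimes> h \<in> {g \<in> carrier G. act x g = x}" using g h by simp
next
  fix g assume g: "g \<in> {g \<in> carrier G. act x g = x}"
  have "act (act x g) (inv g) = x" using g by (intro act_inv(1) x) auto
  then show "inv g \<in> {g \<in> carrier G. act x g = x}" using g by simp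
qed auto

text \<open>Bass' argument that a nonzero projective module has a maximal submodule. The image \<open>E\<close> of the
  idempotent \<open>e\<close> is, modulo \<open>T\<close>, a direct summand of the sum of the cyclic projective modules
  spanned by the single orbits.\<close>

theorem exists_maximal_in_summand:
  assumes suborbits: "\<And>x y. x \<in> \<Omega> \<Longrightarrow> y \<in> \<Omega> \<Longrightarrow> finite {act y g | g. g \<in> carrier G \<and> act x g = x}"
    and e: "ghom e" "e ` F \<subseteq> E" "\<And>f. f \<in> E \<Longrightarrow> e f = f"
    and E: "stable E" "E \<subseteq> F"
    and T: "stable T" "\<And>\<theta>. ghom \<theta> \<Longrightarrow> \<theta> ` (T \<inter> F) \<subseteq> T"
    and ne: "\<not> E \<subseteq> T"
  shows "\<exists>W. maximal_in E W \<and> E \<inter> T \<subseteq> W"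
proof -
  obtain v where v: "v \<in> E" "v \<notin> T" using ne by blast
  then have vF: "v \<in> F" using E by blast
  \<comment> \<open>Finitely many orbits meet the support of \<open>v\<close>, so the functions
    living on \<open>S\<close> form a finitely generated module.\<close>
  define S where "S = (\<Union>x\<in>supp v. {act x g | g. g \<in> carrier G})"
  have S_sub: "S \<subseteq> \<Omega>" using finsuppD(2)[OF vF] act_closed by (auto simp: S_def)
  have S_act: "act x g \<in> S \<longleftrightarrow> x \<in> S" if "x \<in> \<Omega>" "g \<in> carrier G" for x g
  proof
    assume "x \<in> S"
    then obtain y h where y: "y \<in> supp v" "h \<in> carrier G" "x = act y h" by (auto simp: S_def)
    then have "act x g = act y (h \<otimes> g)" using that finsuppD(2)[OF vF] by (auto simp: act_mult)
    then show "act x g \<in> S" using y that by (auto simp: S_def)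
  next
    assume "act x g \<in> S"
    then obtain y h where y: "y \<in> supp v" "h \<in> carrier G" "act x g = act y h" by (auto simp: S_def)
    have "x = act (act x g) (inv g)" using that by simp
    also have "\<dots> = act (act y h) (inv g)" using y(3) by simp
    also have "\<dots> = act y (h \<otimes> inv g)" using y that finsuppD(2)[OF vF] by (auto simp: act_mult)
    finally show "x \<in> S" using y that by (auto simp: S_def)
  qed
  have supp_v: "supp v \<subseteq> S"
  proof
    fix x assume x: "x \<in> supp v"
    then have "act x \<one> = x" using act_one finsuppD(2)[OF vF] by auto
    moreover have "act x \<one> \<in> S" using x by (auto simp: S_def)
    ultimately show "x \<in> S" by simp
  qed

  define pr where "pr f = (\<lambda>x. if x \<in> S then f x else (0::complex))" for f
  have prF: "pr f \<in> F" if "f \<in> F" for f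
    by (rule finsuppI[of "supp f"]) (use finsuppD[OF that] in \<open>auto simp: pr_def supp_def\<close>)
  have pr: "ghom pr"
    unfolding ghom_def
  proof (intro conjI ballI allI)
    fix f g assume "f \<in> F" and g: "g \<in> carrier G"
    show "pr (R g f) = R g (pr f)"
      using S_act[OF _ g] S_sub by (auto simp: pr_def R_def fun_eq_iff)
  qed (use prF in \<open>auto simp: pr_def fun_eq_iff\<close>)
  define FS where "FS = F \<inter> {f. \<forall>x. x \<notin> S \<longrightarrow> f x = 0}"
  have FS_F: "FS \<subseteq> F" by (auto simp: FS_def)
  have pr_FS: "pr f \<in> FS" if "f \<in> F" for f using prF[OF that] by (auto simp: FS_def pr_def)
  have pr_id: "pr f = f" if "f \<in> FS" for f using that by (auto simp: FS_def pr_def fun_eq_iff)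
  have FS: "stable FS"
  proof -
    have "FS = pr ` F" using pr_FS pr_id FS_F by (auto simp: image_iff intro!: bexI pr_id[symmetric])
    also have "\<dots> = {pr f + t | f t. f \<in> F \<and> t \<in> {0}}" by auto
    finally have "FS = {pr f + t | f t. f \<in> F \<and> t \<in> {0}}" .
    moreover have "stable {0}" by (rule stableI) (auto simp: R_zero)
    ultimately show ?thesis using ghom_image_plus_stable[OF pr stable_finsupp subset_refl, of "{0}"] by simp
  qed
  define TS where "TS = T \<inter> FS"
  have TS: "stable TS" unfolding TS_def by (rule stable_Int[OF T(1) FS])
  have TS_FS: "TS \<subseteq> FS" by (simp add: TS_def)
  have TS_ghom: "\<theta> f \<in> TS" if "ghom \<theta>" "\<And>f. f \<in> FS \<Longrightarrow> \<theta> f \<in> FS" "f \<in> TS" for \<theta> f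
    using that T(2)[OF that(1)] FS_F by (auto simp: TS_def)
  have TS_pr: "pr f \<in> TS" if "f \<in> F" "f \<in> T" for f
    using that T(2)[OF pr] pr_FS by (auto simp: TS_def)

  \<comment> \<open>The compression of the idempotent to \<open>S\<close>, in general no longer
    idempotent. The proof splits on whether 1 - \<open>\<phi>\<close>, called \<open>d\<close>, is
    onto \<open>FS\<close> modulo \<open>TS\<close>.\<close>
  define \<phi> where "\<phi> f = pr (e f)" for f
  define d where "d f = f - \<phi> f" for f
  have \<phi>: "ghom \<phi>" unfolding \<phi>_def by (rule ghom_comp[OF pr e(1)])
  have d: "ghom d" unfolding d_def by (rule ghom_minus[OF ghom_id \<phi>])
  have \<phi>FS: "\<phi> f \<in> FS" if "f \<in> F" for f
    using pr_FS ghomD(1)[OF e(1)] that by (auto simp: \<phi>_def)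
  have dFS: "d f \<in> FS" if "f \<in> FS" for f
    using that \<phi>FS FS_F stableD(4)[OF FS] by (auto simp: d_def)
  define B where "B = delta ` supp v"
  have delta_FS: "delta x \<in> FS" if "x \<in> S" for x
  proof -
    have "delta x \<in> F" using that S_sub by (intro delta_finsupp) auto
    then show ?thesis using that by (auto simp: FS_def delta_def)
  qed
  have B: "finite B" "B \<subseteq> FS"
    using finsuppD(1)[OF vF] supp_v delta_FS by (auto simp: B_def)
  have genB: "FS \<subseteq> M" if M: "stable M" "B \<subseteq> M" for M
  proof
    fix f assume f: "f \<in> FS"
    have "delta x \<in> M" if x: "x \<in> S" for x
    proof -
      obtain y g where y: "y \<in> supp v" "g \<in> carrier G" "x = act y g" using x unfolding S_def by blast
      then have "R (inv g) (delta y) = delta x" using finsuppD(2)[OF vF] R_delta[of y "inv g"] by auto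
      moreover have "delta y \<in> M" using y M by (auto simp: B_def)
      ultimately show ?thesis using stableD(6)[OF M(1), of "inv g"] y by fastforce
    qed
    moreover have "supp f \<subseteq> S" using f by (auto simp: FS_def supp_def)
    ultimately have "(\<Sum>x\<in>supp f. f x *\<^sub>f delta x) \<in> M"
      by (intro stableD(7)[OF M(1)] stableD(5)[OF M(1)]) auto
    moreover have "f \<in> F" using f FS_F by blast
    ultimately show "f \<in> M" by (simp only: finsupp_expand)
  qed

  define M where "M = {d f + t | f t. f \<in> FS \<and> t \<in> TS}"
  have M: "stable M" unfolding M_def by (rule ghom_image_plus_stable[OF d FS FS_F TS])
  have M_FS: "M \<subseteq> FS" using dFS TS_FS stableD(3)[OF FS] by (auto simp: M_def)
  have TS_M: "TS \<subseteq> M"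
  proof
    fix t assume "t \<in> TS"
    moreover have "t = d 0 + t" by (simp add: ghom_zero[OF d])
    ultimately show "t \<in> M" unfolding M_def using stableD(2)[OF FS] by blast
  qed
  have d_M: "d f \<in> M" if "f \<in> FS" for f
  proof -
    have "d f = d f + 0" by simp
    then show ?thesis unfolding M_def using that stableD(2)[OF TS] by blast
  qed

  show ?thesis
  proof (cases "M = FS")
    \<comment> \<open>A maximal submodule above the image of \<open>d\<close> suffices here: modulo
      it every \<open>f\<close> in \<open>FS\<close> agrees with \<open>\<phi> f\<close>, which is a
      value of \<open>pr\<close> on \<open>E\<close>.\<close>
    case False
    then have "M \<subset> FS" using M_FS by blast
    then obtain N where N: "maximal_in FS N" "M \<subseteq> N"
      using exists_maximal[OF M _ FS B] genB by blast
    have N': "stable N" "N \<subset> FS" using N(1) by (auto simp: maximal_in_def)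
    show ?thesis
    proof (rule maximal_pullback[OF N(1) FS pr E])
      show "pr ` E \<subseteq> FS" using pr_FS E(2) by blast
      show "pr ` (E \<inter> T) \<subseteq> N" using TS_pr E(2) TS_M N(2) by blast
      show "\<not> pr ` E \<subseteq> N"
      proof
        assume sub: "pr ` E \<subseteq> N"
        have "FS \<subseteq> N"
        proof
          fix f assume f: "f \<in> FS"
          have "\<phi> f \<in> N" using sub e(2) f FS_F unfolding \<phi>_def by blast
          moreover have "d f \<in> N" using d_M[OF f] N(2) by blast
          ultimately have "d f + \<phi> f \<in> N" using stableD(3)[OF N'(1)] by blast
          then show "f \<in> N" by (simp add: d_def)
        qed
        then show False using N'(2) by blast
      qed
    qed
  next
    case True
    \<comment> \<open>Here projectivity of \<open>FS\<close> enters: a preimage of a point mass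
      modulo \<open>TS\<close> can be averaged over the stabilizer of the point, and is then fit to
      define an equivariant section.\<close>
    have "\<exists>q\<in>FS. d q - delta x \<in> TS \<and> (\<forall>g\<in>carrier G. act x g = x \<longrightarrow> R g q = q)" if x: "x \<in> S" for x
    proof -
      have x\<Omega>: "x \<in> \<Omega>" using x S_sub by blast
      have "delta x \<in> FS" using x by (rule delta_FS)
      then obtain q0 t where q0: "q0 \<in> FS" "t \<in> TS" "delta x = d q0 + t"
        using True unfolding M_def by blast
      then have q0F: "q0 \<in> F" using FS_F by blast
      have dq0: "d q0 - delta x \<in> TS" using q0 stableD(4)[OF TS stableD(2)[OF TS] q0(2)] by simp
      let ?H = "{g \<in> carrier G. act x g = x}"
      have H: "subgroup ?H G" by (rule stabilizer_subgroup[OF x\<Omega>])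
      have "finite {R g q0 | g. g \<in> ?H}"
        using subgroup.m_inv_closed[OF H] suborbits[OF x\<Omega>] by (intro finite_orbit[OF _ _ q0F]) auto
      then obtain q where q: "\<And>h. h \<in> ?H \<Longrightarrow> R h q = q"
        "\<And>U p. fsubspace U \<Longrightarrow> (\<And>g. g \<in> ?H \<Longrightarrow> R g q0 - p \<in> U) \<Longrightarrow> q - p \<in> U"
        using average[OF H _ q0F] by blast
      \<comment> \<open>Translates of \<open>q0\<close> by the stabilizer differ from
        \<open>q0\<close> by elements of \<open>U\<close>, so averaging leaves \<open>d q0\<close>
        unchanged modulo \<open>TS\<close>.\<close>
      define U where "U = {f \<in> FS. d f \<in> TS}"
      have "fsubspace U" unfolding U_def by (rule stableD(1)[OF stable_vimage[OF d FS FS_F TS]])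
      moreover have "R g q0 - q0 \<in> U" if g: "g \<in> ?H" for g
      proof -
        have "R g q0 - q0 \<in> FS" using g q0 stableD(4,6)[OF FS] by blast
        moreover have "R g (d q0 - delta x) = R g (d q0) - delta x"
          using g x\<Omega> R_delta[OF x\<Omega>, of g] subgroup.m_inv_closed[OF H g] by (simp add: R_diff)
        then have "d (R g q0 - q0) = R g (d q0 - delta x) - (d q0 - delta x)"
          using g q0F ghom_diff[OF d, of "R g q0" q0] ghomD(4)[OF d, of g q0] by simp
        then have "d (R g q0 - q0) \<in> TS" using stableD(4,6)[OF TS] dq0 g by auto
        ultimately show ?thesis by (simp add: U_def)
      qed
      ultimately have "q - q0 \<in> U" by (rule q(2))
      then have qq: "q - q0 \<in> FS" "d (q - q0) \<in> TS" by (auto simp: U_def)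
      have qFS: "q \<in> FS" using stableD(3)[OF FS qq(1) q0(1)] by simp
      then have "d (q - q0) = d q - d q0" using FS_F by (intro ghom_diff[OF d _ q0F]) auto
      then have "d q - delta x \<in> TS" using stableD(3)[OF TS qq(2) dq0] by simp
      then show ?thesis using q(1) qFS by blast
    qed
    then obtain q where q: "\<And>x. x \<in> S \<Longrightarrow> q x \<in> FS" "\<And>x. x \<in> S \<Longrightarrow> d (q x) - delta x \<in> TS"
      "\<And>x g. x \<in> S \<Longrightarrow> g \<in> carrier G \<Longrightarrow> act x g = x \<Longrightarrow> R g (q x) = q x"
      by metis

    define orb where "orb x = {act x g | g. g \<in> carrier G}" for x
    \<comment> \<open>The choice depends on the set \<open>orb x\<close> only, so \<open>r\<close>
      is constant on orbits.\<close>
    define r where "r x = (SOME y. y \<in> orb x)" for x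
    have orb_act: "orb (act x g) = orb x" if "x \<in> \<Omega>" "g \<in> carrier G" for x g
    proof
      show "orb (act x g) \<subseteq> orb x" using that by (auto simp: orb_def act_mult[symmetric])
      show "orb x \<subseteq> orb (act x g)"
      proof
        fix y assume "y \<in> orb x"
        then obtain h where h: "h \<in> carrier G" "y = act x h" by (auto simp: orb_def)
        then have "y = act (act x g) (inv g \<otimes> h)"
          using that act_closed by (subst act_mult) auto
        then show "y \<in> orb (act x g)" using h that by (auto simp: orb_def)
      qed
    qed
    have r_act: "r (act x g) = r x" if "x \<in> \<Omega>" "g \<in> carrier G" for x g
      using orb_act[OF that] by (simp add: r_def)
    have "\<exists>g\<in>carrier G. act (r x) g = x" if "x \<in> \<Omega>" for x
    proof -
      have "act x \<one> \<in> orb x" by (auto simp: orb_def)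
      then have "r x \<in> orb x" unfolding r_def by (rule someI)
      then obtain g where "g \<in> carrier G" "r x = act x g" by (auto simp: orb_def)
      then show ?thesis using that by (intro bexI[of _ "inv g"]) auto
    qed
    then obtain k where k: "\<And>x. x \<in> \<Omega> \<Longrightarrow> k x \<in> carrier G" "\<And>x. x \<in> \<Omega> \<Longrightarrow> act (r x) (k x) = x"
      by metis
    have rS: "r x \<in> S" if "x \<in> S" for x
    proof -
      have "x \<in> \<Omega>" using that S_sub by blast
      moreover have "act x \<one> \<in> orb x" by (auto simp: orb_def)
      then have "r x \<in> orb x" unfolding r_def by (rule someI)
      ultimately show ?thesis using S_act that by (auto simp: orb_def)
    qed
    \<comment> \<open>The preimage at the representative is transported along \<open>k x\<close>.
      Its invariance under the stabilizer of \<open>r x\<close> makes the result independent of the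
      choice of \<open>k x\<close>, and this yields equivariance.\<close>
    define s where "s x = (if x \<in> S then R (inv (k x)) (q (r x)) else 0)" for x
    have sFS: "s x \<in> FS" if "x \<in> \<Omega>" for x
      using that q(1) rS k(1) stableD(2,6)[OF FS] by (auto simp: s_def)
    have s_eq: "R g (s x) = s (act x (inv g))" if x: "x \<in> \<Omega>" and g: "g \<in> carrier G" for x g
    proof (cases "x \<in> S")
      case True
      let ?y = "act x (inv g)"
      have y: "?y \<in> \<Omega>" "?y \<in> S" "r ?y = r x" using x g True S_act act_closed r_act by auto
      have rx: "r x \<in> S" "r x \<in> \<Omega>" using rS[OF True] S_sub by auto
      have kx: "k x \<in> carrier G" "k ?y \<in> carrier G" using k(1) x y(1) by auto
      \<comment> \<open>The discrepancy between the two transporters; it fixes \<open>r x\<close>,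
        hence also \<open>q (r x)\<close>.\<close>
      define h where "h = k ?y \<otimes> (g \<otimes> inv (k x))"
      have h: "h \<in> carrier G" using kx g by (simp add: h_def)
      have "act (r x) h = act (act (act (r x) (k ?y)) g) (inv (k x))"
        using rx kx g act_closed by (simp add: h_def act_mult)
      also have "act (r x) (k ?y) = ?y" using k(2)[OF y(1)] y(3) by simp
      also have "act (act ?y g) (inv (k x)) = r x"
        using x g rx(2) kx(1) k(2)[OF x] act_inv(1)[of "r x" "k x"] by simp
      finally have "R h (q (r x)) = q (r x)" using q(3) rx h by blast
      moreover have "inv (k ?y) \<otimes> h = g \<otimes> inv (k x)" using kx g by (simp add: h_def m_assoc[symmetric])
      moreover have "q (r x) \<in> F" using q(1) rx FS_F by blast
      ultimately have "R (g \<otimes> inv (k x)) (q (r x)) = R (inv (k ?y)) (q (r x))"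
        using R_mult[of "inv (k ?y)" h "q (r x)"] kx h by simp
      then show ?thesis using True y g kx by (simp add: s_def R_mult)
    next
      case False
      then have "act x (inv g) \<notin> S" using S_act x g by auto
      then show ?thesis using False by (simp add: s_def R_zero)
    qed
    have ds: "d (s x) - delta x \<in> TS" if x: "x \<in> S" for x
    proof -
      have x': "x \<in> \<Omega>" using x S_sub by blast
      have rx: "r x \<in> S" "r x \<in> \<Omega>" using rS[OF x] S_sub by auto
      have kx: "k x \<in> carrier G" "inv (k x) \<in> carrier G" using k(1) x' by auto
      have "q (r x) \<in> F" using q(1) rx FS_F by blast
      then have "d (s x) - delta x = R (inv (k x)) (d (q (r x)) - delta (r x))"
        using x kx rx k(2)[OF x'] ghomD(4)[OF d kx(2)] by (simp add: s_def R_diff R_delta)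
      then show ?thesis using q(2)[OF rx(1)] stableD(6)[OF TS] kx by auto
    qed
    define \<sigma> where "\<sigma> = lift s"
    have \<sigma>: "ghom \<sigma>" unfolding \<sigma>_def using sFS FS_F s_eq by (intro ghom_lift) auto
    have \<sigma>FS: "\<sigma> f \<in> FS" if "f \<in> F" for f
      unfolding \<sigma>_def lift_def using sFS finsuppD(2)[OF that]
      by (intro stableD(7)[OF FS] stableD(5)[OF FS]) auto
    have d\<sigma>: "d (\<sigma> f) - f \<in> TS" if f: "f \<in> FS" for f
    proof -
      have fF: "f \<in> F" using f FS_F by blast
      have sub: "supp f \<subseteq> S" using f by (auto simp: FS_def supp_def)
      have "d (\<sigma> f) = (\<Sum>x\<in>supp f. f x *\<^sub>f d (s x))"
        unfolding \<sigma>_def lift_def using sFS FS_F finsuppD(2)[OF fF] by (intro ghom_sum[OF d]) auto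
      then have "d (\<sigma> f) - f = (\<Sum>x\<in>supp f. f x *\<^sub>f d (s x)) - (\<Sum>x\<in>supp f. f x *\<^sub>f delta x)"
        by (simp only: finsupp_expand[OF fF])
      also have "\<dots> = (\<Sum>x\<in>supp f. f x *\<^sub>f (d (s x) - delta x))"
        by (simp only: fscale_diff sum_subtractf)
      also have "\<dots> \<in> TS" using ds sub by (intro stableD(7)[OF TS] stableD(5)[OF TS]) auto
      finally show ?thesis .
    qed

    \<comment> \<open>Since \<open>\<sigma>\<close> is a section of \<open>d\<close> modulo
      \<open>TS\<close>, this is, modulo \<open>TS\<close>, the projection onto the kernel of
      \<open>d\<close> along the image of \<open>\<sigma>\<close>.\<close>
    define \<rho> where "\<rho> f = f - \<sigma> (d f)" for f
    have \<rho>: "ghom \<rho>" unfolding \<rho>_def by (rule ghom_minus[OF ghom_id ghom_comp[OF \<sigma> d]])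
    have \<rho>FS: "\<rho> f \<in> FS" if "f \<in> FS" for f
      using that \<sigma>FS ghomD(1)[OF d] FS_F stableD(4)[OF FS] by (auto simp: \<rho>_def)
    have \<rho>TS: "\<rho> f \<in> TS" if "f \<in> TS" for f by (rule TS_ghom[OF \<rho> \<rho>FS that])
    have \<sigma>TS: "\<sigma> f \<in> TS" if "f \<in> TS" for f by (rule TS_ghom[OF \<sigma> _ that]) (use \<sigma>FS FS_F in blast)
    have d\<rho>: "d (\<rho> f) \<in> TS" if f: "f \<in> FS" for f
    proof -
      have "d (\<rho> f) = d f - d (\<sigma> (d f))"
        unfolding \<rho>_def using f FS_F \<sigma>FS ghomD(1)[OF d] by (intro ghom_diff[OF d]) auto
      moreover have "0 - (d (\<sigma> (d f)) - d f) \<in> TS"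
        by (intro stableD(4)[OF TS] stableD(2)[OF TS] d\<sigma> dFS f)
      ultimately show ?thesis by simp
    qed
    \<comment> \<open>Both \<open>e\<close> and \<open>pr\<close> fix \<open>v\<close>, so
      \<open>d\<close> kills it; as \<open>v\<close> is not in \<open>T\<close>, the kernel of
      \<open>d\<close> is nonzero modulo \<open>TS\<close>.\<close>
    have \<rho>v: "\<rho> v = v"
    proof -
      have "pr v = v" using supp_v by (auto simp: pr_def supp_def fun_eq_iff)
      then have "d v = 0" using e(3)[OF v(1)] by (simp add: d_def \<phi>_def)
      then show ?thesis by (simp add: \<rho>_def ghom_zero[OF \<sigma>])
    qed
    have vFS: "v \<in> FS" using vF supp_v by (auto simp: FS_def supp_def)

    \<comment> \<open>The kernel of \<open>d\<close> modulo \<open>TS\<close>. As an image of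
      \<open>FS\<close> it is finitely generated over \<open>TS\<close>.\<close>
    define D where "D = {\<rho> f + t | f t. f \<in> FS \<and> t \<in> TS}"
    have D: "stable D" unfolding D_def by (rule ghom_image_plus_stable[OF \<rho> FS FS_F TS])
    have \<rho>D: "\<rho> f \<in> D" if "f \<in> FS" for f
    proof -
      have "\<rho> f = \<rho> f + 0" by simp
      then show ?thesis unfolding D_def using that stableD(2)[OF TS] by blast
    qed
    have "TS \<subseteq> D"
    proof
      fix t assume "t \<in> TS"
      moreover have "t = \<rho> 0 + t" by (simp add: ghom_zero[OF \<rho>])
      ultimately show "t \<in> D" unfolding D_def using stableD(2)[OF FS] by blast
    qed
    moreover have "v \<in> D" using \<rho>D[OF vFS] \<rho>v by simp
    ultimately have "TS \<subset> D" using v(2) by (auto simp: TS_def)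
    moreover have "D \<subseteq> M'" if M': "stable M'" "TS \<subseteq> M'" "\<rho> ` B \<subseteq> M'" for M'
    proof -
      have "stable {f \<in> FS. \<rho> f \<in> M'}" by (rule stable_vimage[OF \<rho> FS FS_F M'(1)])
      then have "FS \<subseteq> {f \<in> FS. \<rho> f \<in> M'}" using B(2) M'(3) by (intro genB) auto
      then show "D \<subseteq> M'" using M'(2) stableD(3)[OF M'(1)] by (auto simp: D_def)
    qed
    ultimately obtain N where N: "maximal_in D N" "TS \<subseteq> N"
      using exists_maximal[OF TS _ D, of "\<rho> ` B"] B \<rho>D by blast
    have N': "stable N" "N \<subset> D" using N(1) by (auto simp: maximal_in_def)
    show ?thesis
    proof (rule maximal_pullback[OF N(1) D ghom_comp[OF \<rho> pr] E])
      show "(\<lambda>f. \<rho> (pr f)) ` E \<subseteq> D" using pr_FS E(2) \<rho>D by blast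
      show "(\<lambda>f. \<rho> (pr f)) ` (E \<inter> T) \<subseteq> N" using TS_pr E(2) \<rho>TS N(2) by blast
      show "\<not> (\<lambda>f. \<rho> (pr f)) ` E \<subseteq> N"
      proof
        assume sub: "(\<lambda>f. \<rho> (pr f)) ` E \<subseteq> N"
        \<comment> \<open>Since \<open>d\<close> sends \<open>\<rho> f\<close> into
          \<open>TS\<close>, the vector \<open>\<rho> f\<close> agrees modulo \<open>TS\<close> with
          \<open>\<phi> (\<rho> f)\<close>, a value of \<open>pr\<close> on \<open>E\<close>. As
          \<open>\<rho>\<close> is idempotent modulo \<open>TS\<close>, applying it once more gives
          back \<open>\<rho> f\<close>.\<close>
        have "\<rho> f \<in> N" if f: "f \<in> FS" for f
        proof -
          have \<rho>f: "\<rho> f \<in> FS" "\<rho> f \<in> F" using \<rho>FS[OF f] FS_F by auto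
          have "\<rho> (\<phi> (\<rho> f)) \<in> N" using sub e(2) \<rho>f(2) unfolding \<phi>_def by blast
          moreover have "\<rho> (\<rho> f - d (\<rho> f)) = \<rho> (\<rho> f) - \<rho> (d (\<rho> f))"
            by (intro ghom_diff[OF \<rho>] \<rho>f(2) ghomD(1)[OF d])
          moreover have "\<rho> f - d (\<rho> f) = \<phi> (\<rho> f)" by (simp only: d_def) simp
          ultimately have "\<rho> (\<rho> f) - \<rho> (d (\<rho> f)) \<in> N" by (simp only:)
          moreover have "\<rho> (d (\<rho> f)) \<in> N" "\<sigma> (d (\<rho> f)) \<in> N"
            using \<sigma>TS \<rho>TS d\<rho>[OF f] N(2) by blast+
          ultimately have "\<rho> (\<rho> f) - \<rho> (d (\<rho> f)) + (\<rho> (d (\<rho> f)) + \<sigma> (d (\<rho> f))) \<in> N"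
            by (intro stableD(3)[OF N'(1)])
          moreover have "\<rho> (\<rho> f) + \<sigma> (d (\<rho> f)) = \<rho> f" by (simp only: \<rho>_def[of "\<rho> f"]) simp
          ultimately show ?thesis by simp
        qed
        then have "D \<subseteq> N" using N(2) stableD(3)[OF N'(1)] unfolding D_def by blast
        then show False using N'(2) by blast
      qed
    qed
  qed
qed

end

section \<open>Orthogonal projections in permutation representations\<close>

text \<open>Summing over the support of the first argument makes conjugate linearity in the second
  hold for all functions; linearity in the first needs finite supports.\<close>

definition ip :: "('x \<Rightarrow> complex) \<Rightarrow> ('x \<Rightarrow> complex) \<Rightarrow> complex"
  where "ip f h = (\<Sum>x\<in>supp f. f x * cnj (h x))"

lemma ip_superset:
  assumes "finite A" "finite (supp f)" "\<And>x. x \<notin> A \<Longrightarrow> f x = 0 \<or> h x = 0"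
  shows "ip f h = (\<Sum>x\<in>A. f x * cnj (h x))"
proof -
  have "ip f h = (\<Sum>x\<in>supp f \<inter> A. f x * cnj (h x))"
    unfolding ip_def using assms by (intro sum.mono_neutral_right) auto
  also have "\<dots> = (\<Sum>x\<in>A. f x * cnj (h x))"
    using assms by (intro sum.mono_neutral_left) (auto simp: supp_def)
  finally show ?thesis .
qed

lemma ip_add_left:
  assumes "f \<in> finsupp X'" "g \<in> finsupp X'" shows "ip (f + g) h = ip f h + ip g h"
proof -
  note fin = finsuppD(1)[OF assms(1)] finsuppD(1)[OF assms(2)]
  have "finite (supp (f + g))" using fin by (rule_tac finite_subset[of _ "supp f \<union> supp g"]) (auto simp: supp_def)
  then have "ip a h = (\<Sum>x\<in>supp f \<union> supp g. a x * cnj (h x))" if "a \<in> {f, g, f + g}" for a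
    using that fin by (intro ip_superset) (auto simp: supp_def)
  then show ?thesis by (simp add: sum.distrib algebra_simps)
qed

lemma ip_scale_left:
  assumes "f \<in> finsupp X'" shows "ip (c *\<^sub>f f) h = c * ip f h"
proof -
  note fin = finsuppD(1)[OF assms]
  have "finite (supp (c *\<^sub>f f))" using fin by (rule_tac finite_subset[of _ "supp f"]) (auto simp: supp_def)
  then have "ip (c *\<^sub>f f) h = (\<Sum>x\<in>supp f. (c *\<^sub>f f) x * cnj (h x))"
    using fin by (intro ip_superset) (auto simp: supp_def)
  then show ?thesis by (simp add: ip_def sum_distrib_left mult.assoc)
qed

lemma ip_diff_left:
  assumes "f \<in> finsupp X'" "g \<in> finsupp X'" shows "ip (f - g) h = ip f h - ip g h"
proof -
  have "f - g \<in> finsupp X'" by (rule fsubspaceD(4)[OF subspace_finsupp assms])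
  from ip_add_left[OF this assms(2), of h] show ?thesis by simp
qed

lemma ip_add_right: "ip h (f + g) = ip h f + ip h g"
  and ip_diff_right: "ip h (f - g) = ip h f - ip h g"
  and ip_scale_right: "ip h (c *\<^sub>f f) = cnj c * ip h f"
  by (simp_all add: ip_def sum.distrib sum_subtractf sum_distrib_left algebra_simps)

lemma ip_self_eq_0:
  assumes "f \<in> finsupp X'" "ip f f = 0" shows "f = 0"
proof -
  have "ip f f = of_real (\<Sum>x\<in>supp f. (cmod (f x))\<^sup>2)"
    unfolding ip_def of_real_sum by (intro sum.cong) (simp_all add: complex_norm_square[symmetric])
  then have "(\<Sum>x\<in>supp f. (cmod (f x))\<^sup>2) = 0" using assms(2) of_real_eq_0_iff by metis
  then have "\<forall>x\<in>supp f. (cmod (f x))\<^sup>2 = 0"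
    using finsuppD(1)[OF assms(1)] by (subst (asm) sum_nonneg_eq_0_iff) auto
  then have "supp f = {}" by (auto simp: supp_def)
  then show ?thesis by (auto simp: supp_def)
qed

lemma ip_delta:
  assumes "f \<in> finsupp X'" shows "ip f (delta x) = f x"
proof -
  have "ip f (delta x) = (\<Sum>y\<in>{x}. f y * cnj (delta x y))"
    using finsuppD(1)[OF assms] by (intro ip_superset) (auto simp: delta_def)
  then show ?thesis by (simp add: delta_def)
qed

text \<open>Allows an identity between pairing with \<open>w\<close> and a linear functional to be
  checked on generators.\<close>

lemma fsubspace_ip:
  assumes "fsubspace S" "S \<subseteq> finsupp X'" "\<And>f h. f \<in> S \<Longrightarrow> h \<in> S \<Longrightarrow> L (f + h) = L f + L h"
    "\<And>c f. f \<in> S \<Longrightarrow> L (c *\<^sub>f f) = c * L f"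
  shows "fsubspace {f \<in> S. ip f w = L f}"
  unfolding fsubspace_def
proof (intro conjI ballI allI)
  have "L (0 *\<^sub>f 0) = 0 * L 0" by (rule assms(4)[OF fsubspaceD(1)[OF assms(1)]])
  then show "0 \<in> {f \<in> S. ip f w = L f}"
    using fsubspaceD(1)[OF assms(1)] by (simp add: ip_def supp_def)
next
  fix f h assume "f \<in> {f \<in> S. ip f w = L f}" "h \<in> {f \<in> S. ip f w = L f}"
  moreover from this have "ip (f + h) w = ip f w + ip h w" using assms(2) by (intro ip_add_left) auto
  ultimately show "f + h \<in> {f \<in> S. ip f w = L f}"
    using assms(3) fsubspaceD(2)[OF assms(1)] by simp
next
  fix c f assume "f \<in> {f \<in> S. ip f w = L f}"
  moreover from this have "ip (c *\<^sub>f f) w = c * ip f w" using assms(2) by (intro ip_scale_left) auto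
  ultimately show "c *\<^sub>f f \<in> {f \<in> S. ip f w = L f}"
    using assms(4) fsubspaceD(3)[OF assms(1)] by simp
qed

text \<open>Gram-Schmidt. Lying in the span of \<open>B\<close> is expressed as lying in every
  subspace that contains \<open>B\<close>. The induction is over all \<open>p\<close> because the
  step also projects the new vector \<open>b\<close>.\<close>

lemma exists_orthogonal_projection:
  assumes "finite B" "B \<subseteq> finsupp X'" "p \<in> finsupp X'"
  shows "\<exists>w. (\<forall>U. fsubspace U \<longrightarrow> B \<subseteq> U \<longrightarrow> w \<in> U) \<and> (\<forall>b\<in>B. ip b w = ip b p)"
  using assms
proof (induction B arbitrary: p rule: finite_induct)
  case empty
  have "\<forall>U. fsubspace U \<longrightarrow> {} \<subseteq> U \<longrightarrow> (0::'a \<Rightarrow> complex) \<in> U" using fsubspaceD(1) by blast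
  then show ?case by blast
next
  case (insert b B)
  let ?F = "finsupp X'"
  have F: "fsubspace ?F" by (rule subspace_finsupp)
  have b: "b \<in> ?F" and B: "B \<subseteq> ?F" using insert.prems by auto
  obtain w1 where w1: "\<And>U. fsubspace U \<Longrightarrow> B \<subseteq> U \<Longrightarrow> w1 \<in> U" "\<And>a. a \<in> B \<Longrightarrow> ip a w1 = ip a p"
    using insert.IH[OF B insert.prems(2)] by blast
  obtain b1 where b1: "\<And>U. fsubspace U \<Longrightarrow> B \<subseteq> U \<Longrightarrow> b1 \<in> U" "\<And>a. a \<in> B \<Longrightarrow> ip a b1 = ip a b"
    using insert.IH[OF B b] by blast
  \<comment> \<open>The vector \<open>b1\<close> lies in the span of \<open>B\<close>, so identities
    against \<open>B\<close> extend to it.\<close>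
  have span_B: "ip b1 w = ip b1 p" if "\<And>a. a \<in> B \<Longrightarrow> ip a w = ip a p" for w
  proof -
    have "fsubspace {f \<in> ?F. ip f w = ip f p}"
      by (rule fsubspace_ip[OF F subset_refl]) (auto simp: ip_add_left ip_scale_left)
    from b1(1)[OF this] show ?thesis using B that by blast
  qed
  have b1F: "b1 \<in> ?F" by (rule b1(1)[OF F B])
  define b' where "b' = b - b1"
  have b'F: "b' \<in> ?F" unfolding b'_def by (rule fsubspaceD(4)[OF F b b1F])
  have b_split: "ip b w = ip b' w + ip b1 w" for w
    using ip_add_left[OF b'F b1F, of w] by (simp add: b'_def)
  \<comment> \<open>The conjugate compensates for the conjugate linearity of \<open>ip\<close> on
    the right. If \<open>b' = 0\<close>, then \<open>b\<close> is already in the span and no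
    correction is made.\<close>
  define c where "c = (if b' = 0 then 0 else cnj ((ip b' p - ip b' w1) / ip b' b'))"
  define w where "w = w1 + c *\<^sub>f b'"
  have orth: "ip a b' = 0" if "a \<in> B" for a using b1(2)[OF that] by (simp add: b'_def ip_diff_right)
  have wB: "ip a w = ip a p" if "a \<in> B" for a
    using w1(2)[OF that] orth[OF that] by (simp add: w_def ip_add_right ip_scale_right)
  have "ip b' w = ip b' p"
  proof (cases "b' = 0")
    case True
    then show ?thesis by (simp add: ip_def supp_def)
  next
    case False
    then have "ip b' b' \<noteq> 0" using ip_self_eq_0[OF b'F] by blast
    then show ?thesis using False by (simp add: w_def c_def ip_add_right ip_scale_right)
  qed
  then have "ip b w = ip b p" using b_split span_B[OF wB] by simp
  moreover have "w \<in> U" if U: "fsubspace U" "insert b B \<subseteq> U" for U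
  proof -
    have "w1 \<in> U" "b1 \<in> U" "b \<in> U" using w1(1)[OF U(1)] b1(1)[OF U(1)] U(2) by auto
    then show ?thesis unfolding w_def b'_def
      by (intro fsubspaceD(2)[OF U(1)] fsubspaceD(3)[OF U(1)] fsubspaceD(4)[OF U(1)])
  qed
  ultimately show ?case using wB by blast
qed

context right_action begin

lemma ip_R:
  assumes g: "g \<in> carrier G" and f: "f \<in> F" and h: "h \<in> F"
  shows "ip (R g f) (R g h) = ip f h"
proof -
  let ?i = "\<lambda>y. act y (inv g)"
  have inj: "inj_on ?i (supp f)"
    by (rule inj_on_inverseI[where g = "\<lambda>y. act y g"]) (use finsuppD(2)[OF f] g in auto)
  have sub: "R g f x = 0" if x: "x \<notin> ?i ` supp f" for x
  proof (cases "x \<in> \<Omega>")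
    case True
    then have "act x g \<notin> supp f" using x g by (metis act_inv(1) imageI)
    then show ?thesis by (simp add: R_def supp_def)
  qed (simp add: R_def)
  have "ip (R g f) (R g h) = (\<Sum>x\<in>?i ` supp f. R g f x * cnj (R g h x))"
    using finsuppD(1)[OF f] finsuppD(1)[OF R_finsupp[OF g f]] sub by (intro ip_superset) auto
  also have "\<dots> = (\<Sum>y\<in>supp f. R g f (?i y) * cnj (R g h (?i y)))"
    using inj by (simp add: sum.reindex)
  also have "\<dots> = (\<Sum>y\<in>supp f. f y * cnj (h y))"
    using finsuppD(2)[OF f] g act_closed by (intro sum.cong) (auto simp: R_def subset_iff)
  finally show ?thesis by (simp add: ip_def)
qed

text \<open>The hypothesis on \<open>B\<close> says that \<open>B\<close> spans the coinvariants of \<open>E\<close> under the stabilizer of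
  \<open>x0\<close>; it makes evaluation at \<open>x0\<close> representable by an invariant vector of \<open>E\<close>.\<close>

theorem exists_projection:
  assumes x0: "x0 \<in> \<Omega>" "\<And>x. x \<in> \<Omega> \<Longrightarrow> \<exists>g\<in>carrier G. act x0 g = x"
    and K: "K = {g \<in> carrier G. act x0 g = x0}"
    and suborbits: "\<And>y. y \<in> \<Omega> \<Longrightarrow> finite {act y g | g. g \<in> K}"
    and E: "stable E" "E \<subseteq> F"
    and B: "finite B" "B \<subseteq> E"
      "\<And>U. fsubspace U \<Longrightarrow> B \<subseteq> U \<Longrightarrow> (\<And>k f. k \<in> K \<Longrightarrow> f \<in> E \<Longrightarrow> R k f - f \<in> U) \<Longrightarrow> E \<subseteq> U"
  shows "\<exists>e. ghom e \<and> e ` F \<subseteq> E \<and> (\<forall>f\<in>E. e f = f)"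
proof -
  have subK: "subgroup K G" unfolding K by (rule stabilizer_subgroup[OF x0(1)])
  have KG: "K \<subseteq> carrier G" by (auto simp: K)
  have sE: "fsubspace E" by (rule stableD(1)[OF E(1)])
  \<comment> \<open>Averaging replaces \<open>B\<close> by \<open>K\<close>-invariant vectors of
    \<open>E\<close> with the same classes in the coinvariants.\<close>
  have "\<forall>b\<in>B. \<exists>q. (\<forall>k\<in>K. R k q = q) \<and>
    (\<forall>U p. fsubspace U \<longrightarrow> (\<forall>g\<in>K. R g b - p \<in> U) \<longrightarrow> q - p \<in> U)"
  proof
    fix b assume b: "b \<in> B"
    have bF: "b \<in> F" using b B(2) E(2) by blast
    have "finite {R g b | g. g \<in> K}"
      using suborbits subgroup.m_inv_closed[OF subK] by (intro finite_orbit[OF KG _ bF]) auto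
    then show "\<exists>q. (\<forall>k\<in>K. R k q = q) \<and>
      (\<forall>U p. fsubspace U \<longrightarrow> (\<forall>g\<in>K. R g b - p \<in> U) \<longrightarrow> q - p \<in> U)"
    proof (rule average[OF subK _ bF])
      fix q assume q: "\<And>h. h \<in> K \<Longrightarrow> R h q = q"
        "\<And>U p. fsubspace U \<Longrightarrow> (\<And>g. g \<in> K \<Longrightarrow> R g b - p \<in> U) \<Longrightarrow> q - p \<in> U"
      show "\<exists>q. (\<forall>k\<in>K. R k q = q) \<and>
        (\<forall>U p. fsubspace U \<longrightarrow> (\<forall>g\<in>K. R g b - p \<in> U) \<longrightarrow> q - p \<in> U)"
        using q by (intro exI[of _ q]) blast
    qed
  qed
  from bchoice[OF this] obtain av where av': "\<forall>b\<in>B. (\<forall>k\<in>K. R k (av b) = av b) \<and>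
    (\<forall>U p. fsubspace U \<longrightarrow> (\<forall>g\<in>K. R g b - p \<in> U) \<longrightarrow> av b - p \<in> U)" ..
  have av: "R k (av b) = av b" if "b \<in> B" "k \<in> K" for b k using av' that by blast
  have av2: "av b - p \<in> U" if "b \<in> B" "fsubspace U" "\<And>g. g \<in> K \<Longrightarrow> R g b - p \<in> U" for b U p
    using av' that by simp
  have avE: "av b \<in> E" if b: "b \<in> B" for b
  proof -
    have bE: "b \<in> E" using b B(2) by blast
    have "av b - b \<in> E"
    proof (rule av2[OF b sE])
      fix g assume "g \<in> K"
      then show "R g b - b \<in> E" using KG by (intro stableD(4,6)[OF E(1)] bE) blast
    qed
    from stableD(3)[OF E(1) this bE] show ?thesis by simp
  qed
  have gen: "E \<subseteq> U"
    if U: "fsubspace U" "av ` B \<subseteq> U" "\<And>k f. k \<in> K \<Longrightarrow> f \<in> E \<Longrightarrow> R k f - f \<in> U" for U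
  proof (rule B(3)[OF U(1) _ U(3)])
    show "B \<subseteq> U"
    proof
      fix b assume b: "b \<in> B"
      have bE: "b \<in> E" using b B(2) by blast
      have 1: "av b - b \<in> U" by (rule av2[OF b U(1)]) (rule U(3)[OF _ bE])
      have 2: "av b \<in> U" using b U(2) by blast
      from fsubspaceD(4)[OF U(1) 2 1] show "b \<in> U" by simp
    qed
  qed
  have "av ` B \<subseteq> F" using avE E(2) by blast
  \<comment> \<open>On the finite-dimensional span of the averages, evaluation at \<open>x0\<close>
    is pairing with the projection \<open>w\<close> of the point mass at \<open>x0\<close>. Lying in
    that span, \<open>w\<close> is \<open>K\<close>-invariant.\<close>
  from exists_orthogonal_projection[OF finite_imageI[OF B(1)] this delta_finsupp[OF x0(1)]]
  obtain w where w: "\<And>U. fsubspace U \<Longrightarrow> av ` B \<subseteq> U \<Longrightarrow> w \<in> U"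
    "\<And>b. b \<in> B \<Longrightarrow> ip (av b) w = ip (av b) (delta x0)" by blast
  have wE: "w \<in> E" using avE by (intro w(1)[OF sE]) blast
  have wF: "w \<in> F" using wE E(2) by blast
  have wK: "R k w = w" if k: "k \<in> K" for k
  proof -
    have "fsubspace {f. R k f = f}" by (auto simp: fsubspace_def R_zero R_add R_scale)
    from w(1)[OF this] show ?thesis using av k by blast
  qed
  have "fsubspace {f \<in> E. ip f w = f x0}" by (rule fsubspace_ip[OF sE E(2)]) auto
  moreover have "av ` B \<subseteq> {f \<in> E. ip f w = f x0}"
  proof
    fix a assume "a \<in> av ` B"
    then obtain b where b: "b \<in> B" "a = av b" by blast
    have "a \<in> F" using avE b E(2) by blast
    then show "a \<in> {f \<in> E. ip f w = f x0}" using w(2)[OF b(1)] avE[OF b(1)] b(2) ip_delta by simp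
  qed
  \<comment> \<open>Pairing with the invariant \<open>w\<close> and evaluating at the fixed point
    \<open>x0\<close> both vanish on \<open>R k f - f\<close>. So the identity extends from the
    averages to all of \<open>E\<close>, which may be infinite-dimensional.\<close>
  moreover have "R k f - f \<in> {f \<in> E. ip f w = f x0}" if k: "k \<in> K" and f: "f \<in> E" for k f
  proof -
    have kG: "k \<in> carrier G" and kx: "act x0 k = x0" using k by (auto simp: K)
    have fF: "f \<in> F" using f E(2) by blast
    have "ip (R k f) w = ip f w" using ip_R[OF kG fF wF] wK[OF k] by simp
    then have "ip (R k f - f) w = 0" using ip_diff_left[OF R_finsupp[OF kG fF] fF] by simp
    moreover have "(R k f - f) x0 = 0" using x0(1) kx by (simp add: R_def)
    moreover have "R k f - f \<in> E" by (intro stableD(4,6)[OF E(1)] kG f)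
    ultimately show ?thesis by simp
  qed
  ultimately have "E \<subseteq> {f \<in> E. ip f w = f x0}" by (rule gen)
  then have w_x0: "ip f w = f x0" if "f \<in> E" for f using that by blast

  \<comment> \<open>By transitivity, translates of \<open>w\<close> represent evaluation at every
    point.\<close>
  have "\<forall>x\<in>\<Omega>. \<exists>u. u \<in> E \<and> (\<forall>f\<in>E. ip f u = f x)"
  proof
    fix x assume x: "x \<in> \<Omega>"
    obtain g where g: "g \<in> carrier G" "act x0 g = x" using x0(2)[OF x] by blast
    have "ip f (R (inv g) w) = f x" if f: "f \<in> E" for f
    proof -
      have fF: "f \<in> F" using f E(2) by blast
      have "ip f (R (inv g) w) = ip (R (inv g) (R g f)) (R (inv g) w)" using R_inv(1)[OF g(1) fF] by simp
      also have "\<dots> = ip (R g f) w" using g fF wF by (intro ip_R) auto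
      also have "\<dots> = (R g f) x0" by (intro w_x0 stableD(6)[OF E(1)] g f)
      also have "\<dots> = f x" using x0(1) g by (simp add: R_def)
      finally show ?thesis .
    qed
    moreover have "R (inv g) w \<in> E" using g wE by (intro stableD(6)[OF E(1)]) auto
    ultimately show "\<exists>u. u \<in> E \<and> (\<forall>f\<in>E. ip f u = f x)" by blast
  qed
  from bchoice[OF this] obtain W where W': "\<forall>x\<in>\<Omega>. W x \<in> E \<and> (\<forall>f\<in>E. ip f (W x) = f x)" ..
  then have W: "\<And>x. x \<in> \<Omega> \<Longrightarrow> W x \<in> E" "\<And>x f. x \<in> \<Omega> \<Longrightarrow> f \<in> E \<Longrightarrow> ip f (W x) = f x"
    by simp_all
  have unique: "u = u'" if u: "u \<in> E" "u' \<in> E" "\<And>f. f \<in> E \<Longrightarrow> ip f u = ip f u'" for u u'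
  proof -
    have d: "u - u' \<in> E" by (rule stableD(4)[OF E(1) u(1,2)])
    have "ip (u - u') (u - u') = 0" using u(3)[OF d] by (simp add: ip_diff_right)
    then have "u - u' = 0" using d E(2) by (intro ip_self_eq_0) auto
    then show ?thesis by simp
  qed
  have WF: "W x \<in> F" if "x \<in> \<Omega>" for x using W(1)[OF that] E(2) by blast
  have "R g (W x) = W (act x (inv g))" if x: "x \<in> \<Omega>" and g: "g \<in> carrier G" for x g
  proof (rule unique)
    have y: "act x (inv g) \<in> \<Omega>" using x g act_closed by simp
    show "R g (W x) \<in> E" "W (act x (inv g)) \<in> E"
      using W(1)[OF x] W(1)[OF y] stableD(6)[OF E(1) g] by auto
    fix f assume f: "f \<in> E"
    then have fF: "f \<in> F" using E(2) by blast
    have ig: "inv g \<in> carrier G" using g by simp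
    have "ip f (R g (W x)) = ip (R g (R (inv g) f)) (R g (W x))" using R_inv(2)[OF g fF] by simp
    also have "\<dots> = ip (R (inv g) f) (W x)" using ig fF by (intro ip_R g WF x R_finsupp)
    also have "\<dots> = (R (inv g) f) x" by (intro W(2) x stableD(6)[OF E(1)] ig f)
    also have "\<dots> = f (act x (inv g))" using x by (simp add: R_def)
    finally show "ip f (R g (W x)) = ip f (W (act x (inv g)))" using W(2)[OF y f] by simp
  qed
  \<comment> \<open>Each \<open>W x\<close> is the orthogonal projection of the point mass at
    \<open>x\<close> to \<open>E\<close>, so \<open>lift W\<close> is the orthogonal projection onto
    \<open>E\<close>.\<close>
  then have "ghom (lift W)" using WF by (intro ghom_lift) auto
  moreover have eE: "lift W f \<in> E" if f: "f \<in> F" for f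
    unfolding lift_def using W(1) finsuppD(2)[OF f] by (intro stableD(7)[OF E(1)] stableD(5)[OF E(1)]) auto
  moreover have "lift W f = f" if f: "f \<in> E" for f
  proof (rule unique)
    have fF: "f \<in> F" using f E(2) by blast
    show "lift W f \<in> E" by (rule eE[OF fF])
    show "f \<in> E" by (rule f)
    fix u assume u: "u \<in> E"
    then have uF: "u \<in> F" using E(2) by blast
    have "ip u (lift W f) = (\<Sum>y\<in>supp u. \<Sum>x\<in>supp f. cnj (f x) * (u y * cnj (W x y)))"
      by (simp add: ip_def lift_def sum_fun_apply sum_distrib_left mult_ac)
    also have "\<dots> = (\<Sum>x\<in>supp f. cnj (f x) * ip u (W x))"
      by (subst sum.swap) (simp add: ip_def sum_distrib_left)
    also have "\<dots> = (\<Sum>x\<in>supp f. cnj (f x) * u x)"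
      using W(2)[OF _ u] finsuppD(2)[OF fF] by (intro sum.cong) auto
    also have "\<dots> = ip u f"
      using finsuppD(1)[OF fF] finsuppD(1)[OF uF]
      by (subst ip_superset[of "supp f"]) (auto simp: supp_def mult.commute)
    finally show "ip u (lift W f) = ip u f" .
  qed
  ultimately show ?thesis by blast
qed

end

section \<open>Symplectic geometry over a local field\<close>

lemma absval_zero [simp]: "absval (0::'a::nonarch_local_field) = 0"
  using dist_absval[of 0 "0::'a"] by simp

lemma absval_nonneg [simp]: "0 \<le> absval (x::'a::nonarch_local_field)"
  using dist_absval[of x 0] zero_le_dist[of x 0] by simp

lemma absval_eq_0 [simp]: "absval (x::'a::nonarch_local_field) = 0 \<longleftrightarrow> x = 0"
  using dist_absval[of x 0] dist_eq_0_iff[of x 0] by simp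

lemma absval_pos [simp]: "0 < absval (x::'a::nonarch_local_field) \<longleftrightarrow> x \<noteq> 0"
  using absval_nonneg[of x] absval_eq_0[of x] by linarith

lemma absval_one [simp]: "absval (1::'a::nonarch_local_field) = 1"
  using absval_mult[of "1::'a" 1] absval_eq_0[of "1::'a"] by simp

lemma absval_minus [simp]: "absval (- x) = absval (x::'a::nonarch_local_field)"
  using dist_absval[of x 0] dist_absval[of 0 x] by (simp add: dist_commute)

lemma absval_inverse [simp]: "absval (inverse x) = inverse (absval (x::'a::nonarch_local_field))"
proof (cases "x = 0")
  case False
  then have "absval x * absval (inverse x) = 1" using absval_mult[of x "inverse x"] by simp
  then show ?thesis using inverse_unique by metis
qed simp

lemma absval_power [simp]: "absval (x ^ n) = absval (x::'a::nonarch_local_field) ^ n"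
  by (induction n) (simp_all add: absval_mult)

lemma absval_add_le:
  "absval x \<le> r \<Longrightarrow> absval y \<le> r \<Longrightarrow> absval (x + y :: 'a::nonarch_local_field) \<le> r"
  using absval_add_le_max[of x y] by linarith

lemma absval_diff_le:
  "absval x \<le> r \<Longrightarrow> absval y \<le> r \<Longrightarrow> absval (x - y :: 'a::nonarch_local_field) \<le> r"
  using absval_add_le[of x r "- y"] by simp

lemma exists_absval_small:
  assumes "0 < r" shows "\<exists>x::'a::nonarch_local_field. x \<noteq> 0 \<and> absval x \<le> r"
proof -
  obtain x :: 'a where x: "x \<noteq> 0" "absval x \<noteq> 1" using absval_nontrivial by blast
  obtain y :: 'a where y: "y \<noteq> 0" "absval y < 1"
  proof (cases "absval x < 1")
    case True then show ?thesis using that x by blast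
  next
    case False
    then have "inverse (absval x) < 1" using x by (simp add: inverse_less_1_iff)
    then show ?thesis using that[of "inverse x"] x by simp
  qed
  obtain n where "absval y ^ n < r" using real_arch_pow_inv[OF assms y(2)] by blast
  then show ?thesis using y by (intro exI[of _ "y ^ n"]) simp
qed

text \<open>Local compactness speaks of one ball only; multiplication by a small \<open>t\<close>
  moves the ball of radius \<open>R\<close> into it, where total boundedness applies. The net is
  given as a rounding map \<open>c\<close> with finitely many values so that all entries of a matrix
  can be rounded at once.\<close>

lemma finite_net:
  assumes "0 < \<delta>"
  shows "\<exists>c::'a::nonarch_local_field \<Rightarrow> 'a. finite (c ` {x. absval x \<le> R}) \<and>
    (\<forall>x y. absval x \<le> R \<longrightarrow> absval y \<le> R \<longrightarrow> c x = c y \<longrightarrow> absval (x - y) \<le> \<delta>)"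
proof -
  obtain r where r: "0 < r" "compact {x::'a. absval x \<le> r}" using locally_compact by blast
  \<comment> \<open>The maximum with 1 keeps the divisor positive whatever \<open>R\<close>
    is.\<close>
  define R' where "R' = max R 1"
  obtain t :: 'a where t: "t \<noteq> 0" "absval t \<le> r / R'"
    using exists_absval_small[of "r / R'"] r by (auto simp: R'_def)
  have e: "0 < \<delta> * absval t" using assms t by simp
  obtain N where N: "finite N" "{x::'a. absval x \<le> r} \<subseteq> (\<Union>x\<in>N. ball x (\<delta> * absval t))"
    using r(2) e unfolding compact_eq_totally_bounded by blast
  define c where "c x = (SOME z. z \<in> N \<and> dist z (t * x) < \<delta> * absval t)" for x
  have c: "c x \<in> N \<and> dist (c x) (t * x) < \<delta> * absval t" if "absval x \<le> R" for x
  proof -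
    have "absval (t * x) \<le> r / R' * R'"
      unfolding absval_mult using t that r by (intro mult_mono) (auto simp: R'_def)
    also have "\<dots> = r" by (simp add: R'_def)
    finally have "t * x \<in> (\<Union>z\<in>N. ball z (\<delta> * absval t))" using N(2) by blast
    then have "\<exists>z. z \<in> N \<and> dist z (t * x) < \<delta> * absval t" by (auto simp: dist_commute)
    then show ?thesis unfolding c_def by (rule someI_ex)
  qed
  have "absval (x - y) \<le> \<delta>" if xy: "absval x \<le> R" "absval y \<le> R" "c x = c y" for x y
  proof -
    have "absval (c x - t * x) \<le> \<delta> * absval t" "absval (c x - t * y) \<le> \<delta> * absval t"
      using c[OF xy(1)] c[OF xy(2)] xy(3) by (auto simp: dist_absval)
    from absval_diff_le[OF this(2) this(1)] have "absval (t * (x - y)) \<le> \<delta> * absval t" by (simp add: algebra_simps)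
    then show ?thesis using t by (simp add: absval_mult mult.commute)
  qed
  moreover have "finite (c ` {x. absval x \<le> R})"
    using c by (intro finite_subset[OF _ N(1)]) auto
  ultimately show ?thesis by blast
qed

section \<open>Symplectic bases of a 4-dimensional space\<close>

locale symp =
  fixes B :: "'k::nonarch_local_field ^ 4 \<Rightarrow> 'k ^ 4 \<Rightarrow> 'k"
  assumes char: "CHAR('k) \<noteq> 2" and form: "symplectic_form B"
begin

text \<open>This turns skew-symmetry into \<open>B x x = 0\<close>, and later it determines the
  center of the Heisenberg group.\<close>

lemma two_nonzero: "(2::'k) \<noteq> 0"
proof
  assume "(2::'k) = 0"
  then have "of_nat 2 = (0::'k)" by simp
  then have "CHAR('k) dvd 2" by (simp only: of_nat_eq_0_iff_char_dvd)
  then have "CHAR('k) = 1" using char two_is_prime_nat unfolding prime_nat_iff by blast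
  then show False using CHAR_not_1[where 'a='k] by simp
qed

lemma B_linear: "Vector_Spaces.linear (*s) (*) (B x)" and B_skew: "B x y = - B y x"
  and B_nondeg: "(\<And>y. B x y = 0) \<Longrightarrow> x = 0"
  using form unfolding symplectic_form_def by blast+

lemma B_add_right: "B x (y + z) = B x y + B x z"
  and B_scale_right: "B x (c *s y) = c * B x y"
  using B_linear[of x] by (simp_all add: Vector_Spaces.linear_iff)

lemma B_add_left: "B (x + y) z = B x z + B y z"
  and B_scale_left: "B (c *s x) z = c * B x z"
  using B_add_right[of z x y] B_scale_right[of z c x] B_skew[of "x + y" z] B_skew[of "c *s x" z]
    B_skew[of x z] B_skew[of y z] by (simp_all only: minus_add_distrib mult_minus_right)

lemma B_zero_right [simp]: "B x 0 = 0" and B_zero_left [simp]: "B 0 x = 0"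
  using B_scale_right[of x 0 0] B_scale_left[of 0 0 x] by simp_all

lemma B_minus_right: "B x (- y) = - B x y" and B_minus_left: "B (- x) y = - B x y"
  using B_scale_right[of x "-1" y] B_scale_left[of "-1" x y] by simp_all

lemma B_diff_right: "B x (y - z) = B x y - B x z" and B_diff_left: "B (x - y) z = B x z - B y z"
  using B_add_right[of x y "- z"] B_add_left[of x "- y" z] by (simp_all add: B_minus_right B_minus_left)

lemma B_self [simp]: "B x x = 0"
proof -
  have "B x x + B x x = 0" using B_skew[of x x] by (simp only: eq_neg_iff_add_eq_0)
  then have "2 * B x x = 0" by (simp only: mult_2)
  then show ?thesis using two_nonzero by simp
qed

lemmas B_simps = B_add_right B_add_left B_scale_right B_scale_left B_minus_right B_minus_left
  B_diff_right B_diff_left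

abbreviation Sp :: "('k ^ 4 ^ 4) monoid" where "Sp \<equiv> Sp_group B"

lemma Sp_iff: "g \<in> carrier Sp \<longleftrightarrow> (\<forall>x y. B (g *v x) (g *v y) = B x y)"
  by (simp add: Sp_group_def)

lemma Sp_mult [simp]: "g \<otimes>\<^bsub>Sp\<^esub> h = g ** h" and Sp_one [simp]: "\<one>\<^bsub>Sp\<^esub> = mat 1"
  by (simp_all add: Sp_group_def)

lemma Sp_inverse:
  assumes "g \<in> carrier Sp"
  obtains h where "h \<in> carrier Sp" "g ** h = mat 1" "h ** g = mat 1"
proof -
  have inj: "x = 0" if x: "g *v x = 0" for x
  proof (rule B_nondeg)
    fix y
    have "B (g *v x) (g *v y) = B x y" using assms unfolding Sp_iff by blast
    then show "B x y = 0" using x by simp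
  qed
  have "\<exists>h. h ** g = mat 1" unfolding matrix_left_invertible_ker using inj by blast
  then obtain h where h: "h ** g = mat 1" ..
  then have gh: "g ** h = mat 1" using matrix_left_right_inverse by blast
  have "B (h *v x) (h *v y) = B x y" for x y
  proof -
    have "B (h *v x) (h *v y) = B (g *v (h *v x)) (g *v (h *v y))" using assms unfolding Sp_iff by (simp only:)
    also have "\<dots> = B x y" by (simp only: matrix_vector_mul_assoc gh matrix_vector_mul_lid)
    finally show ?thesis .
  qed
  then have "h \<in> carrier Sp" by (simp add: Sp_iff)
  from that[OF this gh h] show ?thesis .
qed

lemma group_Sp: "group Sp"
proof (rule groupI)
  fix g assume "g \<in> carrier Sp"
  then obtain h where "h \<in> carrier Sp" "g ** h = mat 1" "h ** g = mat 1" by (rule Sp_inverse)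
  then show "\<exists>h\<in>carrier Sp. h \<otimes>\<^bsub>Sp\<^esub> g = \<one>\<^bsub>Sp\<^esub>" by (intro bexI[of _ h]) simp_all
qed (auto simp: Sp_iff matrix_mul_assoc matrix_vector_mul_assoc[symmetric])

sublocale Sp: group Sp by (rule group_Sp)

lemma Sp_inv:
  assumes "g \<in> carrier Sp"
  shows "inv\<^bsub>Sp\<^esub> g ** g = mat 1" "g ** inv\<^bsub>Sp\<^esub> g = mat 1"
    "inv\<^bsub>Sp\<^esub> g *v (g *v x) = x" "g *v (inv\<^bsub>Sp\<^esub> g *v x) = x"
proof -
  show 1: "inv\<^bsub>Sp\<^esub> g ** g = mat 1" "g ** inv\<^bsub>Sp\<^esub> g = mat 1"
    using Sp.l_inv[OF assms] Sp.r_inv[OF assms] by simp_all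
  show "inv\<^bsub>Sp\<^esub> g *v (g *v x) = x" "g *v (inv\<^bsub>Sp\<^esub> g *v x) = x"
    by (simp_all add: matrix_vector_mul_assoc 1)
qed

lemma B_inv:
  assumes "g \<in> carrier Sp" shows "B (inv\<^bsub>Sp\<^esub> g *v x) y = B x (g *v y)"
proof -
  have "B (inv\<^bsub>Sp\<^esub> g *v x) y = B (g *v (inv\<^bsub>Sp\<^esub> g *v x)) (g *v y)"
    using assms by (simp add: Sp_iff)
  then show ?thesis by (simp add: Sp_inv[OF assms])
qed

definition sympl_basis :: "'k ^ 4 \<Rightarrow> 'k ^ 4 \<Rightarrow> 'k ^ 4 \<Rightarrow> 'k ^ 4 \<Rightarrow> bool"
  where "sympl_basis p1 q1 p2 q2 \<longleftrightarrow> B p1 q1 = 1 \<and> B p2 q2 = 1 \<and>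
    B p1 p2 = 0 \<and> B p1 q2 = 0 \<and> B q1 p2 = 0 \<and> B q1 q2 = 0"

lemma sympl_basisD:
  assumes "sympl_basis p1 q1 p2 q2"
  shows "B p1 q1 = 1" "B q1 p1 = -1" "B p2 q2 = 1" "B q2 p2 = -1"
    "B p1 p2 = 0" "B p1 q2 = 0" "B q1 p2 = 0" "B q1 q2 = 0"
    "B p2 p1 = 0" "B q2 p1 = 0" "B p2 q1 = 0" "B q2 q1 = 0"
  using assms B_skew[of q1 p1] B_skew[of q2 p2] B_skew[of p2 p1] B_skew[of q2 p1] B_skew[of p2 q1]
    B_skew[of q2 q1] by (auto simp: sympl_basis_def)

lemma left_inverse_imp_right_inverse:
  fixes f g :: "'k ^ 4 \<Rightarrow> 'k ^ 4"
  assumes "Vector_Spaces.linear (*s) (*s) f" "Vector_Spaces.linear (*s) (*s) g" "\<And>x. f (g x) = x"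
  shows "g (f x) = x"
proof -
  have "matrix f ** matrix g = mat 1"
    using assms by (simp add: matrix_eq matrix_vector_mul_assoc[symmetric] matrix_works)
  then have "matrix g ** matrix f = mat 1" using matrix_left_right_inverse by blast
  then have "matrix g *v (matrix f *v x) = x" by (simp add: matrix_vector_mul_assoc)
  then show ?thesis using assms by (simp add: matrix_works)
qed

text \<open>Pairing with the basis computes the coordinates of a given linear combination. That the
  coordinates in turn recover the vector follows by equality of dimensions.\<close>

lemma sympl_expand:
  assumes "sympl_basis p1 q1 p2 q2"
  shows "B x q1 *s p1 - B x p1 *s q1 + B x q2 *s p2 - B x p2 *s q2 = x"
proof -
  define f where "f x = (\<chi> i::4. if i = 1 then B x q1 else if i = 2 then - B x p1
    else if i = 3 then B x q2 else - B x p2)" for x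
  define g where "g y = y $ 1 *s p1 + y $ 2 *s q1 + y $ 3 *s p2 + y $ 4 *s q2" for y :: "'k ^ 4"
  have "Vector_Spaces.linear (*s) (*s) f" "Vector_Spaces.linear (*s) (*s) g"
    by (auto simp: Vector_Spaces.linear_iff vec.vector_space_axioms f_def g_def vec_eq_iff B_simps algebra_simps)
  moreover have "f (g y) = y" for y
    by (simp add: f_def g_def vec_eq_iff forall_4 B_simps sympl_basisD[OF assms])
  ultimately have "g (f x) = x" by (rule left_inverse_imp_right_inverse)
  then show ?thesis by (simp add: f_def g_def)
qed

text \<open>Otherwise the map \<open>f\<close>, whose last two coordinates vanish, would be
  injective and therefore onto.\<close>

lemma complement_nonzero:
  obtains x where "x \<noteq> 0" "B x p1 = 0" "B x q1 = 0"
proof (rule ccontr)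
  assume neg: "\<not> thesis"
  note intro = that
  define f where "f x = (\<chi> i::4. if i = 1 then B x q1 else if i = 2 then B x p1 else 0)" for x
  have "Vector_Spaces.linear (*s) (*s) f"
    by (auto simp: Vector_Spaces.linear_iff vec.vector_space_axioms f_def vec_eq_iff B_simps)
  moreover have "x = 0" if x: "f x = 0" for x
  proof (rule ccontr)
    assume "x \<noteq> 0"
    moreover have "f x $ 1 = 0" "f x $ 2 = 0" unfolding x by simp_all
    then have "B x p1 = 0" "B x q1 = 0" by (simp_all add: f_def)
    ultimately have thesis by (rule intro)
    with neg show False by blast
  qed
  ultimately have lin: "Vector_Spaces.linear (*s) (*s) f" and "inj f"
    by (auto simp: vec.linear_inj_iff_eq_0)
  have "surj f" using lin \<open>inj f\<close> by (rule vec.linear_inj_imp_surj)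
  then obtain x where "f x = axis 3 1" by (metis surjD)
  then have "f x $ 3 = 1" by simp
  then show False by (simp add: f_def)
qed

lemma exists_hyperbolic_partner:
  assumes "x \<noteq> 0" obtains y where "B x y = 1"
proof -
  obtain z where "B x z \<noteq> 0" using B_nondeg assms by blast
  then have "B x (inverse (B x z) *s z) = 1" by (simp add: B_simps)
  then show ?thesis by (rule that)
qed

text \<open>If \<open>B p q = 1\<close>, this is the component of \<open>x\<close> orthogonal to the
  hyperbolic plane spanned by \<open>p\<close> and \<open>q\<close>.\<close>

definition proj :: "'k ^ 4 \<Rightarrow> 'k ^ 4 \<Rightarrow> 'k ^ 4 \<Rightarrow> 'k ^ 4"
  where "proj p q x = x - B x q *s p + B x p *s q"

lemma B_proj:
  assumes "B p q = 1"
  shows "B (proj p q x) p = 0" "B (proj p q x) q = 0" "B p (proj p q x) = 0" "B q (proj p q x) = 0"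
    "B z p = 0 \<Longrightarrow> B z q = 0 \<Longrightarrow> B z (proj p q x) = B z x"
  using assms B_skew[of q p] B_skew[of p x] B_skew[of q x] by (simp_all add: proj_def B_simps)

lemma exists_sympl_basis: obtains p1 q1 p2 q2 where "sympl_basis p1 q1 p2 q2"
proof -
  have "axis 1 1 \<noteq> (0 :: 'k ^ 4)" by simp
  then obtain q1 :: "'k ^ 4" where 1: "B (axis 1 1) q1 = 1" by (rule exists_hyperbolic_partner)
  define p1 :: "'k ^ 4" where "p1 = axis 1 1"
  note 1 = 1[folded p1_def]
  obtain p2 where p2: "p2 \<noteq> 0" "B p2 p1 = 0" "B p2 q1 = 0" by (rule complement_nonzero)
  obtain q where q: "B p2 q = 1" by (rule exists_hyperbolic_partner[OF p2(1)])
  have "sympl_basis p1 q1 p2 (proj p1 q1 q)"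
    using 1 p2 q B_proj[OF 1] B_skew[of p1 p2] B_skew[of q1 p2] by (simp add: sympl_basis_def)
  then show ?thesis by (rule that)
qed

lemma sympl_transport:
  assumes b: "sympl_basis p1 q1 p2 q2" and b': "sympl_basis p1' q1' p2' q2'"
  obtains k where "k \<in> carrier Sp" "k *v p1 = p1'" "k *v q1 = q1'" "k *v p2 = p2'" "k *v q2 = q2'"
proof -
  define f where "f x = B x q1 *s p1' - B x p1 *s q1' + B x q2 *s p2' - B x p2 *s q2'" for x
  have lin: "Vector_Spaces.linear (*s) (*s) f"
    by (auto simp: Vector_Spaces.linear_iff vec.vector_space_axioms f_def B_simps vec_eq_iff algebra_simps)
  then have k: "matrix f *v x = f x" for x by (rule matrix_works)
  have "B (f x) (f y) = B x y" for x y
  proof -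
    have "B (f x) (f y) = B x q1 * - B y p1 - B x p1 * - B y q1 + B x q2 * - B y p2 - B x p2 * - B y q2"
      by (simp add: f_def B_simps sympl_basisD[OF b'] algebra_simps)
    also have "\<dots> = B (B x q1 *s p1 - B x p1 *s q1 + B x q2 *s p2 - B x p2 *s q2) y"
      by (simp add: B_simps B_skew[of y])
    finally show ?thesis by (simp add: sympl_expand[OF b])
  qed
  then have "matrix f \<in> carrier Sp" by (simp add: Sp_iff k)
  moreover have "f p1 = p1'" "f q1 = q1'" "f p2 = p2'" "f q2 = q2'"
    by (simp_all add: f_def sympl_basisD[OF b])
  ultimately show ?thesis by (intro that[of "matrix f"]) (simp_all add: k)
qed

end

section \<open>The norm of the standard lattice\<close>

locale symp_std = symp B for B :: "'k::nonarch_local_field ^ 4 \<Rightarrow> 'k ^ 4 \<Rightarrow> 'k" +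
  fixes P1 Q1 P2 Q2 :: "'k ^ 4"
  assumes std: "sympl_basis P1 Q1 P2 Q2"
begin

definition basis :: "('k ^ 4) set" where "basis = {P1, Q1, P2, Q2}"

text \<open>Pairings with the basis are the coordinates up to sign and order, so this is the maximum
  norm. Its unit ball is the standard lattice, which is self-dual for \<open>B\<close>.\<close>

definition vnorm :: "'k ^ 4 \<Rightarrow> real"
  where "vnorm x = Max ((\<lambda>b. absval (B x b)) ` basis)"

lemma finite_basis [simp]: "finite basis" "basis \<noteq> {}"
  by (simp_all add: basis_def)

lemma vnorm_le_iff: "vnorm x \<le> r \<longleftrightarrow> (\<forall>b\<in>basis. absval (B x b) \<le> r)"
  unfolding vnorm_def by (subst Max_le_iff) auto

lemma absval_B_basis: "b \<in> basis \<Longrightarrow> absval (B x b) \<le> vnorm x"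
  using vnorm_le_iff[of x "vnorm x"] by simp

lemma vnorm_attained: obtains b where "b \<in> basis" "absval (B x b) = vnorm x"
proof -
  have "vnorm x \<in> (\<lambda>b. absval (B x b)) ` basis" unfolding vnorm_def by (intro Max_in) auto
  then obtain b where "b \<in> basis" "absval (B x b) = vnorm x" by (metis imageE)
  then show ?thesis by (rule that)
qed

lemma vnorm_nonneg [simp]: "0 \<le> vnorm x"
  using absval_nonneg[of "B x P1"] absval_B_basis[of P1 x] by (simp add: basis_def del: absval_nonneg)

lemma vnorm_scale: "vnorm (c *s x) = absval c * vnorm x"
proof (rule antisym)
  show "vnorm (c *s x) \<le> absval c * vnorm x"
    by (auto simp: vnorm_le_iff B_simps absval_mult absval_B_basis intro!: mult_left_mono)
  obtain b where "b \<in> basis" "absval (B x b) = vnorm x" by (rule vnorm_attained)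
  then show "absval c * vnorm x \<le> vnorm (c *s x)"
    using absval_B_basis[of b "c *s x"] by (simp add: B_simps absval_mult)
qed

lemma vnorm_add_le: "vnorm x \<le> r \<Longrightarrow> vnorm y \<le> r \<Longrightarrow> vnorm (x + y) \<le> r"
  and vnorm_diff_le: "vnorm x \<le> r \<Longrightarrow> vnorm y \<le> r \<Longrightarrow> vnorm (x - y) \<le> r"
  by (auto simp: vnorm_le_iff B_simps intro: absval_add_le absval_diff_le)

lemma vnorm_zero [simp]: "vnorm 0 = 0"
  using vnorm_scale[of 0 0] by simp

lemma vnorm_eq_0 [simp]: "vnorm x = 0 \<longleftrightarrow> x = 0"
proof
  assume "vnorm x = 0"
  then have "B x b = 0" if "b \<in> basis" for b
    using absval_B_basis[OF that, of x] absval_nonneg[of "B x b"] absval_eq_0[of "B x b"] by linarith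
  then show "x = 0" using sympl_expand[OF std, of x] by (simp add: basis_def)
qed simp

lemma vnorm_pos [simp]: "0 < vnorm x \<longleftrightarrow> x \<noteq> 0"
  using vnorm_nonneg[of x] vnorm_eq_0[of x] by linarith

text \<open>By the ultrametric inequality a bound on the basis bounds the operator norm, without a
  factor for the dimension.\<close>

lemma vnorm_expand_le:
  assumes lin: "Vector_Spaces.linear (*s) (*s) f" and b: "\<And>b. b \<in> basis \<Longrightarrow> vnorm (f b) \<le> r"
  shows "vnorm (f x) \<le> r * vnorm x"
proof -
  have r: "0 \<le> r" using b[of P1] vnorm_nonneg[of "f P1"] by (simp add: basis_def del: vnorm_nonneg)
  have "vnorm (B x c *s f b) \<le> r * vnorm x" if "b \<in> basis" "c \<in> basis" for b c
  proof -
    have "absval (B x c) * vnorm (f b) \<le> vnorm x * r"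
      using b[OF that(1)] absval_B_basis[OF that(2), of x] r by (intro mult_mono) auto
    then show ?thesis by (simp add: vnorm_scale mult.commute)
  qed
  then have "vnorm (B x Q1 *s f P1 - B x P1 *s f Q1 + B x Q2 *s f P2 - B x P2 *s f Q2) \<le> r * vnorm x"
    by (intro vnorm_diff_le vnorm_add_le) (auto simp: basis_def)
  also have "B x Q1 *s f P1 - B x P1 *s f Q1 + B x Q2 *s f P2 - B x P2 *s f Q2 =
      f (B x Q1 *s P1 - B x P1 *s Q1 + B x Q2 *s P2 - B x P2 *s Q2)"
    by (simp add: vec.linear_add[OF lin] vec.linear_diff[OF lin]
      vec.linear_scale[OF lin])
  finally show ?thesis by (simp add: sympl_expand[OF std])
qed

lemma absval_B_le: "absval (B x y) \<le> vnorm x * vnorm y"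
proof -
  have "absval (B y c * B x b) \<le> vnorm x * vnorm y" if "b \<in> basis" "c \<in> basis" for b c
    using absval_B_basis[OF that(1), of x] absval_B_basis[OF that(2), of y]
    by (simp add: absval_mult mult.commute[of "absval (B y c)"] mult_mono)
  then have "absval (B y Q1 * B x P1 - B y P1 * B x Q1 + B y Q2 * B x P2 - B y P2 * B x Q2)
      \<le> vnorm x * vnorm y"
    by (intro absval_diff_le absval_add_le) (auto simp: basis_def)
  also have "B y Q1 * B x P1 - B y P1 * B x Q1 + B y Q2 * B x P2 - B y P2 * B x Q2 =
      B x (B y Q1 *s P1 - B y P1 *s Q1 + B y Q2 *s P2 - B y P2 *s Q2)"
    by (simp add: B_simps)
  finally show ?thesis by (simp add: sympl_expand[OF std])
qed

lemma vnorm_basis_le: "b \<in> basis \<Longrightarrow> vnorm b \<le> 1"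
  by (auto simp: vnorm_le_iff basis_def sympl_basisD[OF std])

definition op_le :: "'k ^ 4 ^ 4 \<Rightarrow> real \<Rightarrow> bool"
  where "op_le A r \<longleftrightarrow> (\<forall>x. vnorm (A *v x) \<le> r * vnorm x)"

lemma op_leD: "op_le A r \<Longrightarrow> vnorm (A *v x) \<le> r * vnorm x"
  by (simp add: op_le_def)

lemma op_leI: "(\<And>b. b \<in> basis \<Longrightarrow> vnorm (A *v b) \<le> r) \<Longrightarrow> op_le A r"
  unfolding op_le_def by (intro allI vnorm_expand_le[where f = "(*v) A"] matrix_vector_mul_linear_gen)

lemma op_le_mono: "op_le A r \<Longrightarrow> r \<le> s \<Longrightarrow> op_le A s"
  unfolding op_le_def by (meson mult_right_mono order_trans vnorm_nonneg)

lemma op_le_nonneg: "op_le A r \<Longrightarrow> 0 \<le> r"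
proof -
  assume "op_le A r"
  then have "0 \<le> r * vnorm P1" using op_leD[of A r P1] vnorm_nonneg[of "A *v P1"] by linarith
  moreover have "P1 \<noteq> 0" using sympl_basisD(1)[OF std] by auto
  then have "0 < vnorm P1" by simp
  ultimately show ?thesis by (simp add: zero_le_mult_iff)
qed

lemma op_le_mult:
  assumes "op_le A r" "op_le A' s" shows "op_le (A ** A') (r * s)"
  unfolding op_le_def
proof
  fix x
  have "vnorm (A *v (A' *v x)) \<le> r * vnorm (A' *v x)" using assms(1) by (rule op_leD)
  also have "\<dots> \<le> r * (s * vnorm x)"
    using op_leD[OF assms(2)] op_le_nonneg[OF assms(1)] by (intro mult_left_mono)
  finally show "vnorm ((A ** A') *v x) \<le> r * s * vnorm x"
    by (simp add: matrix_vector_mul_assoc mult.assoc)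
qed

lemma op_le_add: "op_le A r \<Longrightarrow> op_le A' r \<Longrightarrow> op_le (A + A') r"
  and op_le_diff: "op_le A r \<Longrightarrow> op_le A' r \<Longrightarrow> op_le (A - A') r"
  by (auto simp: op_le_def matrix_vector_mult_add_rdistrib matrix_vector_mult_diff_rdistrib
    intro: vnorm_add_le vnorm_diff_le)

lemma op_le_one: "op_le (mat 1) 1"
  by (simp add: op_le_def)

text \<open>The inverse is the adjoint for \<open>B\<close>, and the norm is computed by pairing
  with basis vectors, so a bound for \<open>g\<close> carries over to its inverse.\<close>

lemma op_le_inv:
  assumes g: "g \<in> carrier Sp" and r: "op_le g r" shows "op_le (inv\<^bsub>Sp\<^esub> g) r"
  unfolding op_le_def vnorm_le_iff
proof (intro allI ballI)
  fix x b assume b: "b \<in> basis"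
  have "absval (B (inv\<^bsub>Sp\<^esub> g *v x) b) \<le> vnorm x * vnorm (g *v b)"
    unfolding B_inv[OF g] by (rule absval_B_le)
  also have "\<dots> \<le> vnorm x * (r * vnorm b)" by (intro mult_left_mono op_leD[OF r]) auto
  also have "\<dots> \<le> vnorm x * (r * 1)"
    using op_le_nonneg[OF r] vnorm_basis_le[OF b] by (intro mult_left_mono) auto
  finally show "absval (B (inv\<^bsub>Sp\<^esub> g *v x) b) \<le> r * vnorm x" by (simp add: mult.commute)
qed

text \<open>Some basis vector pairs with \<open>x\<close> to an element of absolute value 1, and
  dividing by such an element does not change norms.\<close>

lemma exists_unit_partner:
  assumes "vnorm x = 1"
  obtains y where "B x y = 1" "vnorm y \<le> 1"
proof -
  obtain b where "b \<in> basis" "absval (B x b) = vnorm x" by (rule vnorm_attained)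
  then have b: "b \<in> basis" "absval (B x b) = 1" using assms by simp_all
  then have "B x b \<noteq> 0" by force
  then show ?thesis
    using b vnorm_basis_le[OF b(1)]
    by (intro that[of "inverse (B x b) *s b"]) (simp_all add: B_simps vnorm_scale)
qed

lemma vnorm_proj_le:
  assumes "vnorm p \<le> 1" "vnorm q \<le> 1" shows "vnorm (proj p q x) \<le> vnorm x"
proof -
  have "vnorm (B x y *s z) \<le> vnorm x" if "vnorm y \<le> 1" "vnorm z \<le> 1" for y z
  proof -
    have "absval (B x y) * vnorm z \<le> (vnorm x * vnorm y) * 1"
      using that absval_B_le[of x y] by (intro mult_mono) auto
    also have "\<dots> \<le> vnorm x" using that mult_left_le[of "vnorm y" "vnorm x"] by simp
    finally show ?thesis by (simp add: vnorm_scale)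
  qed
  then show ?thesis unfolding proj_def using assms by (intro vnorm_add_le vnorm_diff_le) auto
qed

end

section \<open>Cartan decomposition\<close>

context symp_std begin

lemma op_norm_attained:
  assumes f: "Vector_Spaces.linear (*s) (*s) f"
  obtains b where "b \<in> basis" "\<And>x. vnorm (f x) \<le> vnorm (f b) * vnorm x"
proof -
  have "Max ((\<lambda>b. vnorm (f b)) ` basis) \<in> (\<lambda>b. vnorm (f b)) ` basis" by (intro Max_in) auto
  then obtain b where b: "b \<in> basis" "Max ((\<lambda>b. vnorm (f b)) ` basis) = vnorm (f b)" by (rule imageE) blast
  have "vnorm (f a) \<le> vnorm (f b)" if "a \<in> basis" for a
    unfolding b(2)[symmetric] using that by (intro Max_ge) auto
  then have "vnorm (f x) \<le> vnorm (f b) * vnorm x" for x by (intro vnorm_expand_le[OF f])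
  with b(1) show ?thesis by (rule that)
qed

lemma exists_absval_eq_vnorm: obtains c :: 'k where "absval c = vnorm x"
proof -
  obtain b where "b \<in> basis" "absval (B x b) = vnorm x" by (rule vnorm_attained)
  from that[OF this(2)] show ?thesis .
qed

lemma proj_linear: "Vector_Spaces.linear (*s) (*s) (proj p q)"
  by (auto simp: Vector_Spaces.linear_iff vec.vector_space_axioms proj_def B_simps vec_eq_iff algebra_simps)

text \<open>The Cartan decomposition, phrased as the existence of two symplectic bases of the standard
  lattice that are matched up to scalars by \<open>g\<close>. The vectors \<open>p1\<close> and then \<open>p2\<close> are chosen so that
  \<open>g\<close> stretches them the most.\<close>

lemma cartan:
  assumes g: "g \<in> carrier Sp"
  obtains p1 q1 p2 q2 p1' q1' p2' q2' c d where
    "sympl_basis p1 q1 p2 q2" "sympl_basis p1' q1' p2' q2'"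
    "\<And>x. x \<in> {p1, q1, p2, q2, p1', q1', p2', q2'} \<Longrightarrow> vnorm x \<le> 1"
    "g *v p1 = c *s p1'" "g *v q1 = inverse c *s q1'" "g *v p2 = d *s p2'" "g *v q2 = inverse d *s q2'"
    "1 \<le> absval d" "absval d \<le> absval c" "op_le g (absval c)"
proof -
  define h where "h = inv\<^bsub>Sp\<^esub> g"
  have gB: "B (g *v x) (g *v y) = B x y" for x y using g unfolding Sp_iff by blast
  have hB: "B (h *v x) y = B x (g *v y)" for x y unfolding h_def by (rule B_inv[OF g])
  have gh: "g *v (h *v x) = x" for x unfolding h_def by (rule Sp_inv(4)[OF g])
  have hg: "h *v (g *v x) = x" for x unfolding h_def by (rule Sp_inv(3)[OF g])
  have g0: "x = 0" if "g *v x = 0" for x using hg[of x] that by simp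
  have lin: "Vector_Spaces.linear (*s) (*s) ((*v) g)" by (rule matrix_vector_mul_linear_gen)

  obtain p1 where p1: "p1 \<in> basis" "\<And>x. vnorm (g *v x) \<le> vnorm (g *v p1) * vnorm x"
    using op_norm_attained[OF lin] by blast
  have p1_le: "vnorm p1 \<le> 1" by (rule vnorm_basis_le[OF p1(1)])
  have "p1 \<noteq> 0" using p1(1) sympl_basisD[OF std] by (auto simp: basis_def)
  then have gp1: "g *v p1 \<noteq> 0" using g0 by blast
  \<comment> \<open>Norms of vectors are absolute values of scalars, so the largest stretching
    factor of \<open>g\<close> is realized by a scalar.\<close>
  obtain c :: 'k where c: "absval c = vnorm (g *v p1)" by (rule exists_absval_eq_vnorm[of "g *v p1"])
  have c0: "c \<noteq> 0" using c gp1 vnorm_pos[of "g *v p1"] by force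
  have gc: "op_le g (absval c)" using p1(2) by (simp add: op_le_def c)
  have hc: "op_le h (absval c)" unfolding h_def by (rule op_le_inv[OF g gc])
  define p1' where "p1' = inverse c *s (g *v p1)"
  have p1'1: "vnorm p1' = 1" using gp1 by (simp add: p1'_def vnorm_scale c)
  obtain q1' where q1': "B p1' q1' = 1" "vnorm q1' \<le> 1" by (rule exists_unit_partner[OF p1'1])
  \<comment> \<open>Forced by the required value of \<open>g *v q1\<close>. It stays in the lattice
    because \<open>h\<close>, like \<open>g\<close>, stretches by at most
    \<open>absval c\<close>.\<close>
  define q1 where "q1 = inverse c *s (h *v q1')"
  have gp1': "g *v p1 = c *s p1'" using c0 by (simp add: p1'_def)
  have gq1: "g *v q1 = inverse c *s q1'" by (simp add: q1_def vector_scalar_commute gh)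
  have B1: "B p1 q1 = 1"
    unfolding gB[of p1 q1, symmetric] gp1' gq1 using c0 q1' by (simp add: B_simps)
  have q1_le: "vnorm q1 \<le> 1"
  proof -
    have "vnorm (h *v q1') \<le> absval c * vnorm q1'" by (rule op_leD[OF hc])
    also have "\<dots> \<le> absval c * 1" using q1'(2) by (intro mult_left_mono) auto
    finally have "inverse (absval c) * vnorm (h *v q1') \<le> inverse (absval c) * absval c"
      by (intro mult_left_mono) auto
    then show ?thesis using c0 by (simp add: q1_def vnorm_scale)
  qed

  \<comment> \<open>Maximizing after the projection makes \<open>p2\<close> a vector of the
    orthogonal complement of \<open>p1\<close> and \<open>q1\<close> with the largest stretching
    there.\<close>
  let ?T = "proj p1 q1" and ?T' = "proj p1' q1'"
  have linT: "Vector_Spaces.linear (*s) (*s) (\<lambda>x. g *v ?T x)"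
    using Vector_Spaces.linear_compose[OF proj_linear lin] by (simp add: o_def)
  obtain e where e: "e \<in> basis" "\<And>x. vnorm (g *v ?T x) \<le> vnorm (g *v ?T e) * vnorm x"
    using op_norm_attained[OF linT] by blast
  define p2 where "p2 = ?T e"
  have p2_le: "vnorm p2 \<le> 1"
    unfolding p2_def using vnorm_proj_le[OF p1_le q1_le, of e] vnorm_basis_le[OF e(1)] by linarith
  have T_id: "?T x = x" if "B x p1 = 0" "B x q1 = 0" for x using that by (simp add: proj_def)
  \<comment> \<open>A nonzero vector of the complement is fixed by \<open>?T\<close>, so
    \<open>g\<close> after \<open>?T\<close> is not zero and its maximum on the basis is
    positive.\<close>
  obtain z where z: "z \<noteq> 0" "B z p1 = 0" "B z q1 = 0" by (rule complement_nonzero)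
  have gp2: "g *v p2 \<noteq> 0"
  proof
    assume "g *v p2 = 0"
    then have "vnorm (g *v z) \<le> 0" using e(2)[of z] T_id[OF z(2,3)] by (simp add: p2_def)
    then have "vnorm (g *v z) = 0" using vnorm_nonneg[of "g *v z"] by linarith
    then show False using g0 z(1) by simp
  qed
  obtain d :: 'k where d: "absval d = vnorm (g *v p2)" by (rule exists_absval_eq_vnorm[of "g *v p2"])
  have d0: "d \<noteq> 0" using d gp2 vnorm_pos[of "g *v p2"] by force
  define p2' where "p2' = inverse d *s (g *v p2)"
  have p2'1: "vnorm p2' = 1" using gp2 by (simp add: p2'_def vnorm_scale d)
  have gp2': "g *v p2 = d *s p2'" using d0 by (simp add: p2'_def)
  obtain y where y: "B p2' y = 1" "vnorm y \<le> 1" by (rule exists_unit_partner[OF p2'1])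
  have B2p: "B p2 p1 = 0" "B p2 q1 = 0" unfolding p2_def by (rule B_proj[OF B1])+
  have "c * (d * B p2' p1') = 0" "inverse c * (d * B p2' q1') = 0"
    using gB[of p2 p1] gB[of p2 q1] unfolding gp2' gp1' gq1 B2p by (simp_all add: B_simps mult_ac)
  then have B2p': "B p2' p1' = 0" "B p2' q1' = 0" using c0 d0 by simp_all
  define q2' where "q2' = ?T' y"
  have B2': "B p2' q2' = 1" unfolding q2'_def using B_proj(5)[OF q1'(1) B2p'] y by simp
  have q2'_le: "vnorm q2' \<le> 1"
    unfolding q2'_def using vnorm_proj_le[of p1' q1' y] p1'1 q1'(2) y(2) by linarith
  have B2q': "B q2' p1' = 0" "B q2' q1' = 0" unfolding q2'_def by (rule B_proj[OF q1'(1)])+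
  define q2 where "q2 = inverse d *s (h *v q2')"
  have gq2: "g *v q2 = inverse d *s q2'" by (simp add: q2_def vector_scalar_commute gh)
  have B2: "B p2 q2 = 1"
    unfolding gB[of p2 q2, symmetric] gp2' gq2 using d0 B2' by (simp add: B_simps)
  have B2q: "B q2 p1 = 0" "B q2 q1 = 0"
    unfolding gB[of q2, symmetric] gq2 gp1' gq1 by (simp_all add: B_simps B2q')
  have gT: "vnorm (g *v x) \<le> absval d * vnorm x" if "B x p1 = 0" "B x q1 = 0" for x
    using e(2)[of x] T_id[OF that] by (simp add: d p2_def)
  \<comment> \<open>The vector \<open>h *v q2'\<close> is orthogonal to \<open>p1\<close> and
    \<open>q1\<close>, so it pairs with \<open>b\<close> as with the projection of \<open>b\<close>,
    and on projections \<open>g\<close> stretches by at most \<open>absval d\<close>.\<close>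
  have q2_le: "vnorm q2 \<le> 1"
  proof -
    have "vnorm (h *v q2') \<le> absval d" unfolding vnorm_le_iff
    proof
      fix b assume b: "b \<in> basis"
      have "B (h *v q2') p1 = 0" "B (h *v q2') q1 = 0" using B2q d0 by (simp_all add: q2_def B_simps)
      then have "B (h *v q2') b = B (h *v q2') (?T b)" using B_proj(5)[OF B1] by simp
      also have "\<dots> = B q2' (g *v ?T b)" by (rule hB)
      finally have "absval (B (h *v q2') b) \<le> vnorm q2' * vnorm (g *v ?T b)" using absval_B_le by simp
      also have "\<dots> \<le> 1 * (absval d * 1)"
      proof (rule mult_mono)
        have "vnorm (g *v ?T b) \<le> absval d * vnorm b" using e(2)[of b] by (simp add: d p2_def)
        also have "\<dots> \<le> absval d * 1" using vnorm_basis_le[OF b] by (intro mult_left_mono) auto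
        finally show "vnorm (g *v ?T b) \<le> absval d * 1" .
      qed (use q2'_le in auto)
      finally show "absval (B (h *v q2') b) \<le> absval d" by simp
    qed
    then have "inverse (absval d) * vnorm (h *v q2') \<le> inverse (absval d) * absval d"
      by (intro mult_left_mono) auto
    then show ?thesis using d0 by (simp add: q2_def vnorm_scale)
  qed
  have "absval d \<le> absval c * vnorm p2" unfolding d by (rule op_leD[OF gc])
  also have "\<dots> \<le> absval c * 1" using p2_le by (intro mult_left_mono) auto
  finally have dc: "absval d \<le> absval c" by simp
  \<comment> \<open>The norm of \<open>g *v q2\<close> is at least the inverse of
    \<open>absval d\<close>, as \<open>q2'\<close> has norm at least 1, and at most
    \<open>absval d\<close>, the largest stretching on the complement. Comparing the two gives
    \<open>1 \<le> absval d\<close>.\<close>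
  have "1 \<le> vnorm q2'" using absval_B_le[of p2' q2'] B2' p2'1 by simp
  then have "inverse (absval d) \<le> inverse (absval d) * vnorm q2'"
    using mult_left_mono[of 1 "vnorm q2'" "inverse (absval d)"] by simp
  also have "\<dots> = vnorm (g *v q2)" by (simp add: gq2 vnorm_scale)
  also have "\<dots> \<le> absval d * vnorm q2" by (rule gT[OF B2q])
  also have "\<dots> \<le> absval d * 1" using q2_le by (intro mult_left_mono) auto
  finally have "absval d * inverse (absval d) \<le> absval d * absval d" by (intro mult_left_mono) auto
  then have "1 \<le> absval d * absval d" using d0 by simp
  then have d1: "1 \<le> absval d" using mult_strict_mono[of "absval d" 1 "absval d" 1]
    by (cases "absval d < 1") simp_all
  show ?thesis
  proof (rule that[of p1 q1 p2 q2 p1' q1' p2' q2' c d])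
    show "sympl_basis p1 q1 p2 q2" unfolding sympl_basis_def
      using B1 B2 B2p B2q B_skew[of p1 p2] B_skew[of p1 q2] B_skew[of q1 p2] B_skew[of q1 q2] by simp
    show "sympl_basis p1' q1' p2' q2'" unfolding sympl_basis_def
      using q1' B2' B2p' B2q' B_skew[of p1' p2'] B_skew[of p1' q2'] B_skew[of q1' p2'] B_skew[of q1' q2'] by simp
    show "\<And>x. x \<in> {p1, q1, p2, q2, p1', q1', p2', q2'} \<Longrightarrow> vnorm x \<le> 1"
      using p1_le q1_le p2_le q2_le p1'1 p2'1 q1'(2) q2'_le by auto
  qed (fact gp1' gq1 gp2' gq2 d1 dc gc)+
qed

text \<open>An element of the split torus in the closed dominant chamber.\<close>

definition diag :: "'k ^ 4 ^ 4 \<Rightarrow> 'k \<Rightarrow> 'k \<Rightarrow> bool"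
  where "diag a c d \<longleftrightarrow> a \<in> carrier Sp \<and> 1 \<le> absval d \<and> absval d \<le> absval c \<and>
    a *v P1 = c *s P1 \<and> a *v Q1 = inverse c *s Q1 \<and> a *v P2 = d *s P2 \<and> a *v Q2 = inverse d *s Q2"

text \<open>The stabilizer of the standard lattice, a maximal compact subgroup; by
  \<open>op_le_inv\<close> the one-sided bound is enough.\<close>

definition K0 :: "('k ^ 4 ^ 4) set" where "K0 = {g \<in> carrier Sp. op_le g 1}"

lemma subgroup_K0: "subgroup K0 Sp"
proof (rule subgroup.intro)
  show "K0 \<subseteq> carrier Sp" by (auto simp: K0_def)
  show "\<one>\<^bsub>Sp\<^esub> \<in> K0" using Sp.one_closed op_le_one by (simp add: K0_def)
  show "inv\<^bsub>Sp\<^esub> x \<in> K0" if "x \<in> K0" for x using that op_le_inv by (simp add: K0_def)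
  show "x \<otimes>\<^bsub>Sp\<^esub> y \<in> K0" if "x \<in> K0" "y \<in> K0" for x y
  proof -
    have "x \<otimes>\<^bsub>Sp\<^esub> y \<in> carrier Sp" using that by (intro Sp.m_closed) (auto simp: K0_def)
    then show ?thesis using that op_le_mult[of x 1 y 1] by (simp add: K0_def)
  qed
qed

text \<open>The last conclusion ties the size of \<open>g\<close> to its torus part: if
  \<open>g\<close> is not bounded by a constant, then \<open>absval c\<close> exceeds it.\<close>

lemma cartan_KAK:
  assumes g: "g \<in> carrier Sp"
  obtains k a k' c d where "k \<in> K0" "k' \<in> K0" "diag a c d" "g = k' ** a ** k" "op_le g (absval c)"
proof -
  obtain p1 q1 p2 q2 p1' q1' p2' q2' c d where *:
    "sympl_basis p1 q1 p2 q2" "sympl_basis p1' q1' p2' q2'"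
    "\<And>x. x \<in> {p1, q1, p2, q2, p1', q1', p2', q2'} \<Longrightarrow> vnorm x \<le> 1"
    "g *v p1 = c *s p1'" "g *v q1 = inverse c *s q1'" "g *v p2 = d *s p2'" "g *v q2 = inverse d *s q2'"
    "1 \<le> absval d" "absval d \<le> absval c" "op_le g (absval c)" by (rule cartan[OF g]) blast
  obtain k where k: "k \<in> carrier Sp" "k *v P1 = p1" "k *v Q1 = q1" "k *v P2 = p2" "k *v Q2 = q2"
    by (rule sympl_transport[OF std *(1)])
  obtain k' where k': "k' \<in> carrier Sp" "k' *v P1 = p1'" "k' *v Q1 = q1'" "k' *v P2 = p2'" "k' *v Q2 = q2'"
    by (rule sympl_transport[OF std *(2)])
  have kK: "k \<in> K0" unfolding K0_def using k *(3) by (auto intro!: op_leI simp: basis_def)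
  have kK': "k' \<in> K0" unfolding K0_def using k' *(3) by (auto intro!: op_leI simp: basis_def)
  define a where "a = inv\<^bsub>Sp\<^esub> k' ** g ** k"
  have aSp: "a \<in> carrier Sp"
    using Sp.m_closed[OF Sp.m_closed[OF Sp.inv_closed[OF k'(1)] g] k(1)] by (simp add: a_def)
  have inv_k': "inv\<^bsub>Sp\<^esub> k' *v p1' = P1" "inv\<^bsub>Sp\<^esub> k' *v q1' = Q1" "inv\<^bsub>Sp\<^esub> k' *v p2' = P2"
    "inv\<^bsub>Sp\<^esub> k' *v q2' = Q2"
    using Sp_inv(3)[OF k'(1)] k'(2-5) by metis+
  have a_v: "a *v x = inv\<^bsub>Sp\<^esub> k' *v (g *v (k *v x))" for x
    by (simp add: a_def matrix_vector_mul_assoc matrix_mul_assoc)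
  have "diag a c d" unfolding diag_def a_v k *(4-7)
    using aSp *(8,9) by (simp add: vector_scalar_commute inv_k')
  moreover have "g = k' ** a ** inv\<^bsub>Sp\<^esub> k"
  proof -
    have "k' ** a ** inv\<^bsub>Sp\<^esub> k = (k' ** inv\<^bsub>Sp\<^esub> k') ** g ** (k ** inv\<^bsub>Sp\<^esub> k)"
      by (simp only: a_def matrix_mul_assoc)
    then show ?thesis by (simp add: Sp_inv(2)[OF k'(1)] Sp_inv(2)[OF k(1)])
  qed
  moreover have "inv\<^bsub>Sp\<^esub> k \<in> K0" by (rule subgroup.m_inv_closed[OF subgroup_K0 kK])
  ultimately show ?thesis using kK' *(10) by (intro that[of "inv\<^bsub>Sp\<^esub> k" k' a c d])
qed

lemma diag_inv:
  assumes "diag a c d"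
  shows "inv\<^bsub>Sp\<^esub> a *v P1 = inverse c *s P1" "inv\<^bsub>Sp\<^esub> a *v Q1 = c *s Q1"
    "inv\<^bsub>Sp\<^esub> a *v P2 = inverse d *s P2" "inv\<^bsub>Sp\<^esub> a *v Q2 = d *s Q2"
proof -
  have a: "a \<in> carrier Sp" and cd: "c \<noteq> 0" "d \<noteq> 0" using assms by (auto simp: diag_def)
  have "inv\<^bsub>Sp\<^esub> a *v x = inverse t *s x" if "a *v x = t *s x" "t \<noteq> 0" for x t
  proof -
    have "inverse t *s x = inv\<^bsub>Sp\<^esub> a *v (a *v (inverse t *s x))" by (simp only: Sp_inv(3)[OF a])
    also have "a *v (inverse t *s x) = x" using that by (simp add: vector_scalar_commute)
    finally show ?thesis by simp
  qed
  from this[of P1 c] this[of Q1 "inverse c"] this[of P2 d] this[of Q2 "inverse d"]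
  show "inv\<^bsub>Sp\<^esub> a *v P1 = inverse c *s P1" "inv\<^bsub>Sp\<^esub> a *v Q1 = c *s Q1"
    "inv\<^bsub>Sp\<^esub> a *v P2 = inverse d *s P2" "inv\<^bsub>Sp\<^esub> a *v Q2 = d *s Q2"
    using assms cd by (simp_all add: diag_def)
qed

lemma diag_expand:
  assumes "diag a c d"
  shows "a *v y = (B y Q1 * c) *s P1 - (B y P1 * inverse c) *s Q1 + (B y Q2 * d) *s P2 - (B y P2 * inverse d) *s Q2"
proof -
  have "a *v y = a *v (B y Q1 *s P1 - B y P1 *s Q1 + B y Q2 *s P2 - B y P2 *s Q2)"
    by (simp only: sympl_expand[OF std])
  also have "\<dots> = B y Q1 *s (a *v P1) - B y P1 *s (a *v Q1) + B y Q2 *s (a *v P2) - B y P2 *s (a *v Q2)"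
    by (simp only: matrix_vector_right_distrib matrix_vector_mult_diff_distrib vector_scalar_commute)
  finally show ?thesis using assms by (simp add: diag_def)
qed

lemma conj_minus_one:
  assumes a: "a \<in> carrier Sp"
  shows "(a ** n ** inv\<^bsub>Sp\<^esub> a - mat 1) *v x = a *v ((n - mat 1) *v (inv\<^bsub>Sp\<^esub> a *v x))"
proof -
  have "a *v ((n - mat 1) *v (inv\<^bsub>Sp\<^esub> a *v x)) = a *v (n *v (inv\<^bsub>Sp\<^esub> a *v x)) - a *v (inv\<^bsub>Sp\<^esub> a *v x)"
    by (simp add: matrix_vector_mult_diff_rdistrib matrix_vector_mult_diff_distrib)
  also have "\<dots> = (a ** n ** inv\<^bsub>Sp\<^esub> a) *v x - x"
    by (simp add: Sp_inv(2)[OF a] matrix_vector_mul_assoc matrix_mul_assoc)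
  finally show ?thesis by (simp add: matrix_vector_mult_diff_rdistrib)
qed

end

section \<open>Contraction of unipotent radicals\<close>

text \<open>The chain is 0, \<open>W\<close>, its perp and the whole space, the middle two
  coinciding if \<open>W\<close> is Lagrangian. The strictly smaller member provided by the
  definition is contained in the subspace named here in either case.\<close>

lemma unipotent_radical_single:
  assumes n: "n \<in> unipotent_radical B {W}" and W: "vec.subspace W" "W \<noteq> {0}" "W \<subseteq> perp B W"
    and B0: "\<And>w. B 0 w = 0"
  shows "n \<in> carrier (Sp_group B)" "v \<in> W \<Longrightarrow> n *v v = v"
    "v \<in> perp B W \<Longrightarrow> n *v v - v \<in> W" "n *v v - v \<in> perp B W"
proof -
  have ff: "full_flag B {W} = {{0}, UNIV, W, perp B W}" by (auto simp: full_flag_def)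
  have n': "\<exists>W'\<in>full_flag B {W}. W' \<subset> U \<and> n *v v - v \<in> W'"
    if "U \<in> full_flag B {W}" "U \<noteq> {0}" "v \<in> U" for U v
    using n that unfolding unipotent_radical_def by blast
  have 0: "0 \<in> W" "0 \<in> perp B W" using vec.subspace_0[OF W(1)] B0 by (auto simp: perp_def)
  show "n \<in> carrier (Sp_group B)" using n by (simp add: unipotent_radical_def)
  show "n *v v = v" if "v \<in> W"
    using n'[of W v] that W unfolding ff by auto
  show "n *v v - v \<in> W" if "v \<in> perp B W"
  proof -
    have "perp B W \<noteq> {0}" using W 0 by blast
    then show ?thesis using n'[of "perp B W" v] that W 0 unfolding ff by auto
  qed
  have "(UNIV :: ('a ^ 'b) set) \<noteq> {0}"
  proof
    assume "(UNIV :: ('a ^ 'b) set) = {0}"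
    then show False using W(2) 0(1) by blast
  qed
  then show "n *v v - v \<in> perp B W"
    using n'[of UNIV v] W 0 unfolding ff by auto
qed

context symp_std begin

text \<open>The line and, in \<open>siegel\<close>, the Lagrangian plane in the directions that a
  \<open>diag\<close> element does not stretch. So conjugation by it contracts the unipotent
  radicals of their stabilizers, the Klingen and the Siegel parabolic.\<close>

definition klingen :: "('k ^ 4) set" where "klingen = {t *s Q1 | t. True}"
definition siegel :: "('k ^ 4) set" where "siegel = {s *s Q1 + t *s Q2 | s t. True}"

lemma Q1_klingen: "Q1 \<in> klingen" and Q_siegel: "Q1 \<in> siegel" "Q2 \<in> siegel"
proof -
  have "1 *s Q1 \<in> klingen" unfolding klingen_def by blast
  then show "Q1 \<in> klingen" by simp
  have "1 *s Q1 + 0 *s Q2 \<in> siegel" "0 *s Q1 + 1 *s Q2 \<in> siegel" unfolding siegel_def by blast+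
  then show "Q1 \<in> siegel" "Q2 \<in> siegel" by simp_all
qed

lemma subspace_klingen: "vec.subspace klingen" and subspace_siegel: "vec.subspace siegel"
proof -
  show "vec.subspace klingen" unfolding vec.subspace_def
  proof (intro conjI ballI allI)
    have "0 *s Q1 \<in> klingen" unfolding klingen_def by blast
    then show "0 \<in> klingen" by simp
  next
    fix x y assume "x \<in> klingen" "y \<in> klingen"
    then obtain s t where st: "x = s *s Q1" "y = t *s Q1" unfolding klingen_def by blast
    have "(s + t) *s Q1 \<in> klingen" unfolding klingen_def by blast
    then show "x + y \<in> klingen" unfolding st vec.scale_left_distrib .
  next
    fix c x assume "x \<in> klingen"
    then obtain t where t: "x = t *s Q1" unfolding klingen_def by blast
    have "(c * t) *s Q1 \<in> klingen" unfolding klingen_def by blast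
    then show "c *s x \<in> klingen" unfolding t by simp
  qed
  show "vec.subspace siegel" unfolding vec.subspace_def
  proof (intro conjI ballI allI)
    have "0 *s Q1 + 0 *s Q2 \<in> siegel" unfolding siegel_def by blast
    then show "0 \<in> siegel" by simp
  next
    fix x y assume "x \<in> siegel" "y \<in> siegel"
    then obtain s t s' t' where st: "x = s *s Q1 + t *s Q2" "y = s' *s Q1 + t' *s Q2"
      unfolding siegel_def by blast
    have "(s + s') *s Q1 + (t + t') *s Q2 \<in> siegel" unfolding siegel_def by blast
    then show "x + y \<in> siegel" unfolding st vec.scale_left_distrib by (simp only: add_ac)
  next
    fix c x assume "x \<in> siegel"
    then obtain s t where st: "x = s *s Q1 + t *s Q2" unfolding siegel_def by blast
    have "(c * s) *s Q1 + (c * t) *s Q2 \<in> siegel" unfolding siegel_def by blast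
    then show "c *s x \<in> siegel" unfolding st vec.scale_right_distrib by simp
  qed
qed

lemma perp_klingen: "y \<in> perp B klingen \<longleftrightarrow> B y Q1 = 0"
proof
  assume "y \<in> perp B klingen"
  then show "B y Q1 = 0" using Q1_klingen unfolding perp_def by blast
qed (auto simp: perp_def klingen_def B_simps)

lemma perp_siegel: "y \<in> perp B siegel \<longleftrightarrow> B y Q1 = 0 \<and> B y Q2 = 0"
proof
  assume "y \<in> perp B siegel"
  then show "B y Q1 = 0 \<and> B y Q2 = 0" using Q_siegel unfolding perp_def by blast
qed (auto simp: perp_def siegel_def B_simps)

lemma Q_nonzero: "Q1 \<noteq> 0"
  using sympl_basisD[OF std] by auto

lemma isotropic_flag_klingen: "isotropic_flag B {klingen}"
  and isotropic_flag_siegel: "isotropic_flag B {siegel}"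
proof -
  have "klingen \<subseteq> perp B klingen" unfolding perp_klingen subset_iff
    by (auto simp: klingen_def B_simps)
  moreover have "siegel \<subseteq> perp B siegel" unfolding perp_siegel subset_iff
    by (auto simp: siegel_def B_simps sympl_basisD[OF std])
  moreover have "klingen \<noteq> {0}" "siegel \<noteq> {0}" using Q1_klingen Q_siegel Q_nonzero by auto
  ultimately show "isotropic_flag B {klingen}" "isotropic_flag B {siegel}"
    using subspace_klingen subspace_siegel by (simp_all add: isotropic_flag_def)
qed

lemma unipotent_klingen:
  assumes n: "n \<in> unipotent_radical B {klingen}"
  shows "n \<in> carrier Sp" "n *v Q1 = Q1" "B y Q1 = 0 \<Longrightarrow> n *v y - y \<in> klingen" "B (n *v y - y) Q1 = 0"
proof -
  have W: "vec.subspace klingen" "klingen \<noteq> {0}" "klingen \<subseteq> perp B klingen"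
    using isotropic_flag_klingen by (simp_all add: isotropic_flag_def)
  note u = unipotent_radical_single[OF n W B_zero_left]
  show "n \<in> carrier Sp" "n *v Q1 = Q1" by (rule u(1), rule u(2)[OF Q1_klingen])
  show "B y Q1 = 0 \<Longrightarrow> n *v y - y \<in> klingen" using u(3) by (simp add: perp_klingen)
  show "B (n *v y - y) Q1 = 0" using u(4) by (simp add: perp_klingen)
qed

lemma unipotent_siegel:
  assumes n: "n \<in> unipotent_radical B {siegel}"
  shows "n \<in> carrier Sp" "n *v Q1 = Q1" "n *v Q2 = Q2" "B (n *v y - y) Q1 = 0" "B (n *v y - y) Q2 = 0"
proof -
  have W: "vec.subspace siegel" "siegel \<noteq> {0}" "siegel \<subseteq> perp B siegel"
    using isotropic_flag_siegel by (simp_all add: isotropic_flag_def)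
  note u = unipotent_radical_single[OF n W B_zero_left]
  show "n \<in> carrier Sp" "n *v Q1 = Q1" "n *v Q2 = Q2"
    by (rule u(1), rule u(2)[OF Q_siegel(1)], rule u(2)[OF Q_siegel(2)])
  show "B (n *v y - y) Q1 = 0" "B (n *v y - y) Q2 = 0" using u(4) by (simp_all add: perp_siegel)
qed

lemma vnorm_scale_basis: "b \<in> basis \<Longrightarrow> absval s \<le> r \<Longrightarrow> vnorm (s *s b) \<le> r"
  using mult_mono[of "absval s" r "vnorm b" 1] vnorm_basis_le[of b] absval_nonneg[of s]
  by (simp add: vnorm_scale)

lemma in_basis: "P1 \<in> basis" "Q1 \<in> basis" "P2 \<in> basis" "Q2 \<in> basis"
  by (simp_all add: basis_def)

text \<open>Here n - 1 kills \<open>Q1\<close>, sends \<open>P2\<close> and \<open>Q2\<close> to the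
  line of \<open>Q1\<close>, and sends \<open>P1\<close> to the span of \<open>Q1\<close>,
  \<open>P2\<close> and \<open>Q2\<close>. Conjugation scales the entries by 1/c^2, 1/(cd) and d/c,
  of which d/c is the largest.\<close>

lemma conj_klingen:
  assumes a: "diag a c d" and n: "n \<in> unipotent_radical B {klingen}" and r: "op_le (n - mat 1) r"
  shows "op_le (a ** n ** inv\<^bsub>Sp\<^esub> a - mat 1) (r * absval d / absval c)"
proof (rule op_leI)
  have aSp: "a \<in> carrier Sp" and d1: "1 \<le> absval d" and dc: "absval d \<le> absval c"
    using a by (auto simp: diag_def)
  have c1: "1 \<le> absval c" using d1 dc by linarith
  have r0: "0 \<le> r" by (rule op_le_nonneg[OF r])
  have id: "inverse (absval d) \<le> 1" using d1 by (simp add: inverse_le_1_iff)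
  have ic: "inverse (absval c) \<le> 1" using c1 by (simp add: inverse_le_1_iff)
  note u = unipotent_klingen[OF n]
  have y: "vnorm (n *v b - b) \<le> r" if "b \<in> basis" for b
    using op_leD[OF r, of b] vnorm_basis_le[OF that] mult_left_le[of "vnorm b" r] r0
    by (simp add: matrix_vector_mult_diff_rdistrib)
  have conj: "(a ** n ** inv\<^bsub>Sp\<^esub> a - mat 1) *v b = t *s (a *v (n *v b - b))"
    if "inv\<^bsub>Sp\<^esub> a *v b = t *s b" for b t
    unfolding conj_minus_one[OF aSp] that
    by (simp add: matrix_vector_mult_diff_rdistrib matrix_vector_mult_diff_distrib
      vector_scalar_commute vec.scale_right_diff_distrib)
  have short: "vnorm (t *s (a *v (n *v b - b))) \<le> r * absval d / absval c"
    if b: "b \<in> basis" "B b Q1 = 0" and t: "absval t \<le> absval d" for b t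
  proof -
    obtain s where s: "n *v b - b = s *s Q1" using u(3)[OF b(2)] by (auto simp: klingen_def)
    have "absval s = absval (B (n *v b - b) P1)" by (simp add: s B_simps sympl_basisD[OF std])
    also have "\<dots> \<le> r" using absval_B_basis[OF in_basis(1)] y[OF b(1)] order_trans by blast
    finally have s_r: "absval s \<le> r" .
    have "t *s (a *v (n *v b - b)) = (t * (s * inverse c)) *s Q1"
      using a by (simp add: s diag_def vector_scalar_commute)
    moreover have "absval (t * (s * inverse c)) \<le> absval d * (r * inverse (absval c))"
      unfolding absval_mult absval_inverse using t s_r r0 by (intro mult_mono mult_right_mono) auto
    ultimately show ?thesis
      using vnorm_scale_basis[OF in_basis(2)] by (simp add: divide_inverse mult_ac)
  qed
  fix b assume "b \<in> basis"
  then consider "b = P1" | "b = Q1" | "b = P2" | "b = Q2" by (auto simp: basis_def)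
  then show "vnorm ((a ** n ** inv\<^bsub>Sp\<^esub> a - mat 1) *v b) \<le> r * absval d / absval c"
  proof cases
    case 1
    let ?y = "n *v P1 - P1"
    have yc: "absval (B ?y e) \<le> r" if "e \<in> basis" for e
      using absval_B_basis[OF that] y[OF in_basis(1)] order_trans by blast
    have "absval (B ?y P1 * inverse c) \<le> r * absval d"
      unfolding absval_mult absval_inverse using yc[OF in_basis(1)] ic d1 r0 by (intro mult_mono) auto
    moreover have "absval (B ?y Q2 * d) \<le> r * absval d"
      unfolding absval_mult using yc[OF in_basis(4)] by (intro mult_right_mono) auto
    moreover have "absval (B ?y P2 * inverse d) \<le> r * absval d"
      unfolding absval_mult absval_inverse using yc[OF in_basis(3)] id d1 r0 by (intro mult_mono) auto
    moreover have "absval (B ?y Q1 * c) \<le> r * absval d" using u(4)[of P1] r0 by simp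
    ultimately have "vnorm (a *v ?y) \<le> r * absval d"
      unfolding diag_expand[OF a] by (intro vnorm_diff_le vnorm_add_le vnorm_scale_basis in_basis)
    then have "inverse (absval c) * vnorm (a *v ?y) \<le> inverse (absval c) * (r * absval d)"
      by (intro mult_left_mono) auto
    then show ?thesis unfolding 1 conj[OF diag_inv(1)[OF a]] by (simp add: vnorm_scale divide_inverse mult_ac)
  next
    case 2
    show ?thesis unfolding 2 conj[OF diag_inv(2)[OF a]] u(2) using r0 by simp
  next
    case 3
    show ?thesis unfolding 3 conj[OF diag_inv(3)[OF a]]
      using id d1 by (intro short in_basis) (simp_all add: sympl_basisD[OF std])
  next
    case 4
    show ?thesis unfolding 4 conj[OF diag_inv(4)[OF a]]
      by (intro short in_basis) (simp_all add: sympl_basisD[OF std])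
  qed
qed

text \<open>Here n - 1 kills \<open>Q1\<close> and \<open>Q2\<close> and sends \<open>P1\<close> and
  \<open>P2\<close> to their span. Conjugation scales the entries by 1/c^2, 1/(cd) and 1/d^2; as c
  and d have absolute value at least 1, the simpler bound by 1/d follows.\<close>

lemma conj_siegel:
  assumes a: "diag a c d" and n: "n \<in> unipotent_radical B {siegel}" and r: "op_le (n - mat 1) r"
  shows "op_le (a ** n ** inv\<^bsub>Sp\<^esub> a - mat 1) (r / absval d)"
proof (rule op_leI)
  have aSp: "a \<in> carrier Sp" and d1: "1 \<le> absval d" and dc: "absval d \<le> absval c"
    using a by (auto simp: diag_def)
  have c1: "1 \<le> absval c" using d1 dc by linarith
  have r0: "0 \<le> r" by (rule op_le_nonneg[OF r])
  have id: "inverse (absval d) \<le> 1" using d1 by (simp add: inverse_le_1_iff)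
  have ic: "inverse (absval c) \<le> 1" using c1 by (simp add: inverse_le_1_iff)
  have icd: "inverse (absval c) \<le> inverse (absval d)" using d1 dc by (intro le_imp_inverse_le) auto
  note u = unipotent_siegel[OF n]
  have y: "vnorm (n *v b - b) \<le> r" if "b \<in> basis" for b
    using op_leD[OF r, of b] vnorm_basis_le[OF that] mult_left_le[of "vnorm b" r] r0
    by (simp add: matrix_vector_mult_diff_rdistrib)
  have conj: "(a ** n ** inv\<^bsub>Sp\<^esub> a - mat 1) *v b = t *s (a *v (n *v b - b))"
    if "inv\<^bsub>Sp\<^esub> a *v b = t *s b" for b t
    unfolding conj_minus_one[OF aSp] that
    by (simp add: matrix_vector_mult_diff_rdistrib matrix_vector_mult_diff_distrib
      vector_scalar_commute vec.scale_right_diff_distrib)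
  have short: "vnorm (t *s (a *v (n *v b - b))) \<le> r / absval d"
    if b: "b \<in> basis" and t: "absval t \<le> 1" for b t
  proof -
    let ?y = "n *v b - b"
    have yc: "absval (B ?y e) \<le> r" if "e \<in> basis" for e
      using absval_B_basis[OF that] y[OF b] order_trans by blast
    have "absval (B ?y P1 * inverse c) \<le> r * inverse (absval d)"
      unfolding absval_mult absval_inverse using yc[OF in_basis(1)] icd r0 by (intro mult_mono) auto
    moreover have "absval (B ?y P2 * inverse d) \<le> r * inverse (absval d)"
      unfolding absval_mult absval_inverse using yc[OF in_basis(3)] by (intro mult_right_mono) auto
    moreover have "absval (B ?y Q1 * c) \<le> r * inverse (absval d)" "absval (B ?y Q2 * d) \<le> r * inverse (absval d)"
      using u(4,5)[of b] r0 by simp_all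
    ultimately have "vnorm (a *v ?y) \<le> r * inverse (absval d)"
      unfolding diag_expand[OF a] by (intro vnorm_diff_le vnorm_add_le vnorm_scale_basis in_basis)
    then have "absval t * vnorm (a *v ?y) \<le> 1 * (r * inverse (absval d))"
      using t by (intro mult_mono) auto
    then show ?thesis by (simp add: vnorm_scale divide_inverse)
  qed
  fix b assume "b \<in> basis"
  then consider "b = P1" | "b = Q1" | "b = P2" | "b = Q2" by (auto simp: basis_def)
  then show "vnorm ((a ** n ** inv\<^bsub>Sp\<^esub> a - mat 1) *v b) \<le> r / absval d"
  proof cases
    case 1
    show ?thesis unfolding 1 conj[OF diag_inv(1)[OF a]] using ic by (intro short in_basis) simp
  next
    case 2
    show ?thesis unfolding 2 conj[OF diag_inv(2)[OF a]] u(2) using r0 by simp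
  next
    case 3
    show ?thesis unfolding 3 conj[OF diag_inv(3)[OF a]] using id by (intro short in_basis) simp
  next
    case 4
    show ?thesis unfolding 4 conj[OF diag_inv(4)[OF a]] u(3) using r0 by simp
  qed
qed

lemma exists_op_le: obtains r where "op_le A r"
proof -
  have "Vector_Spaces.linear (*s) (*s) ((*v) A)" by (rule matrix_vector_mul_linear_gen)
  then obtain b where "\<And>x. vnorm (A *v x) \<le> vnorm (A *v b) * vnorm x" by (rule op_norm_attained) blast
  then have "op_le A (vnorm (A *v b))" by (simp add: op_le_def)
  then show ?thesis by (rule that)
qed

section \<open>Principal congruence subgroups and finite coverings\<close>

definition cong :: "real \<Rightarrow> ('k ^ 4 ^ 4) set"
  where "cong \<epsilon> = {g \<in> carrier Sp. op_le (g - mat 1) \<epsilon>}"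

lemma cong_subset_K0: "\<epsilon> \<le> 1 \<Longrightarrow> cong \<epsilon> \<subseteq> K0"
proof
  fix g assume "\<epsilon> \<le> 1" "g \<in> cong \<epsilon>"
  then have g: "g \<in> carrier Sp" "op_le (g - mat 1) 1" using op_le_mono by (auto simp: cong_def)
  from op_le_add[OF g(2) op_le_one] have "op_le g 1" by simp
  then show "g \<in> K0" using g by (simp add: K0_def)
qed

text \<open>Elements of \<open>K0\<close> and their inverses have operator norm at most 1, so
  conjugation by them does not increase the distance to the identity.\<close>

lemma cong_conj:
  assumes k: "k \<in> K0" and m: "m \<in> cong \<epsilon>" shows "k ** m ** inv\<^bsub>Sp\<^esub> k \<in> cong \<epsilon>"
proof -
  have kSp: "k \<in> carrier Sp" "op_le k 1" and mSp: "m \<in> carrier Sp" "op_le (m - mat 1) \<epsilon>"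
    using k m by (auto simp: K0_def cong_def)
  have "op_le (k ** (m - mat 1) ** inv\<^bsub>Sp\<^esub> k) (1 * \<epsilon> * 1)"
    by (intro op_le_mult kSp mSp op_le_inv)
  moreover have "k ** (m - mat 1) ** inv\<^bsub>Sp\<^esub> k = k ** m ** inv\<^bsub>Sp\<^esub> k - mat 1"
    by (simp add: matrix_eq conj_minus_one[OF kSp(1)] matrix_vector_mul_assoc[symmetric])
  moreover have "k ** m ** inv\<^bsub>Sp\<^esub> k \<in> carrier Sp"
    using Sp.m_closed[OF Sp.m_closed[OF kSp(1) mSp(1)] Sp.inv_closed[OF kSp(1)]] by simp
  ultimately show ?thesis by (simp add: cong_def)
qed

lemma op_le_zero: "0 \<le> r \<Longrightarrow> op_le 0 r"
  by (simp add: op_le_def)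

text \<open>In g h - 1 = (g - 1) h + (h - 1) the factor h has to have norm at most 1, which is where
  \<open>\<epsilon> \<le> 1\<close> enters.\<close>

lemma subgroup_cong:
  assumes "0 \<le> \<epsilon>" "\<epsilon> \<le> 1" shows "subgroup (cong \<epsilon>) Sp"
proof (rule subgroup.intro)
  show "cong \<epsilon> \<subseteq> carrier Sp" by (auto simp: cong_def)
  show "\<one>\<^bsub>Sp\<^esub> \<in> cong \<epsilon>" using Sp.one_closed op_le_zero[OF assms(1)] by (simp add: cong_def)
  fix g assume g: "g \<in> cong \<epsilon>"
  then have gSp: "g \<in> carrier Sp" "op_le (g - mat 1) \<epsilon>" by (auto simp: cong_def)
  have "op_le g 1" using cong_subset_K0[OF assms(2)] g by (auto simp: K0_def)
  then have g1: "op_le (inv\<^bsub>Sp\<^esub> g) 1" by (rule op_le_inv[OF gSp(1)])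
  have "op_le (- (g - mat 1)) \<epsilon>" using op_le_diff[OF op_le_zero[OF assms(1)] gSp(2)] by simp
  then have "op_le (inv\<^bsub>Sp\<^esub> g ** (- (g - mat 1))) (1 * \<epsilon>)" by (intro op_le_mult g1)
  moreover have "inv\<^bsub>Sp\<^esub> g ** (- (g - mat 1)) = inv\<^bsub>Sp\<^esub> g - mat 1"
    by (simp add: matrix_eq matrix_vector_mul_assoc[symmetric] matrix_vector_mult_diff_rdistrib
      matrix_vector_mult_diff_distrib Sp_inv(3)[OF gSp(1)])
  ultimately show "inv\<^bsub>Sp\<^esub> g \<in> cong \<epsilon>" using gSp by (simp add: cong_def)
  fix h assume h: "h \<in> cong \<epsilon>"
  then have hSp: "h \<in> carrier Sp" "op_le (h - mat 1) \<epsilon>" by (auto simp: cong_def)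
  have "op_le h 1" using cong_subset_K0[OF assms(2)] h by (auto simp: K0_def)
  then have "op_le ((g - mat 1) ** h + (h - mat 1)) \<epsilon>"
    using op_le_mult[OF gSp(2), of h 1] hSp by (intro op_le_add) simp_all
  moreover have "(g - mat 1) ** h + (h - mat 1) = g ** h - mat 1"
    by (simp add: matrix_eq matrix_vector_mul_assoc[symmetric] matrix_vector_mult_diff_rdistrib
      matrix_vector_mult_add_rdistrib)
  moreover have "g ** h \<in> carrier Sp" using Sp.m_closed[OF gSp(1) hSp(1)] by simp
  ultimately show "g \<otimes>\<^bsub>Sp\<^esub> h \<in> cong \<epsilon>" by (simp add: cong_def)
qed

text \<open>Rounding the 16 pairings of basis vectors with their images leaves finitely many
  patterns. One group element is kept for each pattern, so that the net lies in the set that it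
  covers.\<close>

lemma finite_cover:
  assumes "0 < \<delta>"
  obtains \<Gamma> where "finite \<Gamma>" "\<Gamma> \<subseteq> {g \<in> carrier Sp. op_le g R}"
    "\<And>g. g \<in> carrier Sp \<Longrightarrow> op_le g R \<Longrightarrow> \<exists>\<gamma>\<in>\<Gamma>. op_le (g - \<gamma>) \<delta>"
proof -
  obtain c :: "'k \<Rightarrow> 'k" where c': "finite (c ` {x. absval x \<le> R}) \<and>
    (\<forall>x y. absval x \<le> R \<longrightarrow> absval y \<le> R \<longrightarrow> c x = c y \<longrightarrow> absval (x - y) \<le> \<delta>)"
    using finite_net[OF assms, of R] ..
  then have c: "finite (c ` {x. absval x \<le> R})"
    "\<And>x y. absval x \<le> R \<Longrightarrow> absval y \<le> R \<Longrightarrow> c x = c y \<Longrightarrow> absval (x - y) \<le> \<delta>"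
    by simp_all
  define S where "S = {g \<in> carrier Sp. op_le g R}"
  define \<Phi> where "\<Phi> g = (\<lambda>p\<in>basis \<times> basis. c (B (g *v fst p) (snd p)))" for g :: "'k ^ 4 ^ 4"
  have bound: "absval (B (g *v b) b') \<le> R" if "g \<in> S" "b \<in> basis" "b' \<in> basis" for g b b'
  proof -
    have gR: "op_le g R" using that by (simp add: S_def)
    have "absval (B (g *v b) b') \<le> vnorm (g *v b)" by (rule absval_B_basis[OF that(3)])
    also have "\<dots> \<le> R * vnorm b" by (rule op_leD[OF gR])
    also have "\<dots> \<le> R" by (rule mult_left_le[OF vnorm_basis_le[OF that(2)] op_le_nonneg[OF gR]])
    finally show ?thesis .
  qed
  have "\<Phi> ` S \<subseteq> PiE (basis \<times> basis) (\<lambda>_. c ` {x. absval x \<le> R})"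
  proof (rule image_subsetI)
    fix g assume g: "g \<in> S"
    show "\<Phi> g \<in> PiE (basis \<times> basis) (\<lambda>_. c ` {x. absval x \<le> R})"
      unfolding \<Phi>_def restrict_PiE_iff using bound[OF g] by force
  qed
  then have fin: "finite (\<Phi> ` S)" by (rule finite_subset) (intro finite_PiE finite_cartesian_product finite_basis c(1))
  define \<Gamma> where "\<Gamma> = inv_into S \<Phi> ` (\<Phi> ` S)"
  show ?thesis
  proof (rule that[of \<Gamma>])
    show "finite \<Gamma>" using fin by (simp add: \<Gamma>_def)
    show "\<Gamma> \<subseteq> {g \<in> carrier Sp. op_le g R}"
      unfolding \<Gamma>_def S_def[symmetric] by (auto intro: inv_into_into)
    fix g assume "g \<in> carrier Sp" "op_le g R"
    then have g: "g \<in> S" by (simp add: S_def)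
    define \<gamma> where "\<gamma> = inv_into S \<Phi> (\<Phi> g)"
    have \<gamma>: "\<gamma> \<in> S" "\<Phi> \<gamma> = \<Phi> g" unfolding \<gamma>_def
      by (rule inv_into_into[OF imageI[OF g]], rule f_inv_into_f[OF imageI[OF g]])
    have "op_le (g - \<gamma>) \<delta>"
    proof (rule op_leI)
      fix b assume b: "b \<in> basis"
      show "vnorm ((g - \<gamma>) *v b) \<le> \<delta>" unfolding vnorm_le_iff
      proof
        fix b' assume b': "b' \<in> basis"
        have "\<Phi> \<gamma> (b, b') = \<Phi> g (b, b')" using \<gamma>(2) by simp
        then have "c (B (g *v b) b') = c (B (\<gamma> *v b) b')" using b b' by (simp add: \<Phi>_def)
        then have "absval (B (g *v b) b' - B (\<gamma> *v b) b') \<le> \<delta>"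
          by (rule c(2)[OF bound[OF g b b'] bound[OF \<gamma>(1) b b']])
        then show "absval (B ((g - \<gamma>) *v b) b') \<le> \<delta>" by (simp add: matrix_vector_mult_diff_rdistrib B_simps)
      qed
    qed
    moreover have "\<gamma> \<in> \<Gamma>" using g by (auto simp: \<gamma>_def \<Gamma>_def)
    ultimately show "\<exists>\<gamma>\<in>\<Gamma>. op_le (g - \<gamma>) \<delta>" by blast
  qed
qed

end

section \<open>Modules and smooth representations\<close>

lemma complex_ring_simps [simp]:
  "carrier complex_ring = UNIV" "\<zero>\<^bsub>complex_ring\<^esub> = 0" "\<one>\<^bsub>complex_ring\<^esub> = 1"
  "a \<oplus>\<^bsub>complex_ring\<^esub> b = a + b" "a \<otimes>\<^bsub>complex_ring\<^esub> b = a * b"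
  by (simp_all add: ring_of_type_algebra_def)

lemma cring_complex_ring: "cring complex_ring"
  by (rule cring_from_type_algebra)

locale complex_module = Module.module complex_ring V for V :: "(complex, 'v) module" (structure)
begin

abbreviation sub :: "'v set \<Rightarrow> bool" where "sub W \<equiv> submodule W complex_ring V"

lemma scale_closed [simp]: "v \<in> carrier V \<Longrightarrow> a \<odot> v \<in> carrier V"
  by (rule smult_closed) simp_all

lemma scale_add: "v \<in> carrier V \<Longrightarrow> w \<in> carrier V \<Longrightarrow> a \<odot> (v \<oplus> w) = a \<odot> v \<oplus> a \<odot> w"
  by (rule smult_r_distr) simp_all

lemma scale_add_left: "v \<in> carrier V \<Longrightarrow> (a + b) \<odot> v = a \<odot> v \<oplus> b \<odot> v"
  using smult_l_distr[of a b v] by simp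

lemma scale_scale: "v \<in> carrier V \<Longrightarrow> a \<odot> (b \<odot> v) = (a * b) \<odot> v"
  using smult_assoc1[of a b v] by simp

lemma scale_one [simp]: "v \<in> carrier V \<Longrightarrow> 1 \<odot> v = v"
  using smult_one[of v] by simp

lemma scale_zero [simp]: "v \<in> carrier V \<Longrightarrow> 0 \<odot> v = \<zero>"
  using smult_l_null[of v] by simp

lemma scale_zero_right [simp]: "a \<odot> \<zero> = \<zero>"
  by (rule smult_r_null) simp

lemma minus_eq_scale: "v \<in> carrier V \<Longrightarrow> \<ominus> v = (-1) \<odot> v"
proof -
  assume v: "v \<in> carrier V"
  have "(-1) \<odot> v \<oplus> v = (-1) \<odot> v \<oplus> 1 \<odot> v" using v by simp
  also have "\<dots> = \<zero>" using v by (simp only: scale_add_left[symmetric]) simp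
  finally show ?thesis using v by (intro M.minus_equality) simp_all
qed

lemma scale_diff:
  assumes "v \<in> carrier V" "w \<in> carrier V" shows "a \<odot> (v \<ominus> w) = a \<odot> v \<ominus> a \<odot> w"
  using assms by (simp add: M.minus_eq minus_eq_scale scale_add scale_scale)

lemma scale_diff_left: "v \<in> carrier V \<Longrightarrow> (a - b) \<odot> v = a \<odot> v \<ominus> b \<odot> v"
  using scale_add_left[of v a "- b"] by (simp add: M.minus_eq minus_eq_scale scale_scale)

lemma subI:
  assumes "W \<subseteq> carrier V" "\<zero> \<in> W" "\<And>v w. v \<in> W \<Longrightarrow> w \<in> W \<Longrightarrow> v \<oplus> w \<in> W"
    "\<And>a v. v \<in> W \<Longrightarrow> a \<odot> v \<in> W"
  shows "sub W"
proof (rule submoduleI)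
  show "\<ominus> v \<in> W" if "v \<in> W" for v using that assms(1,4) by (auto simp: minus_eq_scale)
qed (use assms in auto)

lemma subD:
  assumes "sub W"
  shows "W \<subseteq> carrier V" "\<zero> \<in> W" "\<And>v w. v \<in> W \<Longrightarrow> w \<in> W \<Longrightarrow> v \<oplus> w \<in> W"
    "\<And>a v. v \<in> W \<Longrightarrow> a \<odot> v \<in> W" "\<And>v w. v \<in> W \<Longrightarrow> w \<in> W \<Longrightarrow> v \<ominus> w \<in> W"
proof -
  note S = submoduleE[OF assms]
  show 1: "W \<subseteq> carrier V" "\<And>v w. v \<in> W \<Longrightarrow> w \<in> W \<Longrightarrow> v \<oplus> w \<in> W"
    "\<And>a v. v \<in> W \<Longrightarrow> a \<odot> v \<in> W" using S(1) S(5) S(4) by auto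
  show "v \<ominus> w \<in> W" if "v \<in> W" "w \<in> W" for v w unfolding M.minus_eq using that S(3) 1 by auto
  obtain v where v: "v \<in> W" using S(2) by blast
  then have "0 \<odot> v \<in> W" by (rule 1)
  moreover have "v \<in> carrier V" using v 1 by blast
  ultimately show "\<zero> \<in> W" by simp
qed

lemma sub_carrier: "sub (carrier V)"
  by (rule subI) auto

lemma sub_zero: "sub {\<zero>}"
  by (rule subI) auto

lemma diff_add_cancel [simp]:
  assumes "v \<in> carrier V" "w \<in> carrier V" shows "v \<ominus> w \<oplus> w = v"
  using assms by (simp add: M.minus_eq M.a_assoc M.l_neg)

lemma sub_hull:
  assumes "S \<subseteq> carrier V" shows "sub (sub hull S)"
proof (rule subI)
  show "sub hull S \<subseteq> carrier V" using assms by (intro hull_minimal sub_carrier)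
  have eq: "sub hull S = \<Inter>{T. sub T \<and> S \<subseteq> T}" by (simp add: hull_def)
  show "\<zero> \<in> sub hull S" unfolding eq using subD(2) by blast
  show "v \<oplus> w \<in> sub hull S" if "v \<in> sub hull S" "w \<in> sub hull S" for v w
    using that unfolding eq using subD(3) by blast
  show "a \<odot> v \<in> sub hull S" if "v \<in> sub hull S" for a v
    using that unfolding eq using subD(4) by blast
qed

text \<open>A submodule maximal among those that contain \<open>U\<close> and avoid
  \<open>v0\<close> is a complement of the line of \<open>v0\<close>; the functional is the
  coefficient along this line.\<close>

lemma exists_functional:
  assumes U: "sub U" and v0: "v0 \<in> carrier V" "v0 \<notin> U"
  obtains l :: "'v \<Rightarrow> complex" where "l v0 = 1" "\<And>u. u \<in> U \<Longrightarrow> l u = 0"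
    "\<And>v w. v \<in> carrier V \<Longrightarrow> w \<in> carrier V \<Longrightarrow> l (v \<oplus> w) = l v + l w"
    "\<And>a v. v \<in> carrier V \<Longrightarrow> l (a \<odot> v) = a * l v"
proof -
  define A where "A = {M. sub M \<and> U \<subseteq> M \<and> v0 \<notin> M}"
  have "A \<noteq> {}" using U v0 by (auto simp: A_def)
  moreover have "\<Union>C \<in> A" if C: "C \<noteq> {}" "subset.chain A C" for C
  proof -
    have st: "\<And>N. N \<in> C \<Longrightarrow> sub N \<and> U \<subseteq> N \<and> v0 \<notin> N"
      using C(2) unfolding subset.chain_def A_def by blast
    have lin: "\<And>M N. M \<in> C \<Longrightarrow> N \<in> C \<Longrightarrow> M \<subseteq> N \<or> N \<subseteq> M"
      using C(2) unfolding subset_chain_def by blast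
    have "sub (\<Union>C)"
    proof (rule subI)
      show "\<Union>C \<subseteq> carrier V" using st subD(1) by blast
      show "\<zero> \<in> \<Union>C" using C(1) st subD(2) by blast
    next
      fix f h assume "f \<in> \<Union>C" "h \<in> \<Union>C"
      then obtain M N where "M \<in> C" "N \<in> C" "f \<in> M" "h \<in> N" by blast
      then obtain P where "P \<in> C" "f \<in> P" "h \<in> P" using lin[of M N] by blast
      then show "f \<oplus> h \<in> \<Union>C" using st[of P] subD(3)[of P f h] by blast
    next
      fix a f assume "f \<in> \<Union>C"
      then obtain P where "P \<in> C" "f \<in> P" by blast
      then show "a \<odot> f \<in> \<Union>C" using st[of P] subD(4)[of P f a] by blast
    qed
    then show ?thesis using C(1) st unfolding A_def by blast
  qed
  ultimately obtain M where M: "M \<in> A" "\<forall>N\<in>A. M \<subseteq> N \<longrightarrow> N = M"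
    using subset_Zorn_nonempty[of A] by blast
  have sM: "sub M" and UM: "U \<subseteq> M" and v0M: "v0 \<notin> M" using M(1) by (auto simp: A_def)
  note Msub = subD[OF sM]
  have ex: "\<exists>c. v \<ominus> c \<odot> v0 \<in> M" if v: "v \<in> carrier V" for v
  proof (cases "v \<in> M")
    case True
    then have "v \<ominus> 0 \<odot> v0 \<in> M" using v0 Msub(2) Msub(5)[of v \<zero>] by simp
    then show ?thesis ..
  next
    case False
    \<comment> \<open>Adjoining \<open>v\<close> enlarges \<open>M\<close>, so by maximality
      \<open>v0\<close> is captured; solving its expression for \<open>v\<close> gives the
      coefficient.\<close>
    define N where "N = {m \<oplus> c \<odot> v | m c. m \<in> M}"
    have "sub N"
    proof (rule subI)
      show "N \<subseteq> carrier V" using Msub(1) v by (auto simp: N_def)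
      have "\<zero> \<oplus> 0 \<odot> v \<in> N" unfolding N_def using Msub(2) by blast
      then show "\<zero> \<in> N" using v by simp
    next
      fix x y assume "x \<in> N" "y \<in> N"
      then obtain m c m' c' where *: "m \<in> M" "m' \<in> M" "x = m \<oplus> c \<odot> v" "y = m' \<oplus> c' \<odot> v"
        unfolding N_def by blast
      then have "x \<oplus> y = (m \<oplus> m') \<oplus> (c + c') \<odot> v"
        using v Msub(1) by (simp add: scale_add_left M.a_ac subset_iff)
      moreover have "m \<oplus> m' \<in> M" using * Msub(3) by blast
      ultimately show "x \<oplus> y \<in> N" unfolding N_def by blast
    next
      fix a x assume "x \<in> N"
      then obtain m c where *: "m \<in> M" "x = m \<oplus> c \<odot> v" unfolding N_def by blast
      then have "a \<odot> x = a \<odot> m \<oplus> (a * c) \<odot> v"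
        using v Msub(1) by (simp add: scale_add scale_scale subset_iff)
      then show "a \<odot> x \<in> N" unfolding N_def using * Msub(4) by blast
    qed
    moreover have "M \<subseteq> N"
    proof
      fix m assume m: "m \<in> M"
      then have "m \<oplus> 0 \<odot> v \<in> N" unfolding N_def by blast
      then show "m \<in> N" using m Msub(1) v by (simp add: subset_iff)
    qed
    moreover have "v \<in> N"
    proof -
      have "\<zero> \<oplus> 1 \<odot> v \<in> N" unfolding N_def using Msub(2) by blast
      then show ?thesis using v by simp
    qed
    ultimately have "v0 \<in> N" using M UM False unfolding A_def by blast
    then obtain m c where mc: "m \<in> M" "v0 = m \<oplus> c \<odot> v" unfolding N_def by blast
    have mV: "m \<in> carrier V" using mc Msub(1) by blast
    have c0: "c \<noteq> 0"
    proof
      assume "c = 0"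
      then have "v0 = m" using mc mV v by simp
      then show False using mc v0M by blast
    qed
    have "inverse c \<odot> v0 = inverse c \<odot> m \<oplus> v"
      using mc mV v c0 by (simp add: scale_add scale_scale)
    then have "v \<ominus> inverse c \<odot> v0 = \<ominus> (inverse c \<odot> m)"
      using mV v by (simp add: M.minus_eq M.minus_add M.a_ac M.r_neg1 M.r_neg2)
    also have "\<dots> = (-1) \<odot> (inverse c \<odot> m)" using mV by (simp add: minus_eq_scale)
    also have "\<dots> \<in> M" using mc(1) Msub(4) by blast
    finally show ?thesis by blast
  qed
  have uniq: "c = c'" if "v \<in> carrier V" "v \<ominus> c \<odot> v0 \<in> M" "v \<ominus> c' \<odot> v0 \<in> M" for v c c'
  proof (rule ccontr)
    assume "c \<noteq> c'"
    have "(v \<ominus> c \<odot> v0) \<ominus> (v \<ominus> c' \<odot> v0) \<in> M" by (rule Msub(5)[OF that(2,3)])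
    also have "(v \<ominus> c \<odot> v0) \<ominus> (v \<ominus> c' \<odot> v0) = (c' - c) \<odot> v0"
      using that(1) v0 by (simp add: scale_diff_left M.minus_eq M.minus_add M.a_ac M.r_neg1 M.r_neg2)
    finally have "inverse (c' - c) \<odot> ((c' - c) \<odot> v0) \<in> M" by (rule Msub(4))
    then show False using v0 v0M \<open>c \<noteq> c'\<close> by (simp add: scale_scale)
  qed
  define l where "l v = (THE c. v \<ominus> c \<odot> v0 \<in> M)" for v
  have l: "v \<ominus> l v \<odot> v0 \<in> M" if v: "v \<in> carrier V" for v
    unfolding l_def by (rule theI', rule ex_ex1I[OF ex[OF v]], rule uniq[OF v])
  have l_eq: "l v = c" if "v \<in> carrier V" "v \<ominus> c \<odot> v0 \<in> M" for v c
    using uniq[OF that(1) l[OF that(1)] that(2)] .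
  show ?thesis
  proof (rule that[of l])
    show "l v0 = 1" using v0 Msub(2) by (intro l_eq) (simp_all add: M.minus_eq M.r_neg)
    show "l u = 0" if "u \<in> U" for u
    proof (rule l_eq)
      have u: "u \<in> M" using that UM by blast
      then show "u \<in> carrier V" using Msub(1) by blast
      show "u \<ominus> 0 \<odot> v0 \<in> M" using v0 Msub(2) Msub(5)[OF u, of \<zero>] by simp
    qed
    show "l (v \<oplus> w) = l v + l w" if "v \<in> carrier V" "w \<in> carrier V" for v w
    proof (rule l_eq)
      have "(v \<ominus> l v \<odot> v0) \<oplus> (w \<ominus> l w \<odot> v0) \<in> M" by (intro Msub(3) l that)
      also have "(v \<ominus> l v \<odot> v0) \<oplus> (w \<ominus> l w \<odot> v0) = v \<oplus> w \<ominus> (l v + l w) \<odot> v0"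
        using that v0 by (simp add: scale_add_left M.minus_eq M.minus_add M.a_ac)
      finally show "v \<oplus> w \<ominus> (l v + l w) \<odot> v0 \<in> M" .
    qed (use that in simp)
    show "l (a \<odot> v) = a * l v" if "v \<in> carrier V" for a v
    proof (rule l_eq)
      have "a \<odot> (v \<ominus> l v \<odot> v0) \<in> M" by (intro Msub(4) l that)
      then show "a \<odot> v \<ominus> (a * l v) \<odot> v0 \<in> M" using that v0 by (simp add: scale_diff scale_scale)
    qed (use that in simp)
  qed
qed

end

lemma (in smooth_rep) complex_module: "complex_module V"
  by (intro complex_module.intro V.module_axioms)

sublocale smooth_rep \<subseteq> cm: complex_module V by (rule complex_module)

context smooth_rep begin

lemma rep_zero [simp]: "g \<in> carrier G \<Longrightarrow> \<rho> g \<zero>\<^bsub>V\<^esub> = \<zero>\<^bsub>V\<^esub>"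
  using rep_smult[of g "\<zero>\<^bsub>V\<^esub>" 0] rep_closed[of g "\<zero>\<^bsub>V\<^esub>"] by simp

lemma rep_diff:
  assumes "g \<in> carrier G" "v \<in> carrier V" "w \<in> carrier V"
  shows "\<rho> g (v \<ominus>\<^bsub>V\<^esub> w) = \<rho> g v \<ominus>\<^bsub>V\<^esub> \<rho> g w"
  using assms rep_closed by (simp add: V.M.minus_eq cm.minus_eq_scale rep_add rep_smult)

lemma rep_inv [simp]:
  assumes "g \<in> carrier G" "v \<in> carrier V"
  shows "\<rho> (inv\<^bsub>G\<^esub> g) (\<rho> g v) = v" "\<rho> g (\<rho> (inv\<^bsub>G\<^esub> g) v) = v"
  using assms rep_mult[of "inv\<^bsub>G\<^esub> g" g v] rep_mult[of g "inv\<^bsub>G\<^esub> g" v] by (simp_all add: rep_one)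

lemma twisted_span_sub:
  assumes "N \<subseteq> carrier G" shows "cm.sub (twisted_span V \<rho> N \<psi>)"
  unfolding twisted_span_def using assms rep_closed by (intro cm.sub_hull) auto

lemma twisted_span_gen:
  "n \<in> N \<Longrightarrow> v \<in> carrier V \<Longrightarrow> \<rho> n v \<ominus>\<^bsub>V\<^esub> \<psi> n \<odot>\<^bsub>V\<^esub> v \<in> twisted_span V \<rho> N \<psi>"
  unfolding twisted_span_def by (rule hull_inc) blast

lemma twisted_span_least:
  assumes "cm.sub W" "\<And>n v. n \<in> N \<Longrightarrow> v \<in> carrier V \<Longrightarrow> \<rho> n v \<ominus>\<^bsub>V\<^esub> \<psi> n \<odot>\<^bsub>V\<^esub> v \<in> W"
  shows "twisted_span V \<rho> N \<psi> \<subseteq> W"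
  unfolding twisted_span_def using assms by (intro hull_minimal) blast+

lemma sub_vimage_rep:
  assumes g: "g \<in> carrier G" and W: "cm.sub W" shows "cm.sub {v \<in> carrier V. \<rho> g v \<in> W}"
  using g cm.subD[OF W] by (intro cm.subI) (auto simp: rep_add rep_smult)

text \<open>Since g n = (g n g^-1) g, an element that normalizes \<open>N\<close> and preserves
  \<open>\<psi>\<close> carries generators to generators.\<close>

lemma twisted_span_stable:
  assumes N: "N \<subseteq> carrier G" and g: "g \<in> carrier G"
    and conj: "\<And>n. n \<in> N \<Longrightarrow> g \<otimes>\<^bsub>G\<^esub> n \<otimes>\<^bsub>G\<^esub> inv\<^bsub>G\<^esub> g \<in> N \<and> \<psi> (g \<otimes>\<^bsub>G\<^esub> n \<otimes>\<^bsub>G\<^esub> inv\<^bsub>G\<^esub> g) = \<psi> n"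
    and w: "w \<in> twisted_span V \<rho> N \<psi>"
  shows "\<rho> g w \<in> twisted_span V \<rho> N \<psi>"
proof -
  let ?T = "twisted_span V \<rho> N \<psi>"
  have "?T \<subseteq> {v \<in> carrier V. \<rho> g v \<in> ?T}"
  proof (rule twisted_span_least[OF sub_vimage_rep[OF g twisted_span_sub[OF N]]])
    fix n v assume n: "n \<in> N" and v: "v \<in> carrier V"
    have nG: "n \<in> carrier G" using n N by blast
    let ?m = "g \<otimes>\<^bsub>G\<^esub> n \<otimes>\<^bsub>G\<^esub> inv\<^bsub>G\<^esub> g"
    have m: "?m \<in> N" "\<psi> ?m = \<psi> n" using conj[OF n] by auto
    have "\<rho> ?m (\<rho> g v) = \<rho> g (\<rho> n v)"
      using g nG v rep_closed by (simp add: rep_mult)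
    then have "\<rho> g (\<rho> n v \<ominus>\<^bsub>V\<^esub> \<psi> n \<odot>\<^bsub>V\<^esub> v) = \<rho> ?m (\<rho> g v) \<ominus>\<^bsub>V\<^esub> \<psi> ?m \<odot>\<^bsub>V\<^esub> \<rho> g v"
      using g nG v m rep_closed by (simp add: rep_diff rep_smult)
    also have "\<dots> \<in> ?T" using m g v rep_closed by (intro twisted_span_gen) auto
    finally show "\<rho> n v \<ominus>\<^bsub>V\<^esub> \<psi> n \<odot>\<^bsub>V\<^esub> v \<in> {v \<in> carrier V. \<rho> g v \<in> ?T}"
      using g nG v rep_closed by simp
  qed
  then show ?thesis using w by blast
qed

end

section \<open>Quotients of representations\<close>

context complex_module begin

definition coset :: "'v set \<Rightarrow> 'v \<Rightarrow> 'v set" where "coset W v = W +> v"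

context fixes W assumes W: "sub W" begin

lemma W_carrier: "W \<subseteq> carrier V" by (rule subD(1)[OF W])

lemma mem_coset:
  assumes v: "v \<in> carrier V" shows "x \<in> coset W v \<longleftrightarrow> x \<in> carrier V \<and> x \<ominus> v \<in> W"
proof
  assume "x \<in> coset W v"
  then obtain w where w: "w \<in> W" "x = w \<oplus> v" by (auto simp: coset_def a_r_coset_def')
  then have "w \<in> carrier V" using W_carrier by blast
  then show "x \<in> carrier V \<and> x \<ominus> v \<in> W" using w v by (simp add: M.minus_eq M.a_assoc M.r_neg)
next
  assume x: "x \<in> carrier V \<and> x \<ominus> v \<in> W"
  then have "x = (x \<ominus> v) \<oplus> v" using v by simp
  then show "x \<in> coset W v" using x unfolding coset_def a_r_coset_def' by blast
qed

lemma diff_swap: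
  assumes "v \<in> carrier V" "w \<in> carrier V" "v \<ominus> w \<in> W" shows "w \<ominus> v \<in> W"
proof -
  have "(-1) \<odot> (v \<ominus> w) = w \<ominus> v"
    using assms(1,2) by (simp add: scale_diff minus_eq_scale[symmetric] M.minus_eq M.minus_add M.minus_minus M.a_comm)
  then show ?thesis using subD(4)[OF W assms(3), of "-1"] by simp
qed

lemma diff_trans:
  assumes "x \<in> carrier V" "v \<in> carrier V" "w \<in> carrier V" "x \<ominus> v \<in> W" "v \<ominus> w \<in> W"
  shows "x \<ominus> w \<in> W"
  using subD(3)[OF W assms(4,5)] assms(1-3) by (simp add: M.minus_eq M.a_assoc M.r_neg1)

lemma coset_eq_iff:
  assumes v: "v \<in> carrier V" and w: "w \<in> carrier V" shows "coset W v = coset W w \<longleftrightarrow> v \<ominus> w \<in> W"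
proof
  assume "coset W v = coset W w"
  moreover have "v \<in> coset W v" using v subD(2)[OF W] by (simp add: mem_coset M.minus_eq M.r_neg)
  ultimately show "v \<ominus> w \<in> W" using w by (simp add: mem_coset)
next
  assume d: "v \<ominus> w \<in> W"
  have "x \<ominus> v \<in> W \<longleftrightarrow> x \<ominus> w \<in> W" if x: "x \<in> carrier V" for x
    using diff_trans[OF x v w _ d] diff_trans[OF x w v _ diff_swap[OF v w d]] by blast
  then show "coset W v = coset W w" unfolding set_eq_iff mem_coset[OF v] mem_coset[OF w] by blast
qed

lemma diff_zero [simp]: "v \<in> carrier V \<Longrightarrow> v \<ominus> \<zero> = v"
  by (simp add: M.minus_eq minus_eq_scale)

lemma coset_zero: "coset W \<zero> = W"
proof -
  show ?thesis using W_carrier by (auto simp: mem_coset)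
qed

lemma coset_eq_W: "v \<in> carrier V \<Longrightarrow> coset W v = W \<longleftrightarrow> v \<in> W"
  using coset_eq_iff[of v \<zero>] coset_zero by simp

lemma quot_carrier: "carrier (quot_module V W) = coset W ` carrier V"
  by (auto simp: quot_module_def A_RCOSETS_def' coset_def)

lemma quot_zero: "\<zero>\<^bsub>quot_module V W\<^esub> = W"
  by (simp add: quot_module_def)

lemma quot_add:
  assumes v: "v \<in> carrier V" and w: "w \<in> carrier V"
  shows "coset W v \<oplus>\<^bsub>quot_module V W\<^esub> coset W w = coset W (v \<oplus> w)"
proof -
  have "x \<in> set_add V (coset W v) (coset W w) \<longleftrightarrow> x \<in> coset W (v \<oplus> w)" for x
  proof
    assume "x \<in> set_add V (coset W v) (coset W w)"
    then obtain y z where yz: "y \<in> coset W v" "z \<in> coset W w" "x = y \<oplus> z" by (auto simp: set_add_def')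
    then have "y \<in> carrier V" "z \<in> carrier V" "(y \<ominus> v) \<oplus> (z \<ominus> w) \<in> W"
      using v w subD(3)[OF W] by (auto simp: mem_coset)
    then show "x \<in> coset W (v \<oplus> w)"
      using yz(3) v w by (simp add: mem_coset M.minus_eq M.minus_add M.a_ac)
  next
    assume x: "x \<in> coset W (v \<oplus> w)"
    then have xV: "x \<in> carrier V" and d: "x \<ominus> (v \<oplus> w) \<in> W" using v w by (simp_all add: mem_coset)
    have "x \<ominus> w \<ominus> v = x \<ominus> (v \<oplus> w)" using xV v w by (simp add: M.minus_eq M.minus_add M.a_ac)
    then have "x \<ominus> w \<in> coset W v" using xV v w d by (simp add: mem_coset)
    moreover have "w \<in> coset W w" using w subD(2)[OF W] by (simp add: mem_coset M.minus_eq M.r_neg)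
    moreover have "x = (x \<ominus> w) \<oplus> w" using xV w by simp
    ultimately show "x \<in> set_add V (coset W v) (coset W w)" unfolding set_add_def' by blast
  qed
  then show ?thesis by (auto simp: quot_module_def)
qed

lemma quot_scale:
  assumes v: "v \<in> carrier V"
  shows "a \<odot>\<^bsub>quot_module V W\<^esub> coset W v = coset W (a \<odot> v)"
proof -
  have "coset W (a \<odot> x) = coset W (a \<odot> v)" if x: "x \<in> coset W v" for x
  proof -
    have "x \<in> carrier V" "a \<odot> (x \<ominus> v) \<in> W" using x v subD(4)[OF W] by (simp_all add: mem_coset)
    then show ?thesis using v by (simp add: coset_eq_iff scale_diff)
  qed
  moreover have "v \<in> coset W v" using v subD(2)[OF W] by (simp add: mem_coset M.minus_eq M.r_neg)
  ultimately have "(\<Union>x\<in>coset W v. coset W (a \<odot> x)) = coset W (a \<odot> v)" by blast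
  then show ?thesis by (simp add: quot_module_def coset_def)
qed

lemma quot_complex_module: "complex_module (quot_module V W)"
proof (intro complex_module.intro moduleI abelian_groupI)
  note q = quot_carrier quot_zero quot_add quot_scale
  show "cring complex_ring" by (rule cring_complex_ring)
  show "\<exists>y\<in>carrier (quot_module V W). y \<oplus>\<^bsub>quot_module V W\<^esub> x = \<zero>\<^bsub>quot_module V W\<^esub>"
    if x: "x \<in> carrier (quot_module V W)" for x
  proof -
    obtain v where v: "v \<in> carrier V" "x = coset W v" using x by (auto simp: q)
    then have "coset W (\<ominus> v) \<oplus>\<^bsub>quot_module V W\<^esub> x = coset W \<zero>" by (simp add: q M.l_neg)
    then show ?thesis using v(1) by (intro bexI[of _ "coset W (\<ominus> v)"]) (simp_all add: q coset_zero)
  qed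
  have z: "\<zero>\<^bsub>quot_module V W\<^esub> = coset W \<zero>" by (simp add: q coset_zero)
  show "\<zero>\<^bsub>quot_module V W\<^esub> \<in> carrier (quot_module V W)" unfolding z q(1) by blast
  show "\<zero>\<^bsub>quot_module V W\<^esub> \<oplus>\<^bsub>quot_module V W\<^esub> x = x" if x: "x \<in> carrier (quot_module V W)" for x
    using x unfolding z q(1) by (auto simp: q(3))
qed (auto simp: quot_carrier quot_add quot_scale M.a_ac scale_add scale_add_left scale_scale)

end
end

context smooth_rep begin

lemma subrepD:
  assumes "subrep G V \<rho> W"
  shows "cm.sub W" "\<And>g w. g \<in> carrier G \<Longrightarrow> w \<in> W \<Longrightarrow> \<rho> g w \<in> W"
  using assms by (auto simp: subrep_def)

context fixes W assumes W: "subrep G V \<rho> W" begin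

abbreviation Q where "Q \<equiv> quot_module V W"

lemma sW: "cm.sub W" by (rule subrepD(1)[OF W])

lemma quot_act_coset:
  assumes g: "g \<in> carrier G" and v: "v \<in> carrier V"
  shows "quot_act \<rho> g (cm.coset W v) = cm.coset W (\<rho> g v)"
proof
  note mc = cm.mem_coset[OF sW]
  show "quot_act \<rho> g (cm.coset W v) \<subseteq> cm.coset W (\<rho> g v)"
  proof
    fix y assume "y \<in> quot_act \<rho> g (cm.coset W v)"
    then obtain x where x: "x \<in> carrier V" "x \<ominus>\<^bsub>V\<^esub> v \<in> W" "y = \<rho> g x"
      using v by (auto simp: quot_act_def mc)
    then have "\<rho> g (x \<ominus>\<^bsub>V\<^esub> v) \<in> W" using subrepD(2)[OF W g] by blast
    then show "y \<in> cm.coset W (\<rho> g v)" using x g v rep_closed by (simp add: mc rep_diff)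
  qed
  show "cm.coset W (\<rho> g v) \<subseteq> quot_act \<rho> g (cm.coset W v)"
  proof
    fix y assume "y \<in> cm.coset W (\<rho> g v)"
    then have y: "y \<in> carrier V" "y \<ominus>\<^bsub>V\<^esub> \<rho> g v \<in> W" using g v rep_closed by (simp_all add: mc)
    let ?i = "inv\<^bsub>G\<^esub> g"
    have i: "?i \<in> carrier G" using g by simp
    have "\<rho> ?i (y \<ominus>\<^bsub>V\<^esub> \<rho> g v) \<in> W" by (rule subrepD(2)[OF W i y(2)])
    then have "\<rho> ?i y \<in> cm.coset W v" using y(1) g i v rep_closed by (simp add: mc rep_diff)
    moreover have "y = \<rho> g (\<rho> ?i y)" using g y(1) by simp
    ultimately show "y \<in> quot_act \<rho> g (cm.coset W v)" unfolding quot_act_def by blast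
  qed
qed

text \<open>A coset stabilizer contains the stabilizer of a representative. To conclude that it is
  open one has to translate neighbourhoods, and \<open>smooth_rep\<close> does not relate the
  topology to the multiplication; so openness is a hypothesis here.\<close>

lemma smooth_rep_quot:
  assumes "\<And>v. v \<in> carrier V \<Longrightarrow>
    openin (top_of_set (carrier G)) {g \<in> carrier G. cm.coset W (\<rho> g v) = cm.coset W v}"
  shows "smooth_rep G Q (quot_act \<rho>)"
proof (intro smooth_rep.intro smooth_rep_axioms.intro)
  show "group G" by (rule G.group_axioms)
  show "Module.module complex_ring Q"
    using cm.quot_complex_module[OF sW] by (rule complex_module.axioms)
  have Q_cosets: "\<exists>x\<in>carrier V. v = cm.coset W x" if "v \<in> carrier Q" for v
    using that unfolding cm.quot_carrier[OF sW] by blast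
  have coset_Q: "cm.coset W x \<in> carrier Q" if "x \<in> carrier V" for x
    using that unfolding cm.quot_carrier[OF sW] by blast
  fix g v assume g: "g \<in> carrier G" and "v \<in> carrier Q"
  then obtain x where x: "x \<in> carrier V" "v = cm.coset W x" using Q_cosets by blast
  have gx: "\<rho> g x \<in> carrier V" by (rule rep_closed[OF g x(1)])
  show "quot_act \<rho> g v \<in> carrier Q"
    unfolding x(2) quot_act_coset[OF g x(1)] by (rule coset_Q[OF gx])
  show "quot_act \<rho> g (a \<odot>\<^bsub>Q\<^esub> v) = a \<odot>\<^bsub>Q\<^esub> quot_act \<rho> g v" for a
    unfolding x(2) cm.quot_scale[OF sW x(1)] quot_act_coset[OF g x(1)] cm.quot_scale[OF sW gx]
      quot_act_coset[OF g cm.scale_closed[OF x(1)]] rep_smult[OF g x(1)] ..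
  show "quot_act \<rho> g (v \<oplus>\<^bsub>Q\<^esub> w) = quot_act \<rho> g v \<oplus>\<^bsub>Q\<^esub> quot_act \<rho> g w" if w: "w \<in> carrier Q" for w
  proof -
    obtain y where y: "y \<in> carrier V" "w = cm.coset W y" using Q_cosets[OF w] by blast
    show ?thesis
      unfolding x(2) y(2) cm.quot_add[OF sW x(1) y(1)] quot_act_coset[OF g x(1)] quot_act_coset[OF g y(1)]
        cm.quot_add[OF sW gx rep_closed[OF g y(1)]] quot_act_coset[OF g V.M.a_closed[OF x(1) y(1)]]
        rep_add[OF g x(1) y(1)] ..
  qed
  show "quot_act \<rho> (g \<otimes>\<^bsub>G\<^esub> h) v = quot_act \<rho> g (quot_act \<rho> h v)" if h: "h \<in> carrier G" for h
    unfolding x(2) quot_act_coset[OF G.m_closed[OF g h] x(1)] quot_act_coset[OF h x(1)]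
      quot_act_coset[OF g rep_closed[OF h x(1)]] rep_mult[OF g h x(1)] ..
next
  fix v assume "v \<in> carrier Q"
  then obtain x where x: "x \<in> carrier V" "v = cm.coset W x"
    unfolding cm.quot_carrier[OF sW] by blast
  show "quot_act \<rho> \<one>\<^bsub>G\<^esub> v = v"
    unfolding x(2) quot_act_coset[OF G.one_closed x(1)] rep_one[OF x(1)] ..
  have "{g \<in> carrier G. quot_act \<rho> g v = v} = {g \<in> carrier G. cm.coset W (\<rho> g x) = cm.coset W x}"
    unfolding x(2) using quot_act_coset[OF _ x(1)] by (intro Collect_cong conj_cong refl) simp
  then show "openin (top_of_set (carrier G)) {g \<in> carrier G. quot_act \<rho> g v = v}"
    using assms[OF x(1)] by (simp only:)
qed

section \<open>Subrepresentations of a quotient, and irreducibility\<close>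

lemma subrep_vimage:
  assumes Y: "subrep G Q (quot_act \<rho>) Y"
  shows "subrep G V \<rho> {v \<in> carrier V. cm.coset W v \<in> Y}" "W \<subseteq> {v \<in> carrier V. cm.coset W v \<in> Y}"
    "Y = cm.coset W ` {v \<in> carrier V. cm.coset W v \<in> Y}"
proof -
  interpret q: complex_module Q by (rule cm.quot_complex_module[OF sW])
  have Y': "q.sub Y" "\<And>g y. g \<in> carrier G \<Longrightarrow> y \<in> Y \<Longrightarrow> quot_act \<rho> g y \<in> Y"
    using Y by (auto simp: subrep_def)
  have WY: "W \<in> Y" using q.subD(2)[OF Y'(1)] by (simp add: cm.quot_zero[OF sW])
  show "subrep G V \<rho> {v \<in> carrier V. cm.coset W v \<in> Y}"
    unfolding subrep_def
  proof (intro conjI ballI cm.subI)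
    fix v w assume "v \<in> {v \<in> carrier V. cm.coset W v \<in> Y}" "w \<in> {v \<in> carrier V. cm.coset W v \<in> Y}"
    then show "v \<oplus>\<^bsub>V\<^esub> w \<in> {v \<in> carrier V. cm.coset W v \<in> Y}"
      using q.subD(3)[OF Y'(1), of "cm.coset W v" "cm.coset W w"] by (simp add: cm.quot_add[OF sW])
  next
    fix a v assume "v \<in> {v \<in> carrier V. cm.coset W v \<in> Y}"
    then show "a \<odot>\<^bsub>V\<^esub> v \<in> {v \<in> carrier V. cm.coset W v \<in> Y}"
      using q.subD(4)[OF Y'(1), of "cm.coset W v" a] by (simp add: cm.quot_scale[OF sW])
  next
    fix g v assume "g \<in> carrier G" "v \<in> {v \<in> carrier V. cm.coset W v \<in> Y}"
    then show "\<rho> g v \<in> {v \<in> carrier V. cm.coset W v \<in> Y}"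
      using Y'(2)[of g "cm.coset W v"] rep_closed by (simp add: quot_act_coset)
  qed (use WY in \<open>auto simp: cm.coset_zero[OF sW]\<close>)
  show "W \<subseteq> {v \<in> carrier V. cm.coset W v \<in> Y}"
  proof
    fix w assume w: "w \<in> W"
    then have wV: "w \<in> carrier V" using cm.subD(1)[OF sW] by blast
    then have "cm.coset W w = W" using w by (simp add: cm.coset_eq_W[OF sW])
    then show "w \<in> {v \<in> carrier V. cm.coset W v \<in> Y}" using wV WY by simp
  qed
  show "Y = cm.coset W ` {v \<in> carrier V. cm.coset W v \<in> Y}"
    using q.subD(1)[OF Y'(1)] by (auto simp: cm.quot_carrier[OF sW])
qed

lemma subrep_image:
  assumes U: "subrep G V \<rho> U" and WU: "W \<subseteq> U"
  shows "subrep G Q (quot_act \<rho>) (cm.coset W ` U)"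
    "v \<in> carrier V \<Longrightarrow> cm.coset W v \<in> cm.coset W ` U \<longleftrightarrow> v \<in> U"
proof -
  interpret q: complex_module Q by (rule cm.quot_complex_module[OF sW])
  note U' = cm.subD[OF subrepD(1)[OF U]] and Us = subrepD(2)[OF U]
  have UV: "\<And>u. u \<in> U \<Longrightarrow> u \<in> carrier V" using U'(1) by blast
  show "subrep G Q (quot_act \<rho>) (cm.coset W ` U)"
    unfolding subrep_def
  proof (intro conjI ballI q.subI)
    show "cm.coset W ` U \<subseteq> carrier Q" using U'(1) by (auto simp: cm.quot_carrier[OF sW])
    have "cm.coset W \<zero>\<^bsub>V\<^esub> \<in> cm.coset W ` U" using U'(2) by blast
    then show "\<zero>\<^bsub>Q\<^esub> \<in> cm.coset W ` U" by (simp add: cm.quot_zero[OF sW] cm.coset_zero[OF sW])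
  next
    fix x y assume "x \<in> cm.coset W ` U" "y \<in> cm.coset W ` U"
    then obtain v w where "v \<in> U" "w \<in> U" "x = cm.coset W v" "y = cm.coset W w" by blast
    then show "x \<oplus>\<^bsub>Q\<^esub> y \<in> cm.coset W ` U" using U'(3) UV by (simp add: cm.quot_add[OF sW])
  next
    fix a x assume "x \<in> cm.coset W ` U"
    then obtain v where "v \<in> U" "x = cm.coset W v" by blast
    then show "a \<odot>\<^bsub>Q\<^esub> x \<in> cm.coset W ` U" using U'(4) UV by (simp add: cm.quot_scale[OF sW])
  next
    fix g x assume "g \<in> carrier G" "x \<in> cm.coset W ` U"
    moreover from this obtain v where "v \<in> U" "x = cm.coset W v" by blast
    ultimately show "quot_act \<rho> g x \<in> cm.coset W ` U" using Us UV by (simp add: quot_act_coset)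
  qed
  show "cm.coset W v \<in> cm.coset W ` U \<longleftrightarrow> v \<in> U" if v: "v \<in> carrier V"
  proof
    assume "cm.coset W v \<in> cm.coset W ` U"
    then obtain u where u: "u \<in> U" "cm.coset W v = cm.coset W u" by blast
    then have "v \<ominus>\<^bsub>V\<^esub> u \<in> U" using v UV WU by (auto simp: cm.coset_eq_iff[OF sW])
    then have "v \<ominus>\<^bsub>V\<^esub> u \<oplus>\<^bsub>V\<^esub> u \<in> U" using u(1) by (rule U'(3))
    then show "v \<in> U" using v UV[OF u(1)] by simp
  qed blast
qed

lemma irreducible_quot:
  assumes smooth: "smooth_rep G Q (quot_act \<rho>)" and proper: "W \<noteq> carrier V"
    and max: "\<And>U. subrep G V \<rho> U \<Longrightarrow> W \<subseteq> U \<Longrightarrow> U = W \<or> U = carrier V"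
  shows "irreducible_rep G Q (quot_act \<rho>)"
  unfolding irreducible_rep_def
proof (intro conjI allI impI)
  show "carrier Q \<noteq> {\<zero>\<^bsub>Q\<^esub>}"
  proof
    assume *: "carrier Q = {\<zero>\<^bsub>Q\<^esub>}"
    have "v \<in> W" if v: "v \<in> carrier V" for v
    proof -
      have "cm.coset W v \<in> carrier Q" using v by (simp add: cm.quot_carrier[OF sW])
      then have "cm.coset W v = W" unfolding * by (simp add: cm.quot_zero[OF sW])
      then show ?thesis using v by (simp add: cm.coset_eq_W[OF sW])
    qed
    then show False using proper cm.subD(1)[OF sW] by blast
  qed
  fix Y assume Y: "subrep G Q (quot_act \<rho>) Y"
  note Y' = subrep_vimage[OF Y]
  from max[OF Y'(1,2)] show "Y = {\<zero>\<^bsub>Q\<^esub>} \<or> Y = carrier Q"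
  proof
    assume 1: "{v \<in> carrier V. cm.coset W v \<in> Y} = W"
    have "cm.coset W w = W" if "w \<in> W" for w
      using that cm.subD(1)[OF sW] by (subst cm.coset_eq_W[OF sW]) auto
    then have "cm.coset W ` W = {W}" using cm.subD(2)[OF sW] by blast
    then show ?thesis using Y'(3) unfolding 1 by (simp add: cm.quot_zero[OF sW])
  next
    assume 2: "{v \<in> carrier V. cm.coset W v \<in> Y} = carrier V"
    then show ?thesis using Y'(3) unfolding 2 by (simp add: cm.quot_carrier[OF sW])
  qed
qed (rule smooth)

end

text \<open>Applied with \<open>f\<close> the map to a quotient and the map to a quotient of a
  quotient.\<close>

lemma subgroup_stabilizer:
  assumes v: "v \<in> carrier V" and f: "\<And>g x y. g \<in> carrier G \<Longrightarrow> x \<in> carrier V \<Longrightarrow> y \<in> carrier V \<Longrightarrow>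
      f x = f y \<Longrightarrow> f (\<rho> g x) = f (\<rho> g y)"
  shows "subgroup {g \<in> carrier G. f (\<rho> g v) = f v} G"
proof (rule subgroup.intro)
  show "\<one>\<^bsub>G\<^esub> \<in> {g \<in> carrier G. f (\<rho> g v) = f v}" using v by (simp add: rep_one)
next
  fix g h assume "g \<in> {g \<in> carrier G. f (\<rho> g v) = f v}" "h \<in> {g \<in> carrier G. f (\<rho> g v) = f v}"
  then show "g \<otimes>\<^bsub>G\<^esub> h \<in> {g \<in> carrier G. f (\<rho> g v) = f v}"
    using v rep_closed f[of g "\<rho> h v" v] by (simp add: rep_mult)
next
  fix g assume "g \<in> {g \<in> carrier G. f (\<rho> g v) = f v}"
  then show "inv\<^bsub>G\<^esub> g \<in> {g \<in> carrier G. f (\<rho> g v) = f v}"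
    using v rep_closed f[of "inv\<^bsub>G\<^esub> g" "\<rho> g v" v] by simp
qed auto

text \<open>The subrepresentations of (V/T)/(U/T) come from those between \<open>U\<close> and
  \<open>V\<close>. Both quotients are smooth by \<open>op\<close>, because a coset stabilizer is a
  subgroup containing the stabilizer of a vector.\<close>

lemma has_irreducible_quotient_quot:
  assumes T: "subrep G V \<rho> T" and U: "subrep G V \<rho> U" "T \<subseteq> U" "U \<noteq> carrier V"
    and max: "\<And>U'. subrep G V \<rho> U' \<Longrightarrow> U \<subseteq> U' \<Longrightarrow> U' = U \<or> U' = carrier V"
    and op: "\<And>S. subgroup S G \<Longrightarrow> (\<exists>v\<in>carrier V. {g \<in> carrier G. \<rho> g v = v} \<subseteq> S) \<Longrightarrow>
      openin (top_of_set (carrier G)) S"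
  shows "has_irreducible_quotient G (quot_module V T) (quot_act \<rho>)"
proof -
  let ?Q = "quot_module V T"
  have sT: "cm.sub T" by (rule sW[OF T])
  have f1: "cm.coset T (\<rho> g x) = cm.coset T (\<rho> g y)"
    if "g \<in> carrier G" "x \<in> carrier V" "y \<in> carrier V" "cm.coset T x = cm.coset T y" for g x y
    using quot_act_coset[OF T that(1,2)] quot_act_coset[OF T that(1,3)] that(4) by simp
  have "smooth_rep G ?Q (quot_act \<rho>)"
  proof (rule smooth_rep_quot[OF T])
    fix v assume v: "v \<in> carrier V"
    show "openin (top_of_set (carrier G)) {g \<in> carrier G. cm.coset T (\<rho> g v) = cm.coset T v}"
      by (rule op[OF subgroup_stabilizer[where f = "cm.coset T", OF v f1]]) (use v in \<open>auto intro!: bexI[of _ v]\<close>)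
  qed
  then interpret q: smooth_rep G ?Q "quot_act \<rho>" .
  define W where "W = cm.coset T ` U"
  have W: "subrep G ?Q (quot_act \<rho>) W" unfolding W_def by (rule subrep_image(1)[OF T U(1,2)])
  have W_iff: "cm.coset T v \<in> W \<longleftrightarrow> v \<in> U" if "v \<in> carrier V" for v
    unfolding W_def by (rule subrep_image(2)[OF T U(1,2) that])
  have "smooth_rep G (quot_module ?Q W) (quot_act (quot_act \<rho>))"
  proof (rule q.smooth_rep_quot[OF W])
    fix y assume "y \<in> carrier ?Q"
    then obtain v where v: "v \<in> carrier V" "y = cm.coset T v" by (auto simp: cm.quot_carrier[OF sT])
    define f where "f x = q.cm.coset W (cm.coset T x)" for x
    have f: "f (\<rho> g x) = f (\<rho> g z)" if "g \<in> carrier G" "x \<in> carrier V" "z \<in> carrier V" "f x = f z" for g x z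
    proof -
      have in_Q: "cm.coset T x \<in> carrier ?Q" "cm.coset T z \<in> carrier ?Q"
        using that by (simp_all add: cm.quot_carrier[OF sT])
      have "f (\<rho> g x) = quot_act (quot_act \<rho>) g (f x)" "f (\<rho> g z) = quot_act (quot_act \<rho>) g (f z)"
        unfolding f_def q.quot_act_coset[OF W that(1) in_Q(1)] q.quot_act_coset[OF W that(1) in_Q(2)]
          quot_act_coset[OF T that(1,2)] quot_act_coset[OF T that(1,3)] by simp_all
      then show ?thesis using that(4) by simp
    qed
    have "openin (top_of_set (carrier G)) {g \<in> carrier G. f (\<rho> g v) = f v}"
      by (rule op[OF subgroup_stabilizer[where f = f, OF v(1) f]]) (use v(1) in \<open>auto intro!: bexI[of _ v]\<close>)
    moreover have "{g \<in> carrier G. f (\<rho> g v) = f v} =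
        {g \<in> carrier G. q.cm.coset W (quot_act \<rho> g y) = q.cm.coset W y}"
      unfolding f_def v(2) using quot_act_coset[OF T _ v(1)] by (intro Collect_cong conj_cong refl) simp
    ultimately show "openin (top_of_set (carrier G))
        {g \<in> carrier G. q.cm.coset W (quot_act \<rho> g y) = q.cm.coset W y}" by (simp only:)
  qed
  moreover have "W \<noteq> carrier ?Q"
  proof
    assume *: "W = carrier ?Q"
    have "v \<in> U" if v: "v \<in> carrier V" for v
      using W_iff[OF v] v unfolding * by (simp add: cm.quot_carrier[OF sT])
    then show False using U(3) cm.subD(1)[OF subrepD(1)[OF U(1)]] by blast
  qed
  moreover have "Y = W \<or> Y = carrier ?Q" if Y: "subrep G ?Q (quot_act \<rho>) Y" "W \<subseteq> Y" for Y
  proof -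
    note Y' = subrep_vimage[OF T Y(1)]
    have "U \<subseteq> {v \<in> carrier V. cm.coset T v \<in> Y}"
      using Y(2) cm.subD(1)[OF subrepD(1)[OF U(1)]] by (auto simp: W_def)
    from max[OF Y'(1) this] show ?thesis
    proof
      assume 1: "{v \<in> carrier V. cm.coset T v \<in> Y} = U"
      show ?thesis using Y'(3) unfolding 1 W_def by blast
    next
      assume 2: "{v \<in> carrier V. cm.coset T v \<in> Y} = carrier V"
      show ?thesis using Y'(3) unfolding 2 by (simp add: cm.quot_carrier[OF sT])
    qed
  qed
  ultimately have "irreducible_rep G (quot_module ?Q W) (quot_act (quot_act \<rho>))"
    by (rule q.irreducible_quot[OF W])
  then show ?thesis using W unfolding has_irreducible_quotient_def by blast
qed

end

section \<open>Compactness of supercuspidal representations\<close>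

lemma absval_sum_le:
  assumes "0 \<le> r" "\<And>i. i \<in> A \<Longrightarrow> absval (f i) \<le> r"
  shows "absval (\<Sum>i\<in>A. f i :: 'a::nonarch_local_field) \<le> r"
  using assms by (induction A rule: infinite_finite_induct) (simp_all add: absval_add_le)

context symp_std begin

section \<open>The operator norm and the topology on matrices\<close>

lemma vnorm_sum_le:
  assumes "0 \<le> r" "\<And>i. i \<in> A \<Longrightarrow> vnorm (f i) \<le> r" shows "vnorm (\<Sum>i\<in>A. f i) \<le> r"
  using assms by (induction A rule: infinite_finite_induct) (simp_all add: vnorm_add_le)

text \<open>The standard coordinates and the chosen symplectic basis differ by a fixed change of
  basis, so their norms are equivalent.\<close>

lemma entries_bound:
  obtains C where "0 < C" "\<And>x i. absval (x $ i) \<le> C * vnorm x" "\<And>i. vnorm (axis i 1) \<le> C"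
proof -
  define C1 where "C1 = Max ((\<lambda>(b, i). absval (b $ i)) ` (basis \<times> UNIV))"
  define C2 where "C2 = Max (range (\<lambda>i::4. vnorm (axis i 1)))"
  define C where "C = max 1 (max C1 C2)"
  have C: "0 < C" "C1 \<le> C" "C2 \<le> C" by (auto simp: C_def)
  have b: "absval (b $ i) \<le> C" if "b \<in> basis" for b :: "'k ^ 4" and i
  proof -
    have "absval (b $ i) \<le> C1" unfolding C1_def
      by (rule Max_ge[OF _ image_eqI[of _ _ "(b, i)"]]) (use that in auto)
    then show ?thesis using C by linarith
  qed
  have "absval (x $ i) \<le> C * vnorm x" for x :: "'k ^ 4" and i
  proof -
    have "absval (B x c * b $ i) \<le> C * vnorm x" if "b \<in> basis" "c \<in> basis" for b c
      using mult_mono[OF absval_B_basis[OF that(2), of x] b[OF that(1), of i]] C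
      by (simp add: absval_mult mult.commute)
    then have "absval (B x Q1 * P1 $ i - B x P1 * Q1 $ i + B x Q2 * P2 $ i - B x P2 * Q2 $ i) \<le> C * vnorm x"
      by (intro absval_diff_le absval_add_le) (simp_all add: in_basis)
    also have "B x Q1 * P1 $ i - B x P1 * Q1 $ i + B x Q2 * P2 $ i - B x P2 * Q2 $ i =
        (B x Q1 *s P1 - B x P1 *s Q1 + B x Q2 *s P2 - B x P2 *s Q2) $ i" by simp
    finally show ?thesis by (simp only: sympl_expand[OF std])
  qed
  moreover have "vnorm (axis i 1) \<le> C" for i
  proof -
    have "vnorm (axis i 1) \<le> C2" unfolding C2_def by (intro Max_ge) auto
    then show ?thesis using C by linarith
  qed
  ultimately show ?thesis using that C(1) by blast
qed

lemma op_le_imp_dist: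
  assumes "0 < e" shows "\<exists>\<delta>>0. \<forall>A A'. op_le (A - A') \<delta> \<longrightarrow> dist A A' < e"
proof -
  obtain C where C: "0 < C" "\<And>x i. absval (x $ i) \<le> C * vnorm x" "\<And>i. vnorm (axis i 1) \<le> C"
    by (rule entries_bound) blast
  \<comment> \<open>Each of the 16 entries then moves by at most e/32, in total by at most e/2,
    which leaves room for the strict inequality.\<close>
  define \<delta> where "\<delta> = e / (32 * C * C)"
  have \<delta>: "0 < \<delta>" using assms C by (simp add: \<delta>_def)
  have "dist A A' < e" if A: "op_le (A - A') \<delta>" for A A'
  proof -
    have entry: "dist (A $ i $ j) (A' $ i $ j) \<le> e / 32" for i j
    proof -
      have "(A - A') $ i $ j = ((A - A') *v axis j 1) $ i"
        by (simp add: matrix_vector_mult_def axis_def if_distrib cong: if_cong)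
      then have "absval ((A - A') $ i $ j) \<le> C * vnorm ((A - A') *v axis j 1)" using C(2) by simp
      also have "\<dots> \<le> C * (\<delta> * vnorm (axis j 1))" using C(1) by (intro mult_left_mono op_leD[OF A]) auto
      also have "\<dots> \<le> C * (\<delta> * C)" using C \<delta> by (intro mult_left_mono) auto
      also have "\<dots> = e / 32" using C by (simp add: \<delta>_def)
      finally show ?thesis by (simp add: dist_absval)
    qed
    have row: "dist (A $ i) (A' $ i) \<le> e / 8" for i
    proof -
      have "dist (A $ i) (A' $ i) \<le> (\<Sum>j\<in>UNIV. dist (A $ i $ j) (A' $ i $ j))"
        unfolding dist_vec_def by (rule L2_set_le_sum) simp
      also have "\<dots> \<le> (\<Sum>j\<in>(UNIV::4 set). e / 32)" by (intro sum_mono entry)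
      finally show ?thesis by simp
    qed
    have "dist A A' \<le> (\<Sum>i\<in>UNIV. dist (A $ i) (A' $ i))"
      unfolding dist_vec_def[of A] by (rule L2_set_le_sum) simp
    also have "\<dots> \<le> (\<Sum>i\<in>(UNIV::4 set). e / 8)" by (intro sum_mono row)
    finally show ?thesis using assms by simp
  qed
  then show ?thesis using \<delta> by blast
qed

lemma dist_imp_op_le:
  assumes "0 < \<delta>" shows "\<exists>e>0. \<forall>A A'. dist A A' < e \<longrightarrow> op_le (A - A') \<delta>"
proof -
  obtain C where C: "0 < C" "\<And>x i. absval (x $ i) \<le> C * vnorm x" "\<And>i. vnorm (axis i 1) \<le> C"
    by (rule entries_bound) blast
  define e where "e = \<delta> / (C * C)"
  have e: "0 < e" using assms C by (simp add: e_def)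
  have "op_le (A - A') \<delta>" if A: "dist A A' < e" for A A'
  proof (rule op_leI)
    fix b assume b: "b \<in> basis"
    let ?D = "A - A'"
    have entry: "absval (?D $ i $ j) \<le> e" for i j
    proof -
      have "dist (A $ i $ j) (A' $ i $ j) \<le> dist A A'"
        using dist_vec_nth_le[of "A $ i" j "A' $ i"] dist_vec_nth_le[of A i A'] by linarith
      then show ?thesis using A by (simp add: dist_absval)
    qed
    have coord: "absval ((?D *v b) $ i) \<le> e * C" for i
      unfolding matrix_vector_mult_def vec_lambda_beta
    proof (rule absval_sum_le)
      show "0 \<le> e * C" using e C by simp
      fix j
      have "absval (b $ j) \<le> C * 1"
        using C(2)[of b j] mult_left_mono[OF vnorm_basis_le[OF b], of C] C(1) by linarith
      then show "absval (?D $ i $ j * b $ j) \<le> e * C"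
        unfolding absval_mult using entry e by (intro mult_mono) auto
    qed
    have "?D *v b = (\<Sum>i\<in>UNIV. (?D *v b) $ i *s axis i 1)"
      by (simp add: basis_expansion)
    moreover have "vnorm (\<Sum>i\<in>UNIV. (?D *v b) $ i *s axis i 1) \<le> \<delta>"
    proof (rule vnorm_sum_le)
      show "0 \<le> \<delta>" using assms by simp
      fix i
      have "absval ((?D *v b) $ i) * vnorm (axis i 1) \<le> (e * C) * C"
        using coord C e by (intro mult_mono) auto
      also have "\<dots> = \<delta>" using C by (simp add: e_def)
      finally show "vnorm ((?D *v b) $ i *s axis i 1) \<le> \<delta>" by (simp add: vnorm_scale)
    qed
    ultimately show "vnorm (?D *v b) \<le> \<delta>" by simp
  qed
  then show ?thesis using e by blast
qed

lemma cong_mono: "\<epsilon> \<le> \<epsilon>' \<Longrightarrow> cong \<epsilon> \<subseteq> cong \<epsilon>'"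
  by (auto simp: cong_def intro: op_le_mono)

lemma open_contains_cong:
  assumes "openin (top_of_set (carrier Sp)) S" "mat 1 \<in> S"
  obtains \<epsilon> where "0 < \<epsilon>" "\<epsilon> \<le> 1" "cong \<epsilon> \<subseteq> S"
proof -
  obtain e where e: "0 < e" "\<And>x. x \<in> carrier Sp \<Longrightarrow> dist x (mat 1) < e \<Longrightarrow> x \<in> S"
    using assms unfolding openin_euclidean_subtopology_iff by blast
  obtain \<delta> where \<delta>: "0 < \<delta>" "\<And>A A'. op_le (A - A') \<delta> \<Longrightarrow> dist A A' < e"
    using op_le_imp_dist[OF e(1)] by blast
  have "cong (min \<delta> 1) \<subseteq> cong \<delta>" by (rule cong_mono) simp
  moreover have "cong \<delta> \<subseteq> S" using e(2) \<delta>(2) by (auto simp: cong_def)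
  ultimately show ?thesis using \<delta>(1) by (intro that[of "min \<delta> 1"]) auto
qed

text \<open>If h is near g in \<open>S\<close>, then g^-1 h is near 1, how near depending on the
  norm of g^-1; so it lies in \<open>S\<close>, and so does h.\<close>

lemma subgroup_open:
  assumes J: "subgroup J Sp" and S: "subgroup S (Sp\<lparr>carrier := J\<rparr>)"
    and \<epsilon>: "0 < \<epsilon>" "cong \<epsilon> \<inter> J \<subseteq> S"
  shows "openin (top_of_set J) S"
  unfolding openin_euclidean_subtopology_iff
proof (intro conjI ballI)
  have SJ: "S \<subseteq> J" using subgroup.subset[OF S] by simp
  then show "S \<subseteq> J" .
  fix g assume g: "g \<in> S"
  have gJ: "g \<in> J" using g SJ by blast
  have gSp: "g \<in> carrier Sp" using gJ subgroup.subset[OF J] by blast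
  obtain r0 where "op_le (inv\<^bsub>Sp\<^esub> g) r0" by (rule exists_op_le)
  then have r: "op_le (inv\<^bsub>Sp\<^esub> g) (max r0 1)" by (rule op_le_mono) simp
  have "0 < \<epsilon> / max r0 1" using \<epsilon>(1) by simp
  from dist_imp_op_le[OF this] obtain e where e: "0 < e"
    "\<And>A A'. dist A A' < e \<Longrightarrow> op_le (A - A') (\<epsilon> / max r0 1)" by blast
  have "h \<in> S" if h: "h \<in> J" "dist h g < e" for h
  proof -
    have hSp: "h \<in> carrier Sp" using h subgroup.subset[OF J] by blast
    have "op_le (inv\<^bsub>Sp\<^esub> g ** (h - g)) (max r0 1 * (\<epsilon> / max r0 1))"
      by (intro op_le_mult r e(2) h(2))
    moreover have "inv\<^bsub>Sp\<^esub> g ** (h - g) = inv\<^bsub>Sp\<^esub> g ** h - mat 1"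
      by (simp add: matrix_eq matrix_vector_mul_assoc[symmetric] matrix_vector_mult_diff_rdistrib
        matrix_vector_mult_diff_distrib Sp_inv(3)[OF gSp])
    moreover have "max r0 1 * (\<epsilon> / max r0 1) = \<epsilon>" by simp
    ultimately have "op_le (inv\<^bsub>Sp\<^esub> g ** h - mat 1) \<epsilon>" by (simp only:)
    moreover have ghJ: "inv\<^bsub>Sp\<^esub> g ** h \<in> J"
      using subgroup.m_closed[OF J subgroup.m_inv_closed[OF J gJ] h(1)] by simp
    ultimately have "inv\<^bsub>Sp\<^esub> g ** h \<in> S"
      using \<epsilon>(2) subgroup.subset[OF J] by (auto simp: cong_def)
    then have "g ** (inv\<^bsub>Sp\<^esub> g ** h) \<in> S" using subgroup.m_closed[OF S g] by (simp add: Sp_group_def)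
    then show "h \<in> S" by (simp add: matrix_mul_assoc Sp_inv(2)[OF gSp])
  qed
  then show "\<exists>e>0. \<forall>h\<in>J. dist h g < e \<longrightarrow> h \<in> S" using e(1) by blast
qed

lemma cong_cosets:
  assumes g: "g \<in> carrier Sp" and h: "h \<in> carrier Sp" "op_le h R" and d: "op_le (g - h) \<delta>"
    and le: "\<delta> * R \<le> \<epsilon>"
  shows "g ** inv\<^bsub>Sp\<^esub> h \<in> cong \<epsilon>" "inv\<^bsub>Sp\<^esub> h ** g \<in> cong \<epsilon>"
proof -
  have hR: "op_le (inv\<^bsub>Sp\<^esub> h) R" by (rule op_le_inv[OF h])
  have "op_le ((g - h) ** inv\<^bsub>Sp\<^esub> h) \<epsilon>" by (rule op_le_mono[OF op_le_mult[OF d hR] le])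
  moreover have "(g - h) ** inv\<^bsub>Sp\<^esub> h = g ** inv\<^bsub>Sp\<^esub> h - mat 1"
    by (simp add: matrix_eq matrix_vector_mul_assoc[symmetric] matrix_vector_mult_diff_rdistrib
        Sp_inv(4)[OF h(1)])
  moreover have "g ** inv\<^bsub>Sp\<^esub> h \<in> carrier Sp" using Sp.m_closed[OF g Sp.inv_closed[OF h(1)]] by simp
  ultimately show "g ** inv\<^bsub>Sp\<^esub> h \<in> cong \<epsilon>" by (simp add: cong_def)
  have "op_le (inv\<^bsub>Sp\<^esub> h ** (g - h)) \<epsilon>"
    using op_le_mono[OF op_le_mult[OF hR d]] le by (simp add: mult.commute)
  moreover have "inv\<^bsub>Sp\<^esub> h ** (g - h) = inv\<^bsub>Sp\<^esub> h ** g - mat 1"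
    by (simp add: matrix_eq matrix_vector_mul_assoc[symmetric] matrix_vector_mult_diff_rdistrib
        matrix_vector_mult_diff_distrib Sp_inv(3)[OF h(1)])
  moreover have "inv\<^bsub>Sp\<^esub> h ** g \<in> carrier Sp" using Sp.m_closed[OF Sp.inv_closed[OF h(1)] g] by simp
  ultimately show "inv\<^bsub>Sp\<^esub> h ** g \<in> cong \<epsilon>" by (simp add: cong_def)
qed

text \<open>Both kinds of cosets are recorded: left cosets control orbits of vectors, right cosets
  are the points of the coset space.\<close>

lemma finite_cosets:
  assumes "0 < \<epsilon>"
  obtains \<Gamma> where "finite \<Gamma>" "\<Gamma> \<subseteq> carrier Sp"
    "\<And>g. g \<in> carrier Sp \<Longrightarrow> op_le g R \<Longrightarrow> \<exists>\<gamma>\<in>\<Gamma>. g ** inv\<^bsub>Sp\<^esub> \<gamma> \<in> cong \<epsilon> \<and> inv\<^bsub>Sp\<^esub> \<gamma> ** g \<in> cong \<epsilon>"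
proof -
  have "0 < \<epsilon> / max R 1" using assms by simp
  then obtain \<Gamma> where \<Gamma>: "finite \<Gamma>" "\<Gamma> \<subseteq> {g \<in> carrier Sp. op_le g R}"
    "\<And>g. g \<in> carrier Sp \<Longrightarrow> op_le g R \<Longrightarrow> \<exists>\<gamma>\<in>\<Gamma>. op_le (g - \<gamma>) (\<epsilon> / max R 1)"
    by (rule finite_cover) blast
  show ?thesis
  proof (rule that[of \<Gamma>])
    show "finite \<Gamma>" "\<Gamma> \<subseteq> carrier Sp" using \<Gamma>(1,2) by auto
    fix g assume g: "g \<in> carrier Sp" "op_le g R"
    obtain \<gamma> where \<gamma>: "\<gamma> \<in> \<Gamma>" "op_le (g - \<gamma>) (\<epsilon> / max R 1)" using \<Gamma>(3)[OF g] by blast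
    have \<gamma>': "\<gamma> \<in> carrier Sp" "op_le \<gamma> (max R 1)" using \<gamma>(1) \<Gamma>(2) op_le_mono by auto
    have "\<epsilon> / max R 1 * max R 1 \<le> \<epsilon>" by simp
    from cong_cosets[OF g(1) \<gamma>' \<gamma>(2) this] \<gamma>(1)
    show "\<exists>\<gamma>\<in>\<Gamma>. g ** inv\<^bsub>Sp\<^esub> \<gamma> \<in> cong \<epsilon> \<and> inv\<^bsub>Sp\<^esub> \<gamma> ** g \<in> cong \<epsilon>" by blast
  qed
qed

end

section \<open>Coinvariants of congruence subgroups and compactness\<close>

locale symp_rep = symp_std B P1 Q1 P2 Q2 + smooth_rep "Sp_group B" V \<pi>
  for B :: "'k::nonarch_local_field ^ 4 \<Rightarrow> 'k ^ 4 \<Rightarrow> 'k" and P1 Q1 P2 Q2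
    and V :: "(complex, 'v) module" and \<pi>
begin

text \<open>The subspace divided out to form the coinvariants of \<open>cong \<epsilon>\<close>, not
  the quotient itself.\<close>

abbreviation coinv :: "real \<Rightarrow> 'v set"
  where "coinv \<epsilon> \<equiv> twisted_span V \<pi> (cong \<epsilon>) (\<lambda>_. 1)"

lemma cong_Sp: "cong \<epsilon> \<subseteq> carrier Sp"
  by (auto simp: cong_def)

lemma sub_coinv: "cm.sub (coinv \<epsilon>)"
  by (rule twisted_span_sub[OF cong_Sp])

lemma exists_cong_fixing:
  assumes v: "v \<in> carrier V"
  obtains \<epsilon> where "0 < \<epsilon>" "\<epsilon> \<le> 1" "\<And>k. k \<in> cong \<epsilon> \<Longrightarrow> \<pi> k v = v"
proof -
  have "mat 1 \<in> {g \<in> carrier Sp. \<pi> g v = v}" using rep_one[OF v] Sp.one_closed by simp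
  then obtain \<epsilon> where "0 < \<epsilon>" "\<epsilon> \<le> 1" "cong \<epsilon> \<subseteq> {g \<in> carrier Sp. \<pi> g v = v}"
    by (rule open_contains_cong[OF smooth[OF v]])
  then show ?thesis by (intro that) auto
qed

lemma finite_K0_orbit:
  assumes v: "v \<in> carrier V" shows "finite {\<pi> k v | k. k \<in> K0}"
proof -
  obtain \<epsilon> where \<epsilon>: "0 < \<epsilon>" "\<epsilon> \<le> 1" "\<And>k. k \<in> cong \<epsilon> \<Longrightarrow> \<pi> k v = v"
    by (rule exists_cong_fixing[OF v]) blast
  obtain \<Gamma> where \<Gamma>: "finite \<Gamma>" "\<Gamma> \<subseteq> carrier Sp" "\<And>g. g \<in> carrier Sp \<Longrightarrow> op_le g 1 \<Longrightarrow>
      \<exists>\<gamma>\<in>\<Gamma>. g ** inv\<^bsub>Sp\<^esub> \<gamma> \<in> cong \<epsilon> \<and> inv\<^bsub>Sp\<^esub> \<gamma> ** g \<in> cong \<epsilon>"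
    using finite_cosets[OF \<epsilon>(1), of 1] by metis
  have "{\<pi> k v | k. k \<in> K0} \<subseteq> (\<lambda>\<gamma>. \<pi> \<gamma> v) ` \<Gamma>"
  proof clarify
    fix k assume "k \<in> K0"
    then have k: "k \<in> carrier Sp" "op_le k 1" by (auto simp: K0_def)
    obtain \<gamma> where \<gamma>: "\<gamma> \<in> \<Gamma>" "inv\<^bsub>Sp\<^esub> \<gamma> ** k \<in> cong \<epsilon>" using \<Gamma>(3)[OF k] by blast
    have \<gamma>Sp: "\<gamma> \<in> carrier Sp" using \<gamma> \<Gamma> by blast
    have "\<pi> (\<gamma> \<otimes>\<^bsub>Sp\<^esub> (inv\<^bsub>Sp\<^esub> \<gamma> ** k)) v = \<pi> \<gamma> (\<pi> (inv\<^bsub>Sp\<^esub> \<gamma> ** k) v)"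
      using \<gamma>Sp \<gamma>(2) cong_Sp v by (intro rep_mult) auto
    then have "\<pi> k v = \<pi> \<gamma> v"
      by (simp add: matrix_mul_assoc Sp_inv(2)[OF \<gamma>Sp] \<epsilon>(3)[OF \<gamma>(2)])
    then show "\<pi> k v \<in> (\<lambda>\<gamma>. \<pi> \<gamma> v) ` \<Gamma>" using \<gamma>(1) by blast
  qed
  then show ?thesis using \<Gamma>(1) finite_surj by blast
qed

text \<open>If \<open>g\<close> contracts \<open>n\<close> into \<open>cong \<epsilon>\<close>, then \<open>g (n v - v) = (g n g\<inverse>) g v - g v\<close> dies in the
  coinvariants.\<close>

lemma contraction:
  assumes N: "N \<subseteq> carrier Sp" and P: "\<And>g t. P g t \<Longrightarrow> g \<in> carrier Sp"
    and contr: "\<And>n. n \<in> N \<Longrightarrow> \<exists>R::real. \<forall>g t. P g t \<longrightarrow> R \<le> t \<longrightarrow> g ** n ** inv\<^bsub>Sp\<^esub> g \<in> cong \<epsilon>"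
    and u: "u \<in> twisted_span V \<pi> N (\<lambda>_. 1)"
  shows "\<exists>R. \<forall>g t. P g t \<longrightarrow> R \<le> t \<longrightarrow> \<pi> g u \<in> coinv \<epsilon>"
proof -
  note S = cm.subD[OF sub_coinv[of \<epsilon>]]
  define U where "U = {u \<in> carrier V. \<exists>R. \<forall>g t. P g t \<longrightarrow> R \<le> t \<longrightarrow> \<pi> g u \<in> coinv \<epsilon>}"
  have "cm.sub U"
  proof (rule cm.subI)
    show "U \<subseteq> carrier V" by (auto simp: U_def)
    show "\<zero>\<^bsub>V\<^esub> \<in> U" using S(2) P by (auto simp: U_def)
  next
    fix v w assume "v \<in> U" "w \<in> U"
    then obtain R R' where *: "v \<in> carrier V" "w \<in> carrier V"
      "\<And>g t. P g t \<Longrightarrow> R \<le> t \<Longrightarrow> \<pi> g v \<in> coinv \<epsilon>" "\<And>g t. P g t \<Longrightarrow> R' \<le> t \<Longrightarrow> \<pi> g w \<in> coinv \<epsilon>"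
      unfolding U_def by blast
    have "\<pi> g (v \<oplus>\<^bsub>V\<^esub> w) \<in> coinv \<epsilon>" if "P g t" "max R R' \<le> t" for g t
      using *(3,4)[OF that(1)] that(2) S(3) by (simp add: rep_add[OF P[OF that(1)] *(1,2)])
    then show "v \<oplus>\<^bsub>V\<^esub> w \<in> U" using * unfolding U_def by blast
  next
    fix a v assume "v \<in> U"
    then obtain R where *: "v \<in> carrier V" "\<And>g t. P g t \<Longrightarrow> R \<le> t \<Longrightarrow> \<pi> g v \<in> coinv \<epsilon>"
      unfolding U_def by blast
    have "\<pi> g (a \<odot>\<^bsub>V\<^esub> v) \<in> coinv \<epsilon>" if "P g t" "R \<le> t" for g t
      using *(2)[OF that] S(4) by (simp add: rep_smult[OF P[OF that(1)] *(1)])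
    then show "a \<odot>\<^bsub>V\<^esub> v \<in> U" using * unfolding U_def by auto
  qed
  moreover have "\<pi> n v \<ominus>\<^bsub>V\<^esub> 1 \<odot>\<^bsub>V\<^esub> v \<in> U" if n: "n \<in> N" and v: "v \<in> carrier V" for n v
  proof -
    have nSp: "n \<in> carrier Sp" using n N by blast
    obtain R where R: "\<And>g t. P g t \<Longrightarrow> R \<le> t \<Longrightarrow> g ** n ** inv\<^bsub>Sp\<^esub> g \<in> cong \<epsilon>" using contr[OF n] by blast
    have "\<pi> g (\<pi> n v \<ominus>\<^bsub>V\<^esub> 1 \<odot>\<^bsub>V\<^esub> v) \<in> coinv \<epsilon>" if gt: "P g t" "R \<le> t" for g t
    proof -
      have g: "g \<in> carrier Sp" by (rule P[OF gt(1)])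
      let ?m = "g ** n ** inv\<^bsub>Sp\<^esub> g"
      have m: "?m \<in> cong \<epsilon>" by (rule R[OF gt])
      have "?m \<otimes>\<^bsub>Sp\<^esub> g = g \<otimes>\<^bsub>Sp\<^esub> n" by (simp add: matrix_mul_assoc[symmetric] Sp_inv(1)[OF g])
      then have "\<pi> ?m (\<pi> g v) = \<pi> g (\<pi> n v)"
        using rep_mult[OF _ g v, of ?m] rep_mult[OF g nSp v] subsetD[OF cong_Sp m] by simp
      then have "\<pi> g (\<pi> n v \<ominus>\<^bsub>V\<^esub> 1 \<odot>\<^bsub>V\<^esub> v) = \<pi> ?m (\<pi> g v) \<ominus>\<^bsub>V\<^esub> 1 \<odot>\<^bsub>V\<^esub> \<pi> g v"
        using rep_diff[OF g rep_closed[OF nSp v] v] v rep_closed[OF g v] by simp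
      also have "\<dots> \<in> coinv \<epsilon>" by (rule twisted_span_gen[OF m rep_closed[OF g v]])
      finally show ?thesis .
    qed
    then show ?thesis using rep_closed[OF nSp v] v unfolding U_def by auto
  qed
  ultimately have "twisted_span V \<pi> N (\<lambda>_. 1) \<subseteq> U" by (rule twisted_span_least)
  then show ?thesis using u unfolding U_def by blast
qed

lemma jacquet_zero:
  assumes N: "N \<subseteq> carrier Sp" and z: "carrier (jacquet V \<pi> N) = {\<zero>\<^bsub>jacquet V \<pi> N\<^esub>}"
  shows "twisted_span V \<pi> N (\<lambda>_. 1) = carrier V"
proof -
  let ?T = "twisted_span V \<pi> N (\<lambda>_. 1)"
  have T: "cm.sub ?T" by (rule twisted_span_sub[OF N])
  have "v \<in> ?T" if v: "v \<in> carrier V" for v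
  proof -
    have "cm.coset ?T v \<in> carrier (jacquet V \<pi> N)"
      unfolding twisted_jacquet_def cm.quot_carrier[OF T] using v by blast
    then have "cm.coset ?T v = ?T" unfolding z by (simp add: twisted_jacquet_def cm.quot_zero[OF T])
    then show ?thesis using cm.coset_eq_W[OF T v] by blast
  qed
  then show ?thesis using cm.subD(1)[OF T] by blast
qed

text \<open>In g = k' a k the factor k moves \<open>v\<close> only within a finite orbit, and k' is
  absorbed because \<open>K0\<close> normalizes \<open>cong \<epsilon>\<close>. If c is large then
  so is c/d or d, and a contracts the Klingen or the Siegel radical. Every vector lies in the span
  for that radical, because the Jacquet module vanishes.\<close>

theorem supercuspidal_compact:
  assumes sc: "supercuspidal B V \<pi>" and \<epsilon>: "0 < \<epsilon>" and v: "v \<in> carrier V"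
  shows "\<exists>R. \<forall>g\<in>carrier Sp. \<not> op_le g R \<longrightarrow> \<pi> g v \<in> coinv \<epsilon>"
proof -
  have kaSp: "k ** a \<in> carrier Sp" if "k \<in> K0" "diag a c d" for k a c d
    using Sp.m_closed[of k a] that by (simp add: K0_def diag_def)
  \<comment> \<open>The function \<open>t\<close> gives the rate at which a \<open>diag\<close>
    element contracts the radical of the flag: \<open>absval c / absval d\<close> for Klingen,
    \<open>absval d\<close> for Siegel.\<close>
  have far: "\<exists>R. \<forall>k a c d. k \<in> K0 \<longrightarrow> diag a c d \<longrightarrow> R \<le> t c d \<longrightarrow> \<pi> (k ** a) u \<in> coinv \<epsilon>"
    if F: "isotropic_flag B F" and t: "\<And>a c d. diag a c d \<Longrightarrow> 0 < t c d"
      and conj: "\<And>a c d n r. diag a c d \<Longrightarrow> n \<in> unipotent_radical B F \<Longrightarrow> op_le (n - mat 1) r \<Longrightarrow>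
        op_le (a ** n ** inv\<^bsub>Sp\<^esub> a - mat 1) (r / t c d)"
      and u: "u \<in> carrier V"
    for F u and t :: "'k \<Rightarrow> 'k \<Rightarrow> real"
  proof -
    define P where "P g s \<longleftrightarrow> (\<exists>k\<in>K0. \<exists>a c d. diag a c d \<and> g = k ** a \<and> s = t c d)" for g s
    have unip: "unipotent_radical B F \<subseteq> carrier Sp" by (auto simp: unipotent_radical_def)
    have "\<exists>R. \<forall>g s. P g s \<longrightarrow> R \<le> s \<longrightarrow> \<pi> g u \<in> coinv \<epsilon>"
    proof (rule contraction[OF unip])
      have "twisted_span V \<pi> (unipotent_radical B F) (\<lambda>_. 1) = carrier V"
        using sc F by (intro jacquet_zero unip) (simp add: supercuspidal_def)
      then show "u \<in> twisted_span V \<pi> (unipotent_radical B F) (\<lambda>_. 1)" using u by simp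
      show "g \<in> carrier Sp" if "P g s" for g s using that kaSp unfolding P_def by blast
      fix n assume n: "n \<in> unipotent_radical B F"
      obtain r where r: "op_le (n - mat 1) r" by (rule exists_op_le)
      have "g ** n ** inv\<^bsub>Sp\<^esub> g \<in> cong \<epsilon>" if g: "P g s" "r / \<epsilon> \<le> s" for g s
      proof -
        obtain k a c d where *: "k \<in> K0" "diag a c d" "g = k ** a" "s = t c d"
          using g(1) unfolding P_def by blast
        have ka: "k \<in> carrier Sp" "a \<in> carrier Sp" using *(1,2) by (auto simp: K0_def diag_def)
        have "r / t c d \<le> \<epsilon>" using g(2) t[OF *(2)] \<epsilon> by (simp add: *(4) field_simps)
        then have "op_le (a ** n ** inv\<^bsub>Sp\<^esub> a - mat 1) \<epsilon>" using conj[OF *(2) n r] op_le_mono by blast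
        moreover have "a ** n ** inv\<^bsub>Sp\<^esub> a \<in> carrier Sp"
          using Sp.m_closed[OF Sp.m_closed[OF ka(2) subsetD[OF unip n]] Sp.inv_closed[OF ka(2)]] by simp
        ultimately have "k ** (a ** n ** inv\<^bsub>Sp\<^esub> a) ** inv\<^bsub>Sp\<^esub> k \<in> cong \<epsilon>"
          by (intro cong_conj[OF *(1)]) (simp add: cong_def)
        then show ?thesis using Sp.inv_mult_group[OF ka] by (simp add: *(3) matrix_mul_assoc)
      qed
      then show "\<exists>R. \<forall>g s. P g s \<longrightarrow> R \<le> s \<longrightarrow> g ** n ** inv\<^bsub>Sp\<^esub> g \<in> cong \<epsilon>" by blast
    qed
    then show ?thesis unfolding P_def by blast
  qed
  have pos: "0 < absval c" "0 < absval d" if "diag a c d" for a c d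
    using that unfolding diag_def by linarith+
  have K: "\<exists>R. \<forall>k a c d. k \<in> K0 \<longrightarrow> diag a c d \<longrightarrow> R \<le> absval c / absval d \<longrightarrow> \<pi> (k ** a) u \<in> coinv \<epsilon>"
    if "u \<in> carrier V" for u
    by (rule far[OF isotropic_flag_klingen _ _ that])
      (use pos conj_klingen in \<open>simp_all only: divide_pos_pos divide_divide_eq_right\<close>)
  have S: "\<exists>R. \<forall>k a c d. k \<in> K0 \<longrightarrow> diag a c d \<longrightarrow> R \<le> absval d \<longrightarrow> \<pi> (k ** a) u \<in> coinv \<epsilon>"
    if "u \<in> carrier V" for u
    by (rule far[OF isotropic_flag_siegel pos(2) conj_siegel that])
  define orb where "orb = {\<pi> k v | k. k \<in> K0}"
  have orb: "finite orb" "orb \<subseteq> carrier V"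
    using finite_K0_orbit[OF v] v rep_closed by (auto simp: orb_def K0_def)
  have "\<forall>u\<in>orb. \<exists>R. \<forall>k a c d. k \<in> K0 \<longrightarrow> diag a c d \<longrightarrow> R \<le> absval c / absval d \<longrightarrow> \<pi> (k ** a) u \<in> coinv \<epsilon>"
    using K orb(2) by blast
  from bchoice[OF this] obtain RK where RK:
    "\<forall>u\<in>orb. \<forall>k a c d. k \<in> K0 \<longrightarrow> diag a c d \<longrightarrow> RK u \<le> absval c / absval d \<longrightarrow> \<pi> (k ** a) u \<in> coinv \<epsilon>" ..
  have "\<forall>u\<in>orb. \<exists>R. \<forall>k a c d. k \<in> K0 \<longrightarrow> diag a c d \<longrightarrow> R \<le> absval d \<longrightarrow> \<pi> (k ** a) u \<in> coinv \<epsilon>"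
    using S orb(2) by blast
  from bchoice[OF this] obtain RS where RS:
    "\<forall>u\<in>orb. \<forall>k a c d. k \<in> K0 \<longrightarrow> diag a c d \<longrightarrow> RS u \<le> absval d \<longrightarrow> \<pi> (k ** a) u \<in> coinv \<epsilon>" ..
  define M where "M = Max (insert 1 (RK ` orb \<union> RS ` orb))"
  have M: "1 \<le> M" "\<And>u. u \<in> orb \<Longrightarrow> RK u \<le> M" "\<And>u. u \<in> orb \<Longrightarrow> RS u \<le> M"
    unfolding M_def using orb(1) by (auto intro!: Max_ge)
  \<comment> \<open>The square serves the case distinction: if \<open>absval c\<close> exceeds
    \<open>M * M\<close>, then \<open>absval d\<close> is at least \<open>M\<close>, or else the
    quotient \<open>absval c / absval d\<close> is.\<close>
  have "\<pi> g v \<in> coinv \<epsilon>" if g: "g \<in> carrier Sp" and big: "\<not> op_le g (M * M)" for g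
  proof -
    obtain k a k' c d where *: "k \<in> K0" "k' \<in> K0" "diag a c d" "g = k' ** a ** k" "op_le g (absval c)"
      by (rule cartan_KAK[OF g]) blast
    have big': "M * M < absval c"
    proof (rule ccontr)
      assume "\<not> M * M < absval c"
      then have "op_le g (M * M)" using op_le_mono[OF *(5)] by simp
      then show False using big by blast
    qed
    have d: "0 < absval d" using *(3) unfolding diag_def by linarith
    have kv: "\<pi> k v \<in> orb" using *(1) by (auto simp: orb_def)
    have "\<pi> ((k' ** a) \<otimes>\<^bsub>Sp\<^esub> k) v = \<pi> (k' ** a) (\<pi> k v)"
      using kaSp[OF *(2,3)] *(1) v by (intro rep_mult) (auto simp: K0_def)
    then have gv: "\<pi> g v = \<pi> (k' ** a) (\<pi> k v)" by (simp add: *(4))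
    show ?thesis
    proof (cases "M \<le> absval d")
      case True
      then have "RS (\<pi> k v) \<le> absval d" using M(3)[OF kv] by linarith
      then show ?thesis unfolding gv using RS kv *(2,3) by blast
    next
      case False
      have "M * absval d \<le> M * M" using False M(1) by (intro mult_left_mono) auto
      then have "M \<le> absval c / absval d" using big' d by (simp add: pos_le_divide_eq)
      then have "RK (\<pi> k v) \<le> absval c / absval d" using M(2)[OF kv] by linarith
      then show ?thesis unfolding gv using RK kv *(2,3) by blast
    qed
  qed
  then show ?thesis by blast
qed

end

section \<open>The center of the Heisenberg group, and coinvariants\<close>

context symp begin

lemma J_subgroup: "subgroup {g \<in> carrier Sp. g *v e = e} Sp"
proof (rule subgroup.intro)
  show "x \<otimes>\<^bsub>Sp\<^esub> y \<in> {g \<in> carrier Sp. g *v e = e}"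
    if "x \<in> {g \<in> carrier Sp. g *v e = e}" "y \<in> {g \<in> carrier Sp. g *v e = e}" for x y
    using that Sp.m_closed[of x y] by (auto simp: matrix_vector_mul_assoc[symmetric])
  show "inv\<^bsub>Sp\<^esub> x \<in> {g \<in> carrier Sp. g *v e = e}" if "x \<in> {g \<in> carrier Sp. g *v e = e}" for x
    using that Sp_inv(3)[of x e] by auto
qed (use Sp.one_closed in auto)

lemma J_carrier: "carrier (J_group B e) = {g \<in> carrier Sp. g *v e = e}"
  by (simp add: J_group_def)

lemma J_group_eq: "J_group B e = Sp\<lparr>carrier := {g \<in> carrier Sp. g *v e = e}\<rparr>"
  by (simp add: J_group_def)

lemma H_carrier: "g \<in> carrier (H_group B e) \<longleftrightarrow>
    g \<in> carrier Sp \<and> g *v e = e \<and> (\<forall>v. B e v = 0 \<longrightarrow> (\<exists>t. g *v v - v = t *s e))"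
  by (auto simp: H_group_def J_group_def vec.span_singleton)

text \<open>The elements \<open>x \<mapsto> x + B(x,e) u + B(x,u) e\<close> with \<open>u\<close> orthogonal to \<open>e\<close> lie in the Heisenberg
  group; commuting with them forces a central \<open>z\<close> to be a transvection along \<open>e\<close>.\<close>

lemma center_H_transvection:
  assumes e: "e \<noteq> 0" and z: "z \<in> Z_subgroup B e"
  shows "\<exists>t. \<forall>x. z *v x = x + (t * B x e) *s e"
proof -
  have zH: "z \<in> carrier (H_group B e)" and comm: "\<And>g. g \<in> carrier (H_group B e) \<Longrightarrow> z ** g = g ** z"
    using z by (auto simp: center_def H_group_def Sp_group_def)
  have zSp: "z \<in> carrier Sp" and ze: "z *v e = e"
    and zu: "\<And>u. B e u = 0 \<Longrightarrow> \<exists>t. z *v u - u = t *s e"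
    using zH unfolding H_carrier by auto
  have zB: "B (z *v x) (z *v y) = B x y" for x y using zSp unfolding Sp_iff by blast
  obtain x0 where x0: "B e x0 = 1" by (rule exists_hyperbolic_partner[OF e])
  \<comment> \<open>With this sign \<open>B x1 e = 1\<close>, so the Heisenberg element of
    \<open>u\<close> sends \<open>x1\<close> to \<open>x1 + u\<close> up to a multiple of
    \<open>e\<close>.\<close>
  define x1 where "x1 = - x0"
  have x1: "B x1 e = 1" "B e x1 = -1" using x0 B_skew[of x0 e] by (simp_all add: x1_def B_simps)
  have key: "z *v u = u \<and> B (z *v x1 - x1) u = 0" if u: "B e u = 0" for u
  proof -
    have ue: "B u e = 0" using u B_skew[of u e] by simp
    define f where "f x = x + B x e *s u + B x u *s e" for x
    have "Vector_Spaces.linear (*s) (*s) f"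
      by (auto simp: Vector_Spaces.linear_iff vec.vector_space_axioms f_def B_simps vec_eq_iff algebra_simps)
    then have h: "matrix f *v x = f x" for x by (rule matrix_works)
    have "B (f x) (f y) = B x y" for x y
      using u ue B_skew[of e y] B_skew[of u y] by (simp add: f_def B_simps algebra_simps)
    moreover have "f e = e" using u by (simp add: f_def)
    moreover have "\<exists>t. f v - v = t *s e" if "B e v = 0" for v
      using that B_skew[of v e] by (auto simp: f_def)
    ultimately have "matrix f \<in> carrier (H_group B e)" unfolding H_carrier Sp_iff h by blast
    from arg_cong[OF comm[OF this], of "\<lambda>m. m *v x1"]
    have "z *v (matrix f *v x1) = matrix f *v (z *v x1)" by (simp only: matrix_vector_mul_assoc)
    then have eq: "z *v f x1 = f (z *v x1)" by (simp only: h)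
    obtain t where t: "z *v u - u = t *s e" using zu[OF u] by blast
    then have zu': "z *v u = u + t *s e" by (simp only: diff_eq_eq add.commute)
    have Bz: "B (z *v x1) e = 1" using zB[of x1 e] x1 ze by simp
    have "z *v f x1 = z *v x1 + (u + t *s e) + B x1 u *s e"
      by (simp only: f_def x1 matrix_vector_right_distrib vector_scalar_commute vec.scale_one zu' ze)
    moreover have "f (z *v x1) = z *v x1 + u + B (z *v x1) u *s e"
      by (simp only: f_def Bz vec.scale_one)
    ultimately have "z *v x1 + (u + t *s e) + B x1 u *s e = z *v x1 + u + B (z *v x1) u *s e"
      using eq by (simp only:)
    then have "t *s e + B x1 u *s e = B (z *v x1) u *s e" by (simp only: add.assoc add_left_cancel)
    then have "(t + B x1 u) *s e = B (z *v x1) u *s e" by (simp only: vec.scale_left_distrib)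
    then have t1: "t + B x1 u = B (z *v x1) u" using e by (simp only: vec.scale_cancel_right) blast
    have "B (z *v x1) (u + t *s e) = B x1 u" using zB[of x1 u] by (simp only: zu')
    then have t2: "B (z *v x1) u + t * B (z *v x1) e = B x1 u"
      by (simp only: B_add_right B_scale_right)
    \<comment> \<open>Commutation gives \<open>t1\<close>, and invariance of the form under
      \<open>z\<close> gives \<open>t2\<close>. They contain \<open>t\<close> with opposite effect,
      so together they yield \<open>2 * t = 0\<close>.\<close>
    have "2 * t = (B (z *v x1) u + t * B (z *v x1) e) - B x1 u"
      unfolding t1[symmetric] Bz by simp
    then have "2 * t = 0" unfolding t2 by simp
    then have "t = 0" using two_nonzero by simp
    then have "z *v u = u" "B x1 u = B (z *v x1) u" using zu' t1 by simp_all
    then show ?thesis by (simp only: B_diff_left) simp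
  qed
  define y where "y = z *v x1 - x1"
  \<comment> \<open>By \<open>key\<close>, \<open>y\<close> is orthogonal to everything orthogonal
    to \<open>e\<close>, hence a multiple of \<open>e\<close>; the coefficient is found by pairing
    with \<open>x1\<close>.\<close>
  have "y + B y x1 *s e = 0"
  proof (rule B_nondeg)
    fix w
    define u where "u = w - B w e *s x1"
    have "B u e = 0" by (simp add: u_def B_simps x1)
    then have "B e u = 0" using B_skew[of e u] by simp
    then have "B y u = 0" using key by (simp add: y_def)
    then have "B y w = B w e * B y x1" by (simp add: u_def B_simps)
    moreover have "B e w = - B w e" by (rule B_skew)
    ultimately show "B (y + B y x1 *s e) w = 0" by (simp add: B_simps)
  qed
  then have y: "z *v x1 = x1 + (- B y x1) *s e" by (simp add: y_def algebra_simps eq_neg_iff_add_eq_0)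
  have "z *v x = x + ((- B y x1) * B x e) *s e" for x
  proof -
    define u where "u = x - B x e *s x1"
    have "B u e = 0" by (simp add: u_def B_simps x1)
    then have "B e u = 0" using B_skew[of e u] by simp
    then have "z *v u = u" using key by blast
    moreover have "u + B x e *s x1 = x" by (simp add: u_def)
    moreover have "z *v (u + B x e *s x1) = z *v u + B x e *s (z *v x1)"
      by (simp only: matrix_vector_right_distrib vector_scalar_commute)
    ultimately have "z *v x = u + B x e *s (x1 + (- B y x1) *s e)" by (simp only: y)
    also have "\<dots> = (u + B x e *s x1) + ((- B y x1) * B x e) *s e"
      by (simp only: vec.scale_right_distrib vec.scale_scale add.assoc mult.commute)
    also have "u + B x e *s x1 = x" by (simp add: u_def)
    finally show ?thesis .
  qed
  then show ?thesis by blast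
qed

text \<open>A transvection along \<open>e\<close> is expressed by \<open>e\<close> and the form, and
  elements of J preserve both. Hence J acts on the twisted Jacquet module.\<close>

lemma Z_commutes:
  assumes e: "e \<noteq> 0" and z: "z \<in> Z_subgroup B e" and g: "g \<in> carrier Sp" "g *v e = e"
  shows "z ** g = g ** z"
proof -
  obtain t where t: "\<And>x. z *v x = x + (t * B x e) *s e" using center_H_transvection[OF e z] by blast
  have ge: "B (g *v x) e = B x e" for x
  proof -
    have "B (g *v x) (g *v e) = B x e" using g(1) unfolding Sp_iff by blast
    then show ?thesis by (simp only: g(2))
  qed
  have "z *v (g *v x) = g *v (z *v x)" for x
    unfolding t by (simp add: ge matrix_vector_right_distrib vector_scalar_commute g(2))
  then show ?thesis by (simp add: matrix_eq matrix_vector_mul_assoc)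
qed

lemma Z_subset_J: "Z_subgroup B e \<subseteq> {g \<in> carrier Sp. g *v e = e}"
  by (auto simp: center_def H_carrier)

end

section \<open>Averaging over a congruence subgroup\<close>

context symp_rep begin

text \<open>On vectors fixed by \<open>cong \<delta>\<close>, summing over representatives
  \<open>D\<close> of its cosets in \<open>cong \<epsilon>\<close> stands in for integration over
  \<open>cong \<epsilon>\<close>. Right multiplication by \<open>m\<close> permutes the cosets
  because \<open>K0\<close> normalizes \<open>cong \<delta>\<close>.\<close>

lemma exists_coset_average:
  fixes l :: "'v \<Rightarrow> complex"
  assumes \<epsilon>: "0 < \<epsilon>" "\<epsilon> \<le> 1" and \<delta>: "0 < \<delta>" "\<delta> \<le> \<epsilon>"
  obtains D where "finite D" "D \<noteq> {}" "D \<subseteq> cong \<epsilon>"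
    "\<And>v m. v \<in> carrier V \<Longrightarrow> (\<And>k. k \<in> cong \<delta> \<Longrightarrow> \<pi> k v = v) \<Longrightarrow> m \<in> cong \<epsilon> \<Longrightarrow>
      (\<Sum>k\<in>D. l (\<pi> k (\<pi> m v))) = (\<Sum>k\<in>D. l (\<pi> k v))"
proof -
  let ?K = "cong \<epsilon>" and ?L = "cong \<delta>"
  have K: "subgroup ?K Sp" and L: "subgroup ?L Sp" using \<epsilon> \<delta> by (auto intro: subgroup_cong)
  have KSp: "?K \<subseteq> carrier Sp" and LSp: "?L \<subseteq> carrier Sp" by (rule cong_Sp)+
  have LK: "?L \<subseteq> ?K" by (rule cong_mono[OF \<delta>(2)])
  have KK0: "?K \<subseteq> K0" by (rule cong_subset_K0[OF \<epsilon>(2)])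
  define C where "C k = {x \<in> carrier Sp. inv\<^bsub>Sp\<^esub> k ** x \<in> ?L}" for k
  have C_eq: "C k = C k' \<longleftrightarrow> inv\<^bsub>Sp\<^esub> k ** k' \<in> ?L" if k: "k \<in> carrier Sp" and k': "k' \<in> carrier Sp" for k k'
  proof
    assume "C k = C k'"
    moreover have "k' \<in> C k'" using k' subgroup.one_closed[OF L] by (simp add: C_def Sp_inv(1))
    ultimately show "inv\<^bsub>Sp\<^esub> k ** k' \<in> ?L" by (auto simp: C_def)
  next
    assume a: "inv\<^bsub>Sp\<^esub> k ** k' \<in> ?L"
    have eq: "inv\<^bsub>Sp\<^esub> k ** x = (inv\<^bsub>Sp\<^esub> k ** k') ** (inv\<^bsub>Sp\<^esub> k' ** x)" for x
      using Sp_inv(2)[OF k'] by (simp add: matrix_mul_assoc) (simp add: matrix_mul_assoc[symmetric])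
    have b: "inv\<^bsub>Sp\<^esub> k' ** k \<in> ?L"
      using subgroup.m_inv_closed[OF L a] Sp.inv_mult_group[OF Sp.inv_closed[OF k] k'] k by simp
    have eq': "inv\<^bsub>Sp\<^esub> k' ** x = (inv\<^bsub>Sp\<^esub> k' ** k) ** (inv\<^bsub>Sp\<^esub> k ** x)" for x
      using Sp_inv(2)[OF k] by (simp add: matrix_mul_assoc) (simp add: matrix_mul_assoc[symmetric])
    have "inv\<^bsub>Sp\<^esub> k ** x \<in> ?L \<longleftrightarrow> inv\<^bsub>Sp\<^esub> k' ** x \<in> ?L" for x
    proof
      assume "inv\<^bsub>Sp\<^esub> k ** x \<in> ?L"
      from subgroup.m_closed[OF L b this] show "inv\<^bsub>Sp\<^esub> k' ** x \<in> ?L" by (simp only: Sp_mult eq'[of x, symmetric])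
    next
      assume "inv\<^bsub>Sp\<^esub> k' ** x \<in> ?L"
      from subgroup.m_closed[OF L a this] show "inv\<^bsub>Sp\<^esub> k ** x \<in> ?L" by (simp only: Sp_mult eq[of x, symmetric])
    qed
    then show "C k = C k'" by (simp add: C_def)
  qed
  obtain \<Gamma> where \<Gamma>: "finite \<Gamma>" "\<Gamma> \<subseteq> carrier Sp" "\<And>g. g \<in> carrier Sp \<Longrightarrow> op_le g 1 \<Longrightarrow>
      \<exists>\<gamma>\<in>\<Gamma>. g ** inv\<^bsub>Sp\<^esub> \<gamma> \<in> cong \<delta> \<and> inv\<^bsub>Sp\<^esub> \<gamma> ** g \<in> cong \<delta>"
    by (rule finite_cosets[OF \<delta>(1), of 1]) blast
  have "C ` ?K \<subseteq> C ` \<Gamma>"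
  proof
    fix c assume "c \<in> C ` ?K"
    then obtain k where k: "k \<in> ?K" "c = C k" by blast
    have k': "k \<in> carrier Sp" "op_le k 1" using k(1) KK0 by (auto simp: K0_def)
    obtain \<gamma> where \<gamma>: "\<gamma> \<in> \<Gamma>" "inv\<^bsub>Sp\<^esub> \<gamma> ** k \<in> ?L" using \<Gamma>(3)[OF k'] by blast
    then have "C \<gamma> = C k" using C_eq[of \<gamma> k] k' \<Gamma>(2) by blast
    then show "c \<in> C ` \<Gamma>" using \<gamma>(1) k(2) by blast
  qed
  then have fin: "finite (C ` ?K)" using \<Gamma>(1) finite_surj by blast
  define r where "r = inv_into ?K C"
  have r: "r c \<in> ?K" "C (r c) = c" if "c \<in> C ` ?K" for c
    unfolding r_def by (rule inv_into_into[OF that], rule f_inv_into_f[OF that])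
  define D where "D = r ` (C ` ?K)"
  have inj_r: "inj_on r (C ` ?K)" unfolding r_def by (rule inj_on_inv_into) simp
  show ?thesis
  proof (rule that[of D])
    show "finite D" using fin by (simp add: D_def)
    show "D \<noteq> {}" using subgroup.one_closed[OF K] by (auto simp: D_def)
    show "D \<subseteq> ?K" using r(1) by (auto simp: D_def)
    fix v m assume v: "v \<in> carrier V" "\<And>k. k \<in> ?L \<Longrightarrow> \<pi> k v = v" and m: "m \<in> ?K"
    have mSp: "m \<in> carrier Sp" using m KSp by blast
    define \<mu> where "\<mu> c = C (r c ** m)" for c
    have rm: "r c ** m \<in> ?K" if "c \<in> C ` ?K" for c using subgroup.m_closed[OF K r(1)[OF that] m] by simp
    have \<pi>C: "\<pi> k v = \<pi> k' v" if k: "k \<in> ?K" "k' \<in> ?K" "C k = C k'" for k k'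
    proof -
      have kSp: "k \<in> carrier Sp" "k' \<in> carrier Sp" using k KSp by auto
      have L': "inv\<^bsub>Sp\<^esub> k ** k' \<in> ?L" using C_eq[OF kSp] k(3) by blast
      have "\<pi> (k \<otimes>\<^bsub>Sp\<^esub> (inv\<^bsub>Sp\<^esub> k ** k')) v = \<pi> k (\<pi> (inv\<^bsub>Sp\<^esub> k ** k') v)"
        using L' LSp kSp v(1) by (intro rep_mult) auto
      then show ?thesis by (simp add: matrix_mul_assoc Sp_inv(2)[OF kSp(1)] v(2)[OF L'])
    qed
    have "inj_on \<mu> (C ` ?K)"
    proof (rule inj_onI)
      fix c c' assume c: "c \<in> C ` ?K" "c' \<in> C ` ?K" and eq: "\<mu> c = \<mu> c'"
      have rSp: "r c \<in> carrier Sp" "r c' \<in> carrier Sp" using r(1) c KSp by auto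
      have "inv\<^bsub>Sp\<^esub> (r c ** m) ** (r c' ** m) \<in> ?L"
        using eq C_eq[of "r c ** m" "r c' ** m"] rm[OF c(1)] rm[OF c(2)] KSp by (auto simp: \<mu>_def)
      also have "inv\<^bsub>Sp\<^esub> (r c ** m) = inv\<^bsub>Sp\<^esub> m ** inv\<^bsub>Sp\<^esub> (r c)"
        using Sp.inv_mult_group[OF rSp(1) mSp] by simp
      finally have "m ** (inv\<^bsub>Sp\<^esub> m ** inv\<^bsub>Sp\<^esub> (r c) ** (r c' ** m)) ** inv\<^bsub>Sp\<^esub> m \<in> ?L"
        using cong_conj[of m] m KK0 by blast
      also have "m ** (inv\<^bsub>Sp\<^esub> m ** inv\<^bsub>Sp\<^esub> (r c) ** (r c' ** m)) ** inv\<^bsub>Sp\<^esub> m =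
          (m ** inv\<^bsub>Sp\<^esub> m) ** inv\<^bsub>Sp\<^esub> (r c) ** r c' ** (m ** inv\<^bsub>Sp\<^esub> m)" by (simp only: matrix_mul_assoc)
      also have "\<dots> = inv\<^bsub>Sp\<^esub> (r c) ** r c'" by (simp add: Sp_inv(2)[OF mSp])
      finally have "C (r c) = C (r c')" using C_eq[OF rSp] by blast
      then show "c = c'" using r(2)[OF c(1)] r(2)[OF c(2)] by simp
    qed
    moreover have "\<mu> ` (C ` ?K) \<subseteq> C ` ?K" using rm by (auto simp: \<mu>_def)
    ultimately have bij: "bij_betw \<mu> (C ` ?K) (C ` ?K)" using fin by (simp add: bij_betw_def endo_inj_surj)
    have "(\<Sum>k\<in>D. l (\<pi> k (\<pi> m v))) = (\<Sum>c\<in>C ` ?K. l (\<pi> (r c) (\<pi> m v)))"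
      unfolding D_def by (subst sum.reindex[OF inj_r]) simp
    also have "\<dots> = (\<Sum>c\<in>C ` ?K. l (\<pi> (r (\<mu> c)) v))"
    proof (rule sum.cong[OF refl])
      fix c assume c: "c \<in> C ` ?K"
      have \<mu>c: "\<mu> c \<in> C ` ?K" using rm[OF c] by (auto simp: \<mu>_def)
      have "\<pi> (r c \<otimes>\<^bsub>Sp\<^esub> m) v = \<pi> (r c) (\<pi> m v)"
        using r(1)[OF c] KSp mSp v(1) by (intro rep_mult) auto
      moreover have "\<pi> (r c ** m) v = \<pi> (r (\<mu> c)) v"
        by (rule \<pi>C[OF rm[OF c] r(1)[OF \<mu>c]]) (simp add: r(2)[OF \<mu>c], simp add: \<mu>_def)
      ultimately show "l (\<pi> (r c) (\<pi> m v)) = l (\<pi> (r (\<mu> c)) v)" by simp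
    qed
    also have "\<dots> = (\<Sum>c\<in>C ` ?K. l (\<pi> (r c) v))"
      by (rule sum.reindex_bij_betw[OF bij, of "\<lambda>c. l (\<pi> (r c) v)"])
    also have "\<dots> = (\<Sum>k\<in>D. l (\<pi> k v))"
      unfolding D_def by (subst sum.reindex[OF inj_r]) simp
    finally show "(\<Sum>k\<in>D. l (\<pi> k (\<pi> m v))) = (\<Sum>k\<in>D. l (\<pi> k v))" .
  qed
qed

text \<open>Averaging over \<open>cong \<epsilon>\<close> kills \<open>coinv \<epsilon>\<close> and
  fixes \<open>v0\<close>. A finite average is valid only on vectors fixed at its level
  \<open>\<delta>\<close>, and the level varies with the vector. So a vector counts as killed if,
  for some \<open>\<delta>\<close>, every average balanced at level \<open>\<delta>\<close> vanishes
  on it.\<close>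

lemma fixed_not_coinv:
  assumes \<epsilon>: "0 < \<epsilon>" "\<epsilon> \<le> 1" and v0: "v0 \<in> carrier V" "v0 \<noteq> \<zero>\<^bsub>V\<^esub>"
    and fixed: "\<And>k. k \<in> cong \<epsilon> \<Longrightarrow> \<pi> k v0 = v0"
  shows "v0 \<notin> coinv \<epsilon>"
proof
  assume v0c: "v0 \<in> coinv \<epsilon>"
  have "v0 \<notin> {\<zero>\<^bsub>V\<^esub>}" using v0(2) by simp
  then obtain l :: "'v \<Rightarrow> complex" where l: "l v0 = 1" "\<And>u. u \<in> {\<zero>\<^bsub>V\<^esub>} \<Longrightarrow> l u = 0"
    "\<And>v w. v \<in> carrier V \<Longrightarrow> w \<in> carrier V \<Longrightarrow> l (v \<oplus>\<^bsub>V\<^esub> w) = l v + l w"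
    "\<And>a v. v \<in> carrier V \<Longrightarrow> l (a \<odot>\<^bsub>V\<^esub> v) = a * l v"
    by (rule cm.exists_functional[OF cm.sub_zero v0(1)]) blast
  define balanced where "balanced D \<delta> \<longleftrightarrow> (\<forall>v m. v \<in> carrier V \<longrightarrow> (\<forall>k\<in>cong \<delta>. \<pi> k v = v) \<longrightarrow> m \<in> cong \<epsilon> \<longrightarrow>
      (\<Sum>k\<in>D. l (\<pi> k (\<pi> m v))) = (\<Sum>k\<in>D. l (\<pi> k v)))" for D \<delta>
  define ok where "ok u \<delta> \<longleftrightarrow> (\<forall>D. D \<subseteq> cong \<epsilon> \<longrightarrow> balanced D \<delta> \<longrightarrow> (\<Sum>k\<in>D. l (\<pi> k u)) = 0)" for u \<delta>
  \<comment> \<open>A smaller group fixes more vectors, so being balanced at a smaller level is the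
    stronger condition. Hence \<open>ok\<close> survives shrinking the level, and two vectors can be
    given a common one.\<close>
  have balanced_mono: "balanced D \<delta>" if bal: "balanced D \<delta>'" and le: "\<delta>' \<le> \<delta>" for D \<delta> \<delta>'
    unfolding balanced_def
  proof (intro allI impI)
    fix v m assume v: "v \<in> carrier V" "\<forall>k\<in>cong \<delta>. \<pi> k v = v" "m \<in> cong \<epsilon>"
    have "\<forall>k\<in>cong \<delta>'. \<pi> k v = v" using v(2) cong_mono[OF le] by blast
    then show "(\<Sum>k\<in>D. l (\<pi> k (\<pi> m v))) = (\<Sum>k\<in>D. l (\<pi> k v))"
      using bal[unfolded balanced_def, rule_format, of v m] v by blast
  qed
  have ok_mono: "ok u \<delta>'" if "ok u \<delta>" "\<delta>' \<le> \<delta>" for u \<delta> \<delta>'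
    using that(1) balanced_mono[OF _ that(2)] unfolding ok_def by blast
  define U where "U = {u \<in> carrier V. \<exists>\<delta>>0. ok u \<delta>}"
  have lin_add: "(\<Sum>k\<in>D. l (\<pi> k (v \<oplus>\<^bsub>V\<^esub> w))) = (\<Sum>k\<in>D. l (\<pi> k v)) + (\<Sum>k\<in>D. l (\<pi> k w))"
    if "D \<subseteq> cong \<epsilon>" "v \<in> carrier V" "w \<in> carrier V" for D v w
    unfolding sum.distrib[symmetric]
  proof (rule sum.cong[OF refl])
    fix k assume "k \<in> D"
    then have k: "k \<in> carrier Sp" using that(1) cong_Sp by blast
    show "l (\<pi> k (v \<oplus>\<^bsub>V\<^esub> w)) = l (\<pi> k v) + l (\<pi> k w)"
      unfolding rep_add[OF k that(2,3)] by (intro l(3) rep_closed k that)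
  qed
  have lin_scale: "(\<Sum>k\<in>D. l (\<pi> k (a \<odot>\<^bsub>V\<^esub> v))) = a * (\<Sum>k\<in>D. l (\<pi> k v))"
    if "D \<subseteq> cong \<epsilon>" "v \<in> carrier V" for D a v
    unfolding sum_distrib_left
  proof (rule sum.cong[OF refl])
    fix k assume "k \<in> D"
    then have k: "k \<in> carrier Sp" using that(1) cong_Sp by blast
    show "l (\<pi> k (a \<odot>\<^bsub>V\<^esub> v)) = a * l (\<pi> k v)"
      unfolding rep_smult[OF k that(2)] by (intro l(4) rep_closed k that)
  qed
  have "cm.sub U"
  proof (rule cm.subI)
    show "U \<subseteq> carrier V" by (auto simp: U_def)
    have "ok \<zero>\<^bsub>V\<^esub> 1" unfolding ok_def
    proof (intro allI impI sum.neutral ballI)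
      fix D k assume "D \<subseteq> cong \<epsilon>" "k \<in> D"
      then have "\<pi> k \<zero>\<^bsub>V\<^esub> = \<zero>\<^bsub>V\<^esub>" using cong_Sp[of \<epsilon>] by (intro rep_zero) blast
      then show "l (\<pi> k \<zero>\<^bsub>V\<^esub>) = 0" using l(2) by simp
    qed
    moreover have "\<zero>\<^bsub>V\<^esub> \<in> carrier V" by simp
    ultimately show "\<zero>\<^bsub>V\<^esub> \<in> U" unfolding U_def using zero_less_one by blast
  next
    fix v w assume "v \<in> U" "w \<in> U"
    then obtain \<delta> \<delta>' where *: "v \<in> carrier V" "w \<in> carrier V" "0 < \<delta>" "0 < \<delta>'" "ok v \<delta>" "ok w \<delta>'"
      unfolding U_def by blast
    have ok: "ok v (min \<delta> \<delta>')" "ok w (min \<delta> \<delta>')"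
      by (rule ok_mono[OF *(5)], simp, rule ok_mono[OF *(6)], simp)
    have "ok (v \<oplus>\<^bsub>V\<^esub> w) (min \<delta> \<delta>')" unfolding ok_def
    proof (intro allI impI)
      fix D assume D: "D \<subseteq> cong \<epsilon>" "balanced D (min \<delta> \<delta>')"
      show "(\<Sum>k\<in>D. l (\<pi> k (v \<oplus>\<^bsub>V\<^esub> w))) = 0"
        unfolding lin_add[OF D(1) *(1,2)] using ok[unfolded ok_def, rule_format, OF D] by simp
    qed
    moreover have "v \<oplus>\<^bsub>V\<^esub> w \<in> carrier V" "0 < min \<delta> \<delta>'" using *(1-4) by simp_all
    ultimately show "v \<oplus>\<^bsub>V\<^esub> w \<in> U" unfolding U_def by blast
  next
    fix a v assume "v \<in> U"
    then obtain \<delta> where *: "v \<in> carrier V" "0 < \<delta>" "ok v \<delta>" unfolding U_def by blast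
    have "ok (a \<odot>\<^bsub>V\<^esub> v) \<delta>" unfolding ok_def
    proof (intro allI impI)
      fix D assume D: "D \<subseteq> cong \<epsilon>" "balanced D \<delta>"
      show "(\<Sum>k\<in>D. l (\<pi> k (a \<odot>\<^bsub>V\<^esub> v))) = 0"
        unfolding lin_scale[OF D(1) *(1)] using *(3)[unfolded ok_def, rule_format, OF D] by simp
    qed
    moreover have "a \<odot>\<^bsub>V\<^esub> v \<in> carrier V" using *(1) by simp
    ultimately show "a \<odot>\<^bsub>V\<^esub> v \<in> U" unfolding U_def using *(2) by blast
  qed
  moreover have "\<pi> m u \<ominus>\<^bsub>V\<^esub> 1 \<odot>\<^bsub>V\<^esub> u \<in> U" if m: "m \<in> cong \<epsilon>" and u: "u \<in> carrier V" for m u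
  proof -
    have mu: "\<pi> m u \<in> carrier V" using m u cong_Sp rep_closed by blast
    obtain \<delta> where \<delta>: "0 < \<delta>" "\<And>k. k \<in> cong \<delta> \<Longrightarrow> \<pi> k u = u" by (rule exists_cong_fixing[OF u]) blast
    have "\<pi> m u \<ominus>\<^bsub>V\<^esub> 1 \<odot>\<^bsub>V\<^esub> u = \<pi> m u \<oplus>\<^bsub>V\<^esub> (-1) \<odot>\<^bsub>V\<^esub> u"
      using u by (simp add: cm.minus_eq_scale[symmetric] V.M.minus_eq)
    moreover have "ok (\<pi> m u \<oplus>\<^bsub>V\<^esub> (-1) \<odot>\<^bsub>V\<^esub> u) \<delta>" unfolding ok_def
    proof (intro allI impI)
      fix D assume D: "D \<subseteq> cong \<epsilon>" "balanced D \<delta>"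
      have "(\<Sum>k\<in>D. l (\<pi> k (\<pi> m u))) = (\<Sum>k\<in>D. l (\<pi> k u))"
        using D(2) \<delta>(2) m u unfolding balanced_def by blast
      then show "(\<Sum>k\<in>D. l (\<pi> k (\<pi> m u \<oplus>\<^bsub>V\<^esub> (-1) \<odot>\<^bsub>V\<^esub> u))) = 0"
        unfolding lin_add[OF D(1) mu cm.scale_closed[OF u]] lin_scale[OF D(1) u] by simp
    qed
    moreover have "\<pi> m u \<oplus>\<^bsub>V\<^esub> (-1) \<odot>\<^bsub>V\<^esub> u \<in> carrier V" using u mu by simp
    ultimately show ?thesis using \<delta>(1) unfolding U_def by auto
  qed
  ultimately have "coinv \<epsilon> \<subseteq> U" by (rule twisted_span_least)
  then obtain \<delta>0 where \<delta>0: "0 < \<delta>0" "ok v0 \<delta>0" using v0c unfolding U_def by blast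
  \<comment> \<open>Shrinking the level below \<open>\<epsilon>\<close> places
    \<open>cong \<delta>\<close> inside \<open>cong \<epsilon>\<close>, so that its cosets there can
    be averaged over.\<close>
  define \<delta> where "\<delta> = min \<delta>0 \<epsilon>"
  have \<delta>: "0 < \<delta>" "\<delta> \<le> \<epsilon>" using \<delta>0(1) \<epsilon> by (simp_all add: \<delta>_def)
  have ok: "ok v0 \<delta>" by (rule ok_mono[OF \<delta>0(2)]) (simp add: \<delta>_def)
  obtain D where D: "finite D" "D \<noteq> {}" "D \<subseteq> cong \<epsilon>"
    "\<And>v m. v \<in> carrier V \<Longrightarrow> (\<And>k. k \<in> cong \<delta> \<Longrightarrow> \<pi> k v = v) \<Longrightarrow> m \<in> cong \<epsilon> \<Longrightarrow>
      (\<Sum>k\<in>D. l (\<pi> k (\<pi> m v))) = (\<Sum>k\<in>D. l (\<pi> k v))"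
    by (rule exists_coset_average[OF \<epsilon> \<delta>(1,2), of l]) blast
  have "balanced D \<delta>" unfolding balanced_def using D(4) by blast
  then have "(\<Sum>k\<in>D. l (\<pi> k v0)) = 0" using ok D(3) unfolding ok_def by blast
  moreover have "(\<Sum>k\<in>D. l (\<pi> k v0)) = (\<Sum>k\<in>D. 1)"
    using D(3) fixed l(1) by (intro sum.cong) auto
  ultimately show False using D(1,2) by simp
qed

end

section \<open>Matrix coefficients and the main theorem\<close>

context symp_rep begin

section \<open>The coset space of a congruence subgroup\<close>

definition rcos :: "real \<Rightarrow> 'k ^ 4 ^ 4 \<Rightarrow> ('k ^ 4 ^ 4) set" where "rcos \<epsilon> g = cong \<epsilon> #>\<^bsub>Sp\<^esub> g"

definition rcos_space :: "real \<Rightarrow> ('k ^ 4 ^ 4) set set" where "rcos_space \<epsilon> = rcos \<epsilon> ` carrier Sp"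

abbreviation rcos_act :: "('k ^ 4 ^ 4) set \<Rightarrow> 'k ^ 4 ^ 4 \<Rightarrow> ('k ^ 4 ^ 4) set"
  where "rcos_act x g \<equiv> x #>\<^bsub>Sp\<^esub> g"

lemma rcos_act_rcos:
  assumes "g \<in> carrier Sp" "h \<in> carrier Sp" shows "rcos_act (rcos \<epsilon> g) h = rcos \<epsilon> (g ** h)"
  unfolding rcos_def using Sp.coset_mult_assoc[OF cong_Sp assms] by simp

lemma rcos_spaceE:
  assumes "x \<in> rcos_space \<epsilon>" obtains g where "g \<in> carrier Sp" "x = rcos \<epsilon> g"
  using assms unfolding rcos_space_def by blast

lemma rcos_in_space: "g \<in> carrier Sp \<Longrightarrow> rcos \<epsilon> g \<in> rcos_space \<epsilon>"
  unfolding rcos_space_def by blast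

lemma Sp_closed: "g \<in> carrier Sp \<Longrightarrow> h \<in> carrier Sp \<Longrightarrow> g ** h \<in> carrier Sp"
  using Sp.m_closed[of g h] by simp

lemma right_action_rcos: "right_action Sp (rcos_space \<epsilon>) rcos_act"
proof (intro right_action.intro right_action_axioms.intro group_Sp)
  fix x g assume x: "x \<in> rcos_space \<epsilon>" and g: "g \<in> carrier Sp"
  obtain h where h: "h \<in> carrier Sp" "x = rcos \<epsilon> h" by (rule rcos_spaceE[OF x])
  show "rcos_act x g \<in> rcos_space \<epsilon>"
    unfolding h(2) rcos_act_rcos[OF h(1) g] by (rule rcos_in_space[OF Sp_closed[OF h(1) g]])
  show "rcos_act x (g \<otimes>\<^bsub>Sp\<^esub> k) = rcos_act (rcos_act x g) k" if k: "k \<in> carrier Sp" for k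
    unfolding h(2) Sp_mult rcos_act_rcos[OF h(1) g] rcos_act_rcos[OF Sp_closed[OF h(1) g] k]
      rcos_act_rcos[OF h(1) Sp_closed[OF g k]] by (simp only: matrix_mul_assoc)
next
  fix x assume x: "x \<in> rcos_space \<epsilon>"
  obtain h where h: "h \<in> carrier Sp" "x = rcos \<epsilon> h" by (rule rcos_spaceE[OF x])
  have one: "mat 1 \<in> carrier Sp" using Sp.one_closed by simp
  show "rcos_act x \<one>\<^bsub>Sp\<^esub> = x" unfolding h(2) Sp_one rcos_act_rcos[OF h(1) one] by simp
qed

lemma right_action_rcos_J: "right_action (J_group B e) (rcos_space \<epsilon>) rcos_act"
proof -
  interpret A: right_action Sp "rcos_space \<epsilon>" rcos_act by (rule right_action_rcos)
  have J: "group (J_group B e)" unfolding J_group_eq by (rule subgroup.subgroup_is_group[OF J_subgroup group_Sp])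
  show ?thesis
  proof (intro right_action.intro right_action_axioms.intro J)
    show "rcos_act x g \<in> rcos_space \<epsilon>" if "x \<in> rcos_space \<epsilon>" "g \<in> carrier (J_group B e)" for x g
      using that A.act_closed by (simp add: J_carrier)
    show "rcos_act x \<one>\<^bsub>J_group B e\<^esub> = x" if "x \<in> rcos_space \<epsilon>" for x
      using that A.act_one by (simp add: J_group_eq)
    show "rcos_act x (g \<otimes>\<^bsub>J_group B e\<^esub> h) = rcos_act (rcos_act x g) h"
      if "x \<in> rcos_space \<epsilon>" "g \<in> carrier (J_group B e)" "h \<in> carrier (J_group B e)" for x g h
    proof -
      have "rcos_act x (g \<otimes>\<^bsub>Sp\<^esub> h) = rcos_act (rcos_act x g) h"
        using that by (intro A.act_mult) (simp_all add: J_carrier)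
      then show ?thesis by (simp add: J_group_eq)
    qed
  qed
qed

context
  fixes \<epsilon> :: real assumes \<epsilon>: "0 < \<epsilon>" "\<epsilon> \<le> 1"
begin

lemma cong_group: "subgroup (cong \<epsilon>) Sp"
  by (rule subgroup_cong) (use \<epsilon> in auto)

lemma rcos_eq:
  assumes "g \<in> carrier Sp" "h \<in> carrier Sp" "g ** inv\<^bsub>Sp\<^esub> h \<in> cong \<epsilon>"
  shows "rcos \<epsilon> g = rcos \<epsilon> h"
proof -
  have "rcos \<epsilon> (g ** inv\<^bsub>Sp\<^esub> h) = cong \<epsilon>"
    unfolding rcos_def using Sp.coset_join2[OF _ cong_group assms(3)] cong_Sp assms(3) by blast
  then have "rcos_act (cong \<epsilon>) h = rcos_act (rcos \<epsilon> (g ** inv\<^bsub>Sp\<^esub> h)) h" by simp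
  also have "\<dots> = rcos \<epsilon> ((g ** inv\<^bsub>Sp\<^esub> h) ** h)"
    using assms by (intro rcos_act_rcos Sp_closed Sp.inv_closed)
  also have "(g ** inv\<^bsub>Sp\<^esub> h) ** h = g" by (simp add: matrix_mul_assoc[symmetric] Sp_inv(1)[OF assms(2)])
  finally show ?thesis by (simp add: rcos_def)
qed

lemma rcos_eqD:
  assumes "g \<in> carrier Sp" "h \<in> carrier Sp" "rcos \<epsilon> g = rcos \<epsilon> h"
  obtains k where "k \<in> cong \<epsilon>" "g = k ** h"
proof -
  have "g \<in> rcos \<epsilon> g" unfolding rcos_def by (rule Sp.rcos_self[OF assms(1) cong_group])
  then have "g \<in> rcos \<epsilon> h" by (simp only: assms(3))
  then show ?thesis unfolding rcos_def r_coset_def Sp_mult using that by blast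
qed

lemma finite_rcos_ball: "finite {rcos \<epsilon> g | g. g \<in> carrier Sp \<and> op_le g R}"
proof -
  obtain \<Gamma> where \<Gamma>: "finite \<Gamma>" "\<Gamma> \<subseteq> carrier Sp" "\<And>g. g \<in> carrier Sp \<Longrightarrow> op_le g R \<Longrightarrow>
      \<exists>\<gamma>\<in>\<Gamma>. g ** inv\<^bsub>Sp\<^esub> \<gamma> \<in> cong \<epsilon> \<and> inv\<^bsub>Sp\<^esub> \<gamma> ** g \<in> cong \<epsilon>"
    by (rule finite_cosets[OF \<epsilon>(1), of R]) blast
  have "{rcos \<epsilon> g | g. g \<in> carrier Sp \<and> op_le g R} \<subseteq> rcos \<epsilon> ` \<Gamma>"
  proof clarify
    fix g assume g: "g \<in> carrier Sp" "op_le g R"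
    obtain \<gamma> where \<gamma>: "\<gamma> \<in> \<Gamma>" "g ** inv\<^bsub>Sp\<^esub> \<gamma> \<in> cong \<epsilon>" using \<Gamma>(3)[OF g] by blast
    have "rcos \<epsilon> g = rcos \<epsilon> \<gamma>" by (rule rcos_eq[OF g(1) _ \<gamma>(2)]) (use \<gamma>(1) \<Gamma>(2) in blast)
    then show "rcos \<epsilon> g \<in> rcos \<epsilon> ` \<Gamma>" using \<gamma>(1) by blast
  qed
  then show ?thesis using \<Gamma>(1) finite_surj by blast
qed

text \<open>Fixing the coset of a means a g = k a with k in \<open>cong \<epsilon>\<close>. Then b g
  = (b a^-1) k a is bounded independently of g, and a bounded set meets finitely many
  cosets.\<close>

lemma finite_suborbits:
  assumes x: "x \<in> rcos_space \<epsilon>" and y: "y \<in> rcos_space \<epsilon>"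
  shows "finite {rcos_act y g | g. g \<in> carrier Sp \<and> rcos_act x g = x}"
proof -
  obtain a where a: "a \<in> carrier Sp" "x = rcos \<epsilon> a" by (rule rcos_spaceE[OF x])
  obtain b where b: "b \<in> carrier Sp" "y = rcos \<epsilon> b" by (rule rcos_spaceE[OF y])
  obtain ra where ra: "op_le a ra" by (rule exists_op_le)
  obtain ri where ri: "op_le (b ** inv\<^bsub>Sp\<^esub> a) ri" by (rule exists_op_le)
  have "{rcos_act y g | g. g \<in> carrier Sp \<and> rcos_act x g = x} \<subseteq>
      {rcos \<epsilon> g | g. g \<in> carrier Sp \<and> op_le g (ri * (1 * ra))}"
  proof clarify
    fix g assume g: "g \<in> carrier Sp" and fixed: "rcos_act x g = x"
    have "rcos \<epsilon> (a ** g) = rcos \<epsilon> a" using fixed unfolding a(2) rcos_act_rcos[OF a(1) g] .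
    then obtain k where k: "k \<in> cong \<epsilon>" "a ** g = k ** a" by (rule rcos_eqD[OF Sp_closed[OF a(1) g] a(1)])
    have "op_le k 1" using k(1) cong_subset_K0[OF \<epsilon>(2)] unfolding K0_def by blast
    then have "op_le ((b ** inv\<^bsub>Sp\<^esub> a) ** (k ** a)) (ri * (1 * ra))" by (intro op_le_mult ri ra)
    moreover have "(b ** inv\<^bsub>Sp\<^esub> a) ** (k ** a) = b ** (inv\<^bsub>Sp\<^esub> a ** a) ** g"
      unfolding k(2)[symmetric] by (simp only: matrix_mul_assoc)
    ultimately have "op_le (b ** g) (ri * (1 * ra))" by (simp add: Sp_inv(1)[OF a(1)])
    then show "\<exists>g'. rcos_act y g = rcos \<epsilon> g' \<and> g' \<in> carrier Sp \<and> op_le g' (ri * (1 * ra))"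
      unfolding b(2) rcos_act_rcos[OF b(1) g] using Sp_closed[OF b(1) g] by blast
  qed
  then show ?thesis by (rule finite_subset) (rule finite_rcos_ball)
qed

section \<open>Embedding by matrix coefficients\<close>

context
  fixes l :: "'v \<Rightarrow> complex" and v0 :: 'v
  assumes l_add: "\<And>v w. v \<in> carrier V \<Longrightarrow> w \<in> carrier V \<Longrightarrow> l (v \<oplus>\<^bsub>V\<^esub> w) = l v + l w"
    and l_scale: "\<And>a v. v \<in> carrier V \<Longrightarrow> l (a \<odot>\<^bsub>V\<^esub> v) = a * l v"
    and l_coinv: "\<And>u. u \<in> coinv \<epsilon> \<Longrightarrow> l u = 0"
    and v0: "v0 \<in> carrier V" "l v0 = 1"
    and sc: "supercuspidal B V \<pi>"
begin

text \<open>The matrix coefficients \<open>g \<mapsto> l (g v)\<close>, as functions on the right cosets of \<open>cong \<epsilon>\<close>.\<close>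

definition coef :: "'v \<Rightarrow> ('k ^ 4 ^ 4) set \<Rightarrow> complex"
  where "coef v x = (if x \<in> rcos_space \<epsilon> then l (\<pi> (SOME g. g \<in> carrier Sp \<and> x = rcos \<epsilon> g) v) else 0)"

lemma l_cong:
  assumes k: "k \<in> cong \<epsilon>" and v: "v \<in> carrier V" shows "l (\<pi> k v) = l v"
proof -
  have kSp: "k \<in> carrier Sp" using k cong_Sp by blast
  have kv: "\<pi> k v \<in> carrier V" by (rule rep_closed[OF kSp v])
  have "\<pi> k v \<ominus>\<^bsub>V\<^esub> 1 \<odot>\<^bsub>V\<^esub> v \<in> coinv \<epsilon>" by (rule twisted_span_gen[OF k v])
  then have "l (\<pi> k v \<ominus>\<^bsub>V\<^esub> 1 \<odot>\<^bsub>V\<^esub> v) = 0" by (rule l_coinv)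
  moreover have "\<pi> k v \<ominus>\<^bsub>V\<^esub> 1 \<odot>\<^bsub>V\<^esub> v = \<pi> k v \<oplus>\<^bsub>V\<^esub> (-1) \<odot>\<^bsub>V\<^esub> v"
    using v by (simp add: cm.minus_eq_scale[symmetric] V.M.minus_eq)
  ultimately have "l (\<pi> k v) + (-1) * l v = 0"
    using l_add[OF kv cm.scale_closed[OF v]] l_scale[OF v] by simp
  then show ?thesis by simp
qed

text \<open>The representative chosen in \<open>coef\<close> differs from \<open>g\<close> by a left
  factor in \<open>cong \<epsilon>\<close>, to which \<open>l\<close> is insensitive.\<close>

lemma coef_rcos:
  assumes g: "g \<in> carrier Sp" and v: "v \<in> carrier V" shows "coef v (rcos \<epsilon> g) = l (\<pi> g v)"
proof -
  let ?h = "SOME h. h \<in> carrier Sp \<and> rcos \<epsilon> g = rcos \<epsilon> h"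
  have h: "?h \<in> carrier Sp \<and> rcos \<epsilon> g = rcos \<epsilon> ?h" by (rule someI[of _ g]) (use g in simp)
  then obtain k where k: "k \<in> cong \<epsilon>" "g = k ** ?h" using rcos_eqD[OF g, of ?h] by blast
  have hSp: "?h \<in> carrier Sp" using h by blast
  have "\<pi> (k \<otimes>\<^bsub>Sp\<^esub> ?h) v = \<pi> k (\<pi> ?h v)" using k(1) cong_Sp by (intro rep_mult hSp v) blast
  then have "\<pi> g v = \<pi> k (\<pi> ?h v)" unfolding Sp_mult k(2)[symmetric] .
  then have "l (\<pi> g v) = l (\<pi> ?h v)" using l_cong[OF k(1) rep_closed[OF hSp v]] by simp
  then show ?thesis by (simp add: coef_def rcos_in_space[OF g])
qed

lemma coef_ext:
  assumes "\<And>x. x \<notin> rcos_space \<epsilon> \<Longrightarrow> f x = 0" "v \<in> carrier V"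
    "\<And>g. g \<in> carrier Sp \<Longrightarrow> f (rcos \<epsilon> g) = l (\<pi> g v)"
  shows "f = coef v"
proof
  fix x
  show "f x = coef v x"
  proof (cases "x \<in> rcos_space \<epsilon>")
    case True
    obtain g where g: "g \<in> carrier Sp" "x = rcos \<epsilon> g" by (rule rcos_spaceE[OF True])
    show ?thesis unfolding g(2) coef_rcos[OF g(1) assms(2)] by (rule assms(3)[OF g(1)])
  qed (simp add: assms(1) coef_def)
qed

lemma coef_add:
  assumes "v \<in> carrier V" "w \<in> carrier V" shows "coef v + coef w = coef (v \<oplus>\<^bsub>V\<^esub> w)"
proof (rule coef_ext)
  fix g assume g: "g \<in> carrier Sp"
  show "(coef v + coef w) (rcos \<epsilon> g) = l (\<pi> g (v \<oplus>\<^bsub>V\<^esub> w))"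
    using g assms rep_closed by (simp add: coef_rcos rep_add l_add)
qed (use assms in \<open>simp_all add: coef_def\<close>)

lemma coef_scale:
  assumes "v \<in> carrier V" shows "a *\<^sub>f coef v = coef (a \<odot>\<^bsub>V\<^esub> v)"
proof (rule coef_ext)
  fix g assume g: "g \<in> carrier Sp"
  show "(a *\<^sub>f coef v) (rcos \<epsilon> g) = l (\<pi> g (a \<odot>\<^bsub>V\<^esub> v))"
    using g assms rep_closed by (simp add: coef_rcos rep_smult l_scale)
qed (use assms in \<open>simp_all add: coef_def\<close>)

lemma coef_zero: "coef \<zero>\<^bsub>V\<^esub> = 0"
  using coef_scale[of "\<zero>\<^bsub>V\<^esub>" 0] by simp

interpretation A: right_action Sp "rcos_space \<epsilon>" rcos_act by (rule right_action_rcos)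

lemma coef_R:
  assumes g: "g \<in> carrier Sp" and v: "v \<in> carrier V" shows "A.R g (coef v) = coef (\<pi> g v)"
proof (rule coef_ext)
  fix h assume h: "h \<in> carrier Sp"
  have "\<pi> (h \<otimes>\<^bsub>Sp\<^esub> g) v = \<pi> h (\<pi> g v)" by (rule rep_mult[OF h g v])
  then show "A.R g (coef v) (rcos \<epsilon> h) = l (\<pi> h (\<pi> g v))"
    by (simp add: A.R_def rcos_in_space[OF h] rcos_act_rcos[OF h g] coef_rcos[OF Sp_closed[OF h g] v])
qed (use g v rep_closed in \<open>simp_all add: A.R_def\<close>)

lemma coef_finsupp:
  assumes v: "v \<in> carrier V" shows "coef v \<in> A.F"
proof -
  obtain R where R: "\<And>g. g \<in> carrier Sp \<Longrightarrow> \<not> op_le g R \<Longrightarrow> \<pi> g v \<in> coinv \<epsilon>"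
    using supercuspidal_compact[OF sc \<epsilon>(1) v] by blast
  show ?thesis
  proof (rule finsuppI[OF finite_rcos_ball[of R]])
    show "{rcos \<epsilon> g | g. g \<in> carrier Sp \<and> op_le g R} \<subseteq> rcos_space \<epsilon>" using rcos_in_space by blast
    fix x assume x: "x \<notin> {rcos \<epsilon> g | g. g \<in> carrier Sp \<and> op_le g R}"
    show "coef v x = 0"
    proof (cases "x \<in> rcos_space \<epsilon>")
      case True
      obtain g where g: "g \<in> carrier Sp" "x = rcos \<epsilon> g" by (rule rcos_spaceE[OF True])
      then have "\<not> op_le g R" using x by blast
      then show ?thesis unfolding g(2) coef_rcos[OF g(1) v] by (rule l_coinv[OF R[OF g(1)]])
    qed (simp add: coef_def)
  qed
qed

lemma irreducible: "subrep Sp V \<pi> W \<Longrightarrow> W = {\<zero>\<^bsub>V\<^esub>} \<or> W = carrier V"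
  using sc by (simp add: supercuspidal_def irreducible_rep_def)

lemma v0_nonzero: "v0 \<noteq> \<zero>\<^bsub>V\<^esub>"
  using v0 l_scale[of "\<zero>\<^bsub>V\<^esub>" 0] by auto

lemma subrepI:
  assumes "cm.sub W" "\<And>g w. g \<in> carrier Sp \<Longrightarrow> w \<in> W \<Longrightarrow> \<pi> g w \<in> W" shows "subrep Sp V \<pi> W"
  using assms by (simp add: subrep_def)

text \<open>The kernel of \<open>coef\<close> is a subrepresentation, and it omits
  \<open>v0\<close>, whose coefficient at the trivial coset is \<open>l v0\<close>; irreducibility
  does the rest.\<close>

lemma coef_inj:
  assumes "u \<in> carrier V" "w \<in> carrier V" "coef u = coef w" shows "u = w"
proof -
  define N where "N = {v \<in> carrier V. coef v = 0}"
  have "subrep Sp V \<pi> N"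
  proof (intro subrepI cm.subI)
    show "\<zero>\<^bsub>V\<^esub> \<in> N" by (simp add: N_def coef_zero)
  next
    fix v w assume "v \<in> N" "w \<in> N"
    then show "v \<oplus>\<^bsub>V\<^esub> w \<in> N" using coef_add[of v w] by (simp add: N_def)
  next
    fix a v assume "v \<in> N"
    then have "v \<in> carrier V" "coef v = 0" by (simp_all add: N_def)
    moreover have "a *\<^sub>f 0 = (0 :: ('k ^ 4 ^ 4) set \<Rightarrow> complex)" by (simp add: fun_eq_iff)
    ultimately show "a \<odot>\<^bsub>V\<^esub> v \<in> N" using coef_scale[of v a] by (simp add: N_def)
  next
    fix g v assume "g \<in> carrier Sp" "v \<in> N"
    then show "\<pi> g v \<in> N" using coef_R[of g v] rep_closed by (simp add: N_def A.R_zero)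
  qed (simp add: N_def)
  moreover have "v0 \<notin> N"
  proof -
    have one: "mat 1 \<in> carrier Sp" using Sp.one_closed by simp
    have "coef v0 (rcos \<epsilon> (mat 1)) = 1"
      unfolding coef_rcos[OF one v0(1)] using rep_one[OF v0(1)] v0(2) by simp
    then show ?thesis by (auto simp: N_def)
  qed
  ultimately have N: "N = {\<zero>\<^bsub>V\<^esub>}" using irreducible v0(1) by blast
  have "coef (u \<oplus>\<^bsub>V\<^esub> (-1) \<odot>\<^bsub>V\<^esub> w) = coef u + (-1) *\<^sub>f coef w"
    using assms(1,2) by (simp add: coef_add coef_scale)
  also have "\<dots> = 0" unfolding assms(3) by (simp add: fun_eq_iff)
  finally have "u \<oplus>\<^bsub>V\<^esub> (-1) \<odot>\<^bsub>V\<^esub> w \<in> N" using assms by (simp add: N_def)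
  then have "u \<ominus>\<^bsub>V\<^esub> w = \<zero>\<^bsub>V\<^esub>" using assms unfolding N by (simp add: cm.minus_eq_scale V.M.minus_eq)
  moreover have "u \<ominus>\<^bsub>V\<^esub> w \<oplus>\<^bsub>V\<^esub> w = u" by (rule cm.diff_add_cancel[OF assms(1,2)])
  ultimately show ?thesis using assms(2) by simp
qed

text \<open>Translation of functions does not depend on the group, so one statement serves for Sp(4)
  and for the stabilizer of a vector.\<close>

lemma coef_image_stable:
  assumes J: "right_action J (rcos_space \<epsilon>) rcos_act" "carrier J \<subseteq> carrier Sp"
    and W: "cm.sub W" "\<And>g w. g \<in> carrier J \<Longrightarrow> w \<in> W \<Longrightarrow> \<pi> g w \<in> W"
  shows "right_action.stable J (rcos_space \<epsilon>) rcos_act (coef ` W)"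
proof -
  interpret J: right_action J "rcos_space \<epsilon>" rcos_act by (rule J(1))
  note W' = cm.subD[OF W(1)]
  show ?thesis
  proof (rule J.stableI)
    show "0 \<in> coef ` W" using W'(2) coef_zero by (metis imageI)
  next
    fix f h assume "f \<in> coef ` W" "h \<in> coef ` W"
    then obtain v w where vw: "v \<in> W" "w \<in> W" "f = coef v" "h = coef w" by blast
    have "f + h = coef (v \<oplus>\<^bsub>V\<^esub> w)" unfolding vw(3,4) by (rule coef_add) (use vw W'(1) in auto)
    then show "f + h \<in> coef ` W" using W'(3)[OF vw(1,2)] by blast
  next
    fix c f assume "f \<in> coef ` W"
    then obtain v where v: "v \<in> W" "f = coef v" by blast
    have "c *\<^sub>f f = coef (c \<odot>\<^bsub>V\<^esub> v)" unfolding v(2) by (rule coef_scale) (use v W'(1) in auto)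
    then show "c *\<^sub>f f \<in> coef ` W" using W'(4)[OF v(1)] by blast
  next
    fix g f assume g: "g \<in> carrier J" and "f \<in> coef ` W"
    then obtain v where v: "v \<in> W" "f = coef v" by blast
    have "A.R g f = coef (\<pi> g v)" unfolding v(2) by (rule coef_R) (use g J(2) v W'(1) in auto)
    then show "A.R g f \<in> coef ` W" using W(2)[OF g v(1)] by blast
  qed
qed

text \<open>The coinvariants are spanned by finitely many translates of \<open>v0\<close>: by
  compactness all unbounded translates die there, the bounded ones fall into finitely many right
  cosets, and by irreducibility the translates of \<open>v0\<close> span everything.\<close>

lemma projection_coef:
  obtains e where "A.ghom e" "e ` A.F \<subseteq> coef ` carrier V" "\<And>f. f \<in> coef ` carrier V \<Longrightarrow> e f = f"
proof -
  let ?E = "coef ` carrier V"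
  have one: "mat 1 \<in> carrier Sp" using Sp.one_closed by simp
  define x0 where "x0 = rcos \<epsilon> (mat 1)"
  have x0: "x0 \<in> rcos_space \<epsilon>" unfolding x0_def by (rule rcos_in_space[OF one])
  define K where "K = {g \<in> carrier Sp. rcos_act x0 g = x0}"
  have x0_act: "rcos_act x0 g = rcos \<epsilon> g" if "g \<in> carrier Sp" for g
    unfolding x0_def rcos_act_rcos[OF one that] by simp
  have cong_K: "cong \<epsilon> \<subseteq> K"
  proof
    fix k assume k: "k \<in> cong \<epsilon>"
    then have kSp: "k \<in> carrier Sp" using cong_Sp by blast
    have "rcos \<epsilon> k = rcos \<epsilon> (mat 1)"
      by (rule rcos_eq[OF kSp one]) (use k Sp.inv_one in simp)
    then show "k \<in> K" using kSp x0_act[OF kSp] by (simp add: K_def x0_def)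
  qed
  obtain R0 where R0: "\<And>g. g \<in> carrier Sp \<Longrightarrow> \<not> op_le g R0 \<Longrightarrow> \<pi> g v0 \<in> coinv \<epsilon>"
    using supercuspidal_compact[OF sc \<epsilon>(1) v0(1)] by blast
  obtain \<Gamma> where \<Gamma>: "finite \<Gamma>" "\<Gamma> \<subseteq> carrier Sp" "\<And>g. g \<in> carrier Sp \<Longrightarrow> op_le g R0 \<Longrightarrow>
      \<exists>\<gamma>\<in>\<Gamma>. g ** inv\<^bsub>Sp\<^esub> \<gamma> \<in> cong \<epsilon> \<and> inv\<^bsub>Sp\<^esub> \<gamma> ** g \<in> cong \<epsilon>"
    by (rule finite_cosets[OF \<epsilon>(1), of R0]) blast
  define Bs where "Bs = (\<lambda>\<gamma>. coef (\<pi> \<gamma> v0)) ` \<Gamma>"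
  have "\<exists>e. A.ghom e \<and> e ` A.F \<subseteq> ?E \<and> (\<forall>f\<in>?E. e f = f)"
  proof (rule A.exists_projection[OF x0 _ K_def])
    show "\<exists>g\<in>carrier Sp. rcos_act x0 g = x" if x: "x \<in> rcos_space \<epsilon>" for x
    proof -
      obtain g where g: "g \<in> carrier Sp" "x = rcos \<epsilon> g" by (rule rcos_spaceE[OF x])
      then show ?thesis using x0_act by blast
    qed
    show "finite {rcos_act y g | g. g \<in> K}" if "y \<in> rcos_space \<epsilon>" for y
      using finite_suborbits[OF x0 that] by (simp add: K_def)
    show "A.stable ?E"
      by (rule coef_image_stable[OF right_action_rcos subset_refl cm.sub_carrier]) (rule rep_closed)
    show "?E \<subseteq> A.F" using coef_finsupp by blast
    show "finite Bs" using \<Gamma>(1) by (simp add: Bs_def)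
    show "Bs \<subseteq> ?E" using \<Gamma>(2) rep_closed v0(1) by (auto simp: Bs_def)
    fix U assume U: "fsubspace U" "Bs \<subseteq> U" "\<And>k f. k \<in> K \<Longrightarrow> f \<in> ?E \<Longrightarrow> A.R k f - f \<in> U"
    note U' = fsubspaceD[OF U(1)]
    have subU: "cm.sub {u \<in> carrier V. coef u \<in> U}"
    proof (rule cm.subI)
      show "\<zero>\<^bsub>V\<^esub> \<in> {u \<in> carrier V. coef u \<in> U}" using U'(1) by (simp add: coef_zero)
    next
      fix v w assume "v \<in> {u \<in> carrier V. coef u \<in> U}" "w \<in> {u \<in> carrier V. coef u \<in> U}"
      then show "v \<oplus>\<^bsub>V\<^esub> w \<in> {u \<in> carrier V. coef u \<in> U}" using U'(2)[of "coef v" "coef w"] by (simp add: coef_add)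
    next
      fix a v assume "v \<in> {u \<in> carrier V. coef u \<in> U}"
      then show "a \<odot>\<^bsub>V\<^esub> v \<in> {u \<in> carrier V. coef u \<in> U}" using U'(3)[of "coef v" a] by (simp add: coef_scale)
    qed simp
    have diffU: "coef (\<pi> k u) - coef u \<in> U" if k: "k \<in> cong \<epsilon>" and u: "u \<in> carrier V" for k u
    proof -
      have "A.R k (coef u) - coef u \<in> U" by (rule U(3)) (use k u cong_K in auto)
      moreover have "A.R k (coef u) = coef (\<pi> k u)" by (rule coef_R) (use k u cong_Sp in auto)
      ultimately show ?thesis by simp
    qed
    have "coinv \<epsilon> \<subseteq> {u \<in> carrier V. coef u \<in> U}"
    proof (rule twisted_span_least[OF subU])
      fix k u assume k: "k \<in> cong \<epsilon>" and u: "u \<in> carrier V"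
      have ku: "\<pi> k u \<in> carrier V" using k cong_Sp u rep_closed by blast
      have "coef (\<pi> k u \<oplus>\<^bsub>V\<^esub> (-1) \<odot>\<^bsub>V\<^esub> u) = coef (\<pi> k u) + (-1) *\<^sub>f coef u"
        using ku u by (simp add: coef_add coef_scale)
      also have "\<dots> = coef (\<pi> k u) - coef u" by (simp add: fun_eq_iff)
      finally have "coef (\<pi> k u \<oplus>\<^bsub>V\<^esub> (-1) \<odot>\<^bsub>V\<^esub> u) \<in> U" using diffU[OF k u] by simp
      moreover have "\<pi> k u \<oplus>\<^bsub>V\<^esub> (-1) \<odot>\<^bsub>V\<^esub> u = \<pi> k u \<ominus>\<^bsub>V\<^esub> 1 \<odot>\<^bsub>V\<^esub> u"
        using u by (simp add: cm.minus_eq_scale[symmetric] V.M.minus_eq)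
      ultimately show "\<pi> k u \<ominus>\<^bsub>V\<^esub> 1 \<odot>\<^bsub>V\<^esub> u \<in> {u \<in> carrier V. coef u \<in> U}" using ku u by simp
    qed
    then have coinvU: "coef u \<in> U" if "u \<in> coinv \<epsilon>" for u using that by blast
    \<comment> \<open>Asking for all translates turns the preimage of \<open>U\<close> into a
      subrepresentation; containing \<open>v0\<close>, it is everything.\<close>
    define UU where "UU = {u \<in> carrier V. \<forall>g\<in>carrier Sp. coef (\<pi> g u) \<in> U}"
    have "subrep Sp V \<pi> UU"
    proof (intro subrepI cm.subI)
      show "\<zero>\<^bsub>V\<^esub> \<in> UU" using U'(1) by (simp add: UU_def coef_zero)
    next
      fix v w assume vw: "v \<in> UU" "w \<in> UU"
      have "coef (\<pi> g (v \<oplus>\<^bsub>V\<^esub> w)) \<in> U" if g: "g \<in> carrier Sp" for g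
        using vw g U'(2)[of "coef (\<pi> g v)" "coef (\<pi> g w)"] rep_closed
        by (simp add: UU_def coef_add rep_add)
      then show "v \<oplus>\<^bsub>V\<^esub> w \<in> UU" using vw by (simp add: UU_def)
    next
      fix a v assume v: "v \<in> UU"
      have "coef (\<pi> g (a \<odot>\<^bsub>V\<^esub> v)) \<in> U" if g: "g \<in> carrier Sp" for g
        using v g U'(3)[of "coef (\<pi> g v)" a] rep_closed by (simp add: UU_def coef_scale rep_smult)
      then show "a \<odot>\<^bsub>V\<^esub> v \<in> UU" using v by (simp add: UU_def)
    next
      fix h v assume h: "h \<in> carrier Sp" and v: "v \<in> UU"
      have "coef (\<pi> g (\<pi> h v)) \<in> U" if g: "g \<in> carrier Sp" for g
      proof -
        have "\<pi> (g \<otimes>\<^bsub>Sp\<^esub> h) v = \<pi> g (\<pi> h v)" using v by (intro rep_mult g h) (simp add: UU_def)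
        moreover have "coef (\<pi> (g \<otimes>\<^bsub>Sp\<^esub> h) v) \<in> U" using v Sp.m_closed[OF g h] by (simp only: UU_def) blast
        ultimately show ?thesis by simp
      qed
      then show "\<pi> h v \<in> UU" using v rep_closed[OF h] by (simp add: UU_def)
    qed (auto simp: UU_def)
    moreover have "v0 \<in> UU"
    proof -
      have "coef (\<pi> g v0) \<in> U" if g: "g \<in> carrier Sp" for g
      proof (cases "op_le g R0")
        case True
        obtain \<gamma> where \<gamma>: "\<gamma> \<in> \<Gamma>" "g ** inv\<^bsub>Sp\<^esub> \<gamma> \<in> cong \<epsilon>" using \<Gamma>(3)[OF g True] by blast
        have \<gamma>Sp: "\<gamma> \<in> carrier Sp" using \<gamma>(1) \<Gamma>(2) by blast
        let ?k = "g ** inv\<^bsub>Sp\<^esub> \<gamma>"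
        have "\<pi> (?k \<otimes>\<^bsub>Sp\<^esub> \<gamma>) v0 = \<pi> ?k (\<pi> \<gamma> v0)"
          using \<gamma>(2) cong_Sp by (intro rep_mult \<gamma>Sp v0(1)) blast
        then have "\<pi> g v0 = \<pi> ?k (\<pi> \<gamma> v0)"
          by (simp add: matrix_mul_assoc[symmetric] Sp_inv(1)[OF \<gamma>Sp])
        moreover have "coef (\<pi> \<gamma> v0) \<in> U" using \<gamma>(1) U(2) by (auto simp: Bs_def)
        moreover have "coef (\<pi> ?k (\<pi> \<gamma> v0)) - coef (\<pi> \<gamma> v0) \<in> U"
          by (rule diffU[OF \<gamma>(2) rep_closed[OF \<gamma>Sp v0(1)]])
        ultimately have "(coef (\<pi> g v0) - coef (\<pi> \<gamma> v0)) + coef (\<pi> \<gamma> v0) \<in> U" by (intro U'(2)) simp_all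
        then show ?thesis by simp
      next
        case False
        then show ?thesis using R0[OF g] coinvU by blast
      qed
      then show ?thesis using v0(1) by (simp add: UU_def)
    qed
    ultimately have UU: "UU = carrier V" using irreducible v0_nonzero by blast
    show "?E \<subseteq> U"
    proof
      fix f assume "f \<in> ?E"
      then obtain u where u: "u \<in> carrier V" "f = coef u" by blast
      have "u \<in> UU" using u(1) by (simp only: UU)
      then have "coef (\<pi> (mat 1) u) \<in> U" using one unfolding UU_def by blast
      then show "f \<in> U" using rep_one[OF u(1)] u(2) by simp
    qed
  qed
  then show ?thesis using that by blast
qed

text \<open>The quotient by this subspace is the twisted Jacquet module of the permutation representation.\<close>

definition fspan :: "('k ^ 4 ^ 4) set \<Rightarrow> ('k ^ 4 ^ 4 \<Rightarrow> complex) \<Rightarrow> (('k ^ 4 ^ 4) set \<Rightarrow> complex) set"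
  where "fspan Z \<psi> = \<Inter>{U. fsubspace U \<and> (\<forall>z\<in>Z. \<forall>f\<in>A.F. A.R z f - \<psi> z *\<^sub>f f \<in> U)}"

lemma fspan_subspace: "fsubspace (fspan Z \<psi>)"
  unfolding fspan_def fsubspace_def by blast

lemma fspan_gen: "z \<in> Z \<Longrightarrow> f \<in> A.F \<Longrightarrow> A.R z f - \<psi> z *\<^sub>f f \<in> fspan Z \<psi>"
  unfolding fspan_def by blast

lemma fspan_least:
  assumes "fsubspace U" "\<And>z f. z \<in> Z \<Longrightarrow> f \<in> A.F \<Longrightarrow> A.R z f - \<psi> z *\<^sub>f f \<in> U"
  shows "fspan Z \<psi> \<subseteq> U"
  using assms unfolding fspan_def by blast

lemma coef_gen:
  assumes z: "z \<in> carrier Sp" and u: "u \<in> carrier V"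
  shows "coef (\<pi> z u \<ominus>\<^bsub>V\<^esub> \<psi> z \<odot>\<^bsub>V\<^esub> u) = A.R z (coef u) - \<psi> z *\<^sub>f coef u"
proof -
  have zu: "\<pi> z u \<in> carrier V" by (rule rep_closed[OF z u])
  have "\<pi> z u \<ominus>\<^bsub>V\<^esub> \<psi> z \<odot>\<^bsub>V\<^esub> u = \<pi> z u \<oplus>\<^bsub>V\<^esub> (- \<psi> z) \<odot>\<^bsub>V\<^esub> u"
    using u by (simp add: V.M.minus_eq cm.minus_eq_scale cm.scale_scale)
  then have "coef (\<pi> z u \<ominus>\<^bsub>V\<^esub> \<psi> z \<odot>\<^bsub>V\<^esub> u) = coef (\<pi> z u) + (- \<psi> z) *\<^sub>f coef u"
    using zu u by (simp add: coef_add coef_scale)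
  also have "\<dots> = A.R z (coef u) - \<psi> z *\<^sub>f coef u"
    unfolding coef_R[OF z u] by (simp add: fun_eq_iff)
  finally show ?thesis .
qed

text \<open>The span dividing out \<open>\<psi>\<close> is formed inside the permutation
  representation, where it is preserved by every J-endomorphism. A maximal J-submodule of the image
  of \<open>coef\<close> above its part of that span is then read back in \<open>V\<close>.\<close>

lemma exists_maximal_above_twisted_span:
  assumes e1: "e1 \<noteq> 0" and ne: "twisted_span V \<pi> (Z_subgroup B e1) \<psi> \<noteq> carrier V"
  shows "\<exists>U. subrep (J_group B e1) V \<pi> U \<and> twisted_span V \<pi> (Z_subgroup B e1) \<psi> \<subseteq> U \<and> U \<noteq> carrier V \<and>
    (\<forall>U'. subrep (J_group B e1) V \<pi> U' \<longrightarrow> U \<subseteq> U' \<longrightarrow> U' = U \<or> U' = carrier V)"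
proof -
  let ?J = "J_group B e1" and ?Z = "Z_subgroup B e1"
  let ?T = "twisted_span V \<pi> ?Z \<psi>" and ?E = "coef ` carrier V"
  interpret J: right_action ?J "rcos_space \<epsilon>" rcos_act by (rule right_action_rcos_J)
  have JSp: "carrier ?J \<subseteq> carrier Sp" unfolding J_carrier by blast
  have ZJ: "?Z \<subseteq> carrier ?J" unfolding J_carrier by (rule Z_subset_J)
  have ZSp: "?Z \<subseteq> carrier Sp" using ZJ JSp by blast
  have comm: "z ** g = g ** z" if "z \<in> ?Z" "g \<in> carrier ?J" for z g
    using that(2) unfolding J_carrier by (intro Z_commutes[OF e1 that(1)]) auto
  have R_comm: "A.R g (A.R z f) = A.R z (A.R g f)" if z: "z \<in> ?Z" and g: "g \<in> carrier ?J" for z g f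
  proof -
    have "z \<in> carrier Sp" "g \<in> carrier Sp" using z g ZSp JSp by auto
    then have "A.R (g \<otimes>\<^bsub>Sp\<^esub> z) f = A.R g (A.R z f)" "A.R (z \<otimes>\<^bsub>Sp\<^esub> g) f = A.R z (A.R g f)"
      by (simp_all only: A.R_mult)
    then show ?thesis using comm[OF z g] by simp
  qed
  let ?FT = "fspan ?Z \<psi>"
  note FT = fsubspaceD[OF fspan_subspace[of ?Z \<psi>]]
  have FT_F: "?FT \<subseteq> A.F"
  proof (rule fspan_least[OF subspace_finsupp])
    fix z f assume "z \<in> ?Z" "f \<in> A.F"
    then show "A.R z f - \<psi> z *\<^sub>f f \<in> A.F"
      using ZSp fsubspaceD(3,4)[OF subspace_finsupp] A.R_finsupp by blast
  qed
  \<comment> \<open>Elements of J commute with \<open>Z\<close>, so their translations carry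
    generators to generators.\<close>
  have FT_stable: "J.stable ?FT"
  proof (rule J.stableI)
    fix g f assume g: "g \<in> carrier ?J" and f: "f \<in> ?FT"
    have "?FT \<subseteq> {f. A.R g f \<in> ?FT}"
    proof (rule fspan_least)
      show "fsubspace {f. A.R g f \<in> ?FT}"
        unfolding fsubspace_def using FT(1-3) by (simp add: A.R_zero A.R_add A.R_scale)
      fix z h assume z: "z \<in> ?Z" and h: "h \<in> A.F"
      have "A.R g (A.R z h - \<psi> z *\<^sub>f h) = A.R z (A.R g h) - \<psi> z *\<^sub>f A.R g h"
        by (simp only: A.R_diff A.R_scale R_comm[OF z g])
      moreover have "A.R z (A.R g h) - \<psi> z *\<^sub>f A.R g h \<in> ?FT"
        using g JSp by (intro fspan_gen z A.R_finsupp h) blast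
      ultimately show "A.R z h - \<psi> z *\<^sub>f h \<in> {f. A.R g f \<in> ?FT}" by simp
    qed
    then show "A.R g f \<in> ?FT" using f by blast
  qed (use FT in auto)
  \<comment> \<open>Since \<open>Z\<close> lies in J, a J-endomorphism commutes with the
    translations in the generators.\<close>
  have FT_ghom: "\<theta> ` (?FT \<inter> A.F) \<subseteq> ?FT" if \<theta>: "J.ghom \<theta>" for \<theta>
  proof -
    have "?FT \<subseteq> {f \<in> A.F. \<theta> f \<in> ?FT}"
    proof (rule fspan_least)
      show "fsubspace {f \<in> A.F. \<theta> f \<in> ?FT}"
        by (rule J.stableD(1)[OF J.stable_vimage[OF \<theta> J.stable_finsupp subset_refl FT_stable]])
      fix z h assume z: "z \<in> ?Z" and h: "h \<in> A.F"
      have zJ: "z \<in> carrier ?J" using z ZJ by blast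
      have Rz: "A.R z h \<in> A.F" "\<psi> z *\<^sub>f h \<in> A.F"
        using z ZSp h fsubspaceD(3)[OF subspace_finsupp h] A.R_finsupp by auto
      have "\<theta> (A.R z h - \<psi> z *\<^sub>f h) = A.R z (\<theta> h) - \<psi> z *\<^sub>f \<theta> h"
        using J.ghom_diff[OF \<theta> Rz] J.ghomD(3)[OF \<theta> h, of "\<psi> z"] J.ghomD(4)[OF \<theta> zJ h] by simp
      moreover have "A.R z (\<theta> h) - \<psi> z *\<^sub>f \<theta> h \<in> ?FT" by (intro fspan_gen z J.ghomD(1)[OF \<theta>] h)
      moreover have "A.R z h - \<psi> z *\<^sub>f h \<in> A.F" by (rule fsubspaceD(4)[OF subspace_finsupp Rz])
      ultimately show "A.R z h - \<psi> z *\<^sub>f h \<in> {f \<in> A.F. \<theta> f \<in> ?FT}" by simp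
    qed
    then show ?thesis by blast
  qed
  obtain e where e: "A.ghom e" "e ` A.F \<subseteq> ?E" "\<And>f. f \<in> ?E \<Longrightarrow> e f = f"
    by (rule projection_coef) blast
  have eJ: "J.ghom e" using e(1) JSp unfolding A.ghom_def J.ghom_def by blast
  have E_F: "?E \<subseteq> A.F" using coef_finsupp by blast
  have E_stable: "J.stable ?E"
    by (rule coef_image_stable[OF right_action_rcos_J JSp cm.sub_carrier]) (use rep_closed JSp in blast)
  have subT: "cm.sub ?T" by (rule twisted_span_sub[OF ZSp])
  have rT: "\<pi> g w \<in> ?T" if g: "g \<in> carrier ?J" and w: "w \<in> ?T" for g w
  proof (rule twisted_span_stable[OF ZSp _ _ w])
    show gSp: "g \<in> carrier Sp" using g JSp by blast
    fix n assume n: "n \<in> ?Z"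
    have "g \<otimes>\<^bsub>Sp\<^esub> n \<otimes>\<^bsub>Sp\<^esub> inv\<^bsub>Sp\<^esub> g = n ** (g ** inv\<^bsub>Sp\<^esub> g)"
      using comm[OF n g] by (simp add: matrix_mul_assoc)
    then have "g \<otimes>\<^bsub>Sp\<^esub> n \<otimes>\<^bsub>Sp\<^esub> inv\<^bsub>Sp\<^esub> g = n" by (simp add: Sp_inv(2)[OF gSp])
    then show "g \<otimes>\<^bsub>Sp\<^esub> n \<otimes>\<^bsub>Sp\<^esub> inv\<^bsub>Sp\<^esub> g \<in> ?Z \<and> \<psi> (g \<otimes>\<^bsub>Sp\<^esub> n \<otimes>\<^bsub>Sp\<^esub> inv\<^bsub>Sp\<^esub> g) = \<psi> n"
      using n by (simp only:)
  qed
  have T_img: "J.stable (coef ` ?T)"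
    by (rule coef_image_stable[OF right_action_rcos_J JSp subT rT])
  \<comment> \<open>The projection \<open>e\<close> maps \<open>?FT\<close> into the image of the
    twisted span. Being the identity on \<open>?E\<close>, it would put all of \<open>?E\<close>
    there, contrary to \<open>ne\<close>.\<close>
  have "\<not> ?E \<subseteq> ?FT"
  proof
    assume E_FT: "?E \<subseteq> ?FT"
    have "?FT \<subseteq> {f \<in> A.F. e f \<in> coef ` ?T}"
    proof (rule fspan_least)
      show "fsubspace {f \<in> A.F. e f \<in> coef ` ?T}"
        by (rule J.stableD(1)[OF J.stable_vimage[OF eJ J.stable_finsupp subset_refl T_img]])
      fix z h assume z: "z \<in> ?Z" and h: "h \<in> A.F"
      have zSp: "z \<in> carrier Sp" using z ZSp by blast
      have Rz: "A.R z h \<in> A.F" "\<psi> z *\<^sub>f h \<in> A.F"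
        using zSp h fsubspaceD(3)[OF subspace_finsupp h] A.R_finsupp by auto
      obtain u where u: "u \<in> carrier V" "e h = coef u" using e(2) h by blast
      have "e (A.R z h - \<psi> z *\<^sub>f h) = A.R z (e h) - \<psi> z *\<^sub>f e h"
        using A.ghom_diff[OF e(1) Rz] A.ghomD(3)[OF e(1) h, of "\<psi> z"] A.ghomD(4)[OF e(1) zSp h] by simp
      also have "\<dots> = coef (\<pi> z u \<ominus>\<^bsub>V\<^esub> \<psi> z \<odot>\<^bsub>V\<^esub> u)" unfolding u(2) by (rule coef_gen[OF zSp u(1), symmetric])
      finally have "e (A.R z h - \<psi> z *\<^sub>f h) \<in> coef ` ?T" using twisted_span_gen[OF z u(1), of \<psi>] by blast
      moreover have "A.R z h - \<psi> z *\<^sub>f h \<in> A.F" by (rule fsubspaceD(4)[OF subspace_finsupp Rz])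
      ultimately show "A.R z h - \<psi> z *\<^sub>f h \<in> {f \<in> A.F. e f \<in> coef ` ?T}" by blast
    qed
    have "v \<in> ?T" if v: "v \<in> carrier V" for v
    proof -
      have "coef v \<in> ?E" using v by blast
      then have "e (coef v) \<in> coef ` ?T" "e (coef v) = coef v"
        using E_FT \<open>?FT \<subseteq> {f \<in> A.F. e f \<in> coef ` ?T}\<close> e(3) by blast+
      then obtain u where "u \<in> ?T" "coef v = coef u" by auto
      then show ?thesis using coef_inj[OF v, of u] cm.subD(1)[OF subT] by blast
    qed
    then show False using ne cm.subD(1)[OF subT] by blast
  qed
  moreover have "finite {rcos_act y g | g. g \<in> carrier ?J \<and> rcos_act x g = x}"
    if "x \<in> rcos_space \<epsilon>" "y \<in> rcos_space \<epsilon>" for x y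
    by (rule finite_subset[OF _ finite_suborbits[OF that]]) (use JSp in blast)
  ultimately obtain W where W: "J.maximal_in ?E W" "?E \<inter> ?FT \<subseteq> W"
    using J.exists_maximal_in_summand[OF _ eJ e(2,3) E_stable E_F FT_stable FT_ghom] by blast
  have Wst: "J.stable W" and WE: "W \<subset> ?E" using W(1) unfolding J.maximal_in_def by blast+
  note W' = J.stableD[OF Wst]
  define U where "U = {u \<in> carrier V. coef u \<in> W}"
  have coef_U: "coef ` U = W" using WE by (auto simp: U_def)
  have "subrep ?J V \<pi> U" unfolding subrep_def
  proof (intro conjI ballI cm.subI)
    show "\<zero>\<^bsub>V\<^esub> \<in> U" using W'(2) by (simp add: U_def coef_zero)
  next
    fix v w assume "v \<in> U" "w \<in> U"
    then show "v \<oplus>\<^bsub>V\<^esub> w \<in> U" using W'(3)[of "coef v" "coef w"] by (simp add: U_def coef_add)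
  next
    fix a v assume "v \<in> U"
    then show "a \<odot>\<^bsub>V\<^esub> v \<in> U" using W'(5)[of "coef v" a] by (simp add: U_def coef_scale)
  next
    fix g v assume g: "g \<in> carrier ?J" and v: "v \<in> U"
    have gSp: "g \<in> carrier Sp" using g JSp by blast
    show "\<pi> g v \<in> U" using v W'(6)[OF g, of "coef v"] rep_closed[OF gSp] by (simp add: U_def coef_R[OF gSp])
  qed (auto simp: U_def)
  moreover have "?T \<subseteq> U"
  proof (rule twisted_span_least)
    show "cm.sub U" using calculation by (simp add: subrep_def)
    fix z u assume z: "z \<in> ?Z" and u: "u \<in> carrier V"
    have zSp: "z \<in> carrier Sp" using z ZSp by blast
    have V': "\<pi> z u \<ominus>\<^bsub>V\<^esub> \<psi> z \<odot>\<^bsub>V\<^esub> u \<in> carrier V" using rep_closed[OF zSp u] u by simp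
    have "coef (\<pi> z u \<ominus>\<^bsub>V\<^esub> \<psi> z \<odot>\<^bsub>V\<^esub> u) \<in> ?FT"
      unfolding coef_gen[OF zSp u] by (rule fspan_gen[OF z coef_finsupp[OF u]])
    then have "coef (\<pi> z u \<ominus>\<^bsub>V\<^esub> \<psi> z \<odot>\<^bsub>V\<^esub> u) \<in> W" using W(2) V' by blast
    then show "\<pi> z u \<ominus>\<^bsub>V\<^esub> \<psi> z \<odot>\<^bsub>V\<^esub> u \<in> U" using V' by (simp add: U_def)
  qed
  moreover have "U \<noteq> carrier V" using coef_U WE by blast
  moreover have "U' = U \<or> U' = carrier V" if U': "subrep ?J V \<pi> U'" "U \<subseteq> U'" for U'
  proof -
    have sU': "cm.sub U'" "\<And>g w. g \<in> carrier ?J \<Longrightarrow> w \<in> U' \<Longrightarrow> \<pi> g w \<in> U'"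
      using U'(1) by (simp_all add: subrep_def)
    have U'V: "U' \<subseteq> carrier V" by (rule cm.subD(1)[OF sU'(1)])
    have "J.stable (coef ` U')" by (rule coef_image_stable[OF right_action_rcos_J JSp sU'])
    moreover have "W \<subseteq> coef ` U'" using coef_U U'(2) by blast
    moreover have "coef ` U' \<subseteq> ?E" using U'V by blast
    ultimately consider "coef ` U' = W" | "coef ` U' = ?E" using W(1) unfolding J.maximal_in_def by blast
    then show ?thesis
    proof cases
      case 1
      then have "U' \<subseteq> U" using U'V by (auto simp: U_def)
      then show ?thesis using U'(2) by blast
    next
      case 2
      have "carrier V \<subseteq> U'"
      proof
        fix v assume v: "v \<in> carrier V"
        then have "coef v \<in> coef ` U'" unfolding 2 by blast
        then obtain u where "u \<in> U'" "coef v = coef u" by blast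
        then show "v \<in> U'" using coef_inj[OF v, of u] U'V by blast
      qed
      then show ?thesis using U'V by blast
    qed
  qed
  ultimately show ?thesis by blast
qed

end
end

section \<open>Restriction to the stabilizer and conclusion\<close>

lemma smooth_rep_J: "smooth_rep (J_group B e) V \<pi>"
proof (intro smooth_rep.intro smooth_rep_axioms.intro)
  show "group (J_group B e)" unfolding J_group_eq by (rule subgroup.subgroup_is_group[OF J_subgroup group_Sp])
  show "Module.module complex_ring V" by (rule V.module_axioms)
  show "openin (top_of_set (carrier (J_group B e))) {g \<in> carrier (J_group B e). \<pi> g v = v}" if v: "v \<in> carrier V" for v
  proof -
    have "{g \<in> carrier (J_group B e). \<pi> g v = v} = carrier (J_group B e) \<inter> {g \<in> carrier Sp. \<pi> g v = v}"
      by (auto simp: J_carrier)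
    moreover obtain T where "open T" "{g \<in> carrier Sp. \<pi> g v = v} = carrier Sp \<inter> T"
      using smooth[OF v] unfolding openin_open by blast
    ultimately have "{g \<in> carrier (J_group B e). \<pi> g v = v} = carrier (J_group B e) \<inter> T"
      by (auto simp: J_carrier)
    then show ?thesis unfolding openin_open using \<open>open T\<close> by blast
  qed
  show "\<pi> \<one>\<^bsub>J_group B e\<^esub> v = v" if "v \<in> carrier V" for v using rep_one[OF that] by (simp add: J_group_eq)
  show "\<pi> (g \<otimes>\<^bsub>J_group B e\<^esub> h) v = \<pi> g (\<pi> h v)"
    if "g \<in> carrier (J_group B e)" "h \<in> carrier (J_group B e)" "v \<in> carrier V" for g h v
    using rep_mult[of g h v] that by (simp add: J_group_eq)
qed (simp_all add: J_carrier rep_closed rep_add rep_smult)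

text \<open>Any nonzero \<open>v0\<close> can start the construction: some
  \<open>cong \<epsilon>\<close> fixes it, so it survives in the coinvariants of that group, and a
  functional on them detects it.\<close>

theorem twisted_jacquet_irreducible_quotient:
  assumes sc: "supercuspidal B V \<pi>" and e1: "e1 \<noteq> 0"
    and ne: "carrier (twisted_jacquet V \<pi> (Z_subgroup B e1) \<psi>) \<noteq> {\<zero>\<^bsub>twisted_jacquet V \<pi> (Z_subgroup B e1) \<psi>\<^esub>}"
  shows "has_irreducible_quotient (J_group B e1) (twisted_jacquet V \<pi> (Z_subgroup B e1) \<psi>) (quot_act \<pi>)"
proof -
  let ?J = "J_group B e1" and ?Z = "Z_subgroup B e1"
  let ?T = "twisted_span V \<pi> ?Z \<psi>"
  interpret J: smooth_rep ?J V \<pi> by (rule smooth_rep_J)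
  have ZSp: "?Z \<subseteq> carrier Sp" using Z_subset_J by blast
  have subT: "cm.sub ?T" by (rule twisted_span_sub[OF ZSp])
  have T_ne: "?T \<noteq> carrier V"
  proof
    assume T: "?T = carrier V"
    have "cm.coset ?T v = ?T" if v: "v \<in> carrier V" for v
      using v T by (subst cm.coset_eq_W[OF subT v]) simp
    then have "cm.coset ?T ` carrier V = {?T}" using V.M.zero_closed by blast
    then show False
      using ne unfolding twisted_jacquet_def cm.quot_carrier[OF subT] cm.quot_zero[OF subT] by blast
  qed
  have "carrier V \<noteq> {\<zero>\<^bsub>V\<^esub>}" using sc by (simp add: supercuspidal_def irreducible_rep_def)
  then obtain v0 where v0: "v0 \<in> carrier V" "v0 \<noteq> \<zero>\<^bsub>V\<^esub>" using V.M.zero_closed by blast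
  obtain \<epsilon> where \<epsilon>: "0 < \<epsilon>" "\<epsilon> \<le> 1" "\<And>k. k \<in> cong \<epsilon> \<Longrightarrow> \<pi> k v0 = v0"
    by (rule exists_cong_fixing[OF v0(1)]) blast
  have "v0 \<notin> coinv \<epsilon>" by (rule fixed_not_coinv[OF \<epsilon>(1,2) v0 \<epsilon>(3)])
  then obtain l :: "'v \<Rightarrow> complex" where l: "l v0 = 1" "\<And>u. u \<in> coinv \<epsilon> \<Longrightarrow> l u = 0"
    "\<And>v w. v \<in> carrier V \<Longrightarrow> w \<in> carrier V \<Longrightarrow> l (v \<oplus>\<^bsub>V\<^esub> w) = l v + l w"
    "\<And>a v. v \<in> carrier V \<Longrightarrow> l (a \<odot>\<^bsub>V\<^esub> v) = a * l v"
    by (rule cm.exists_functional[OF sub_coinv v0(1)]) blast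
  obtain U where U: "subrep ?J V \<pi> U" "?T \<subseteq> U" "U \<noteq> carrier V"
    "\<And>U'. subrep ?J V \<pi> U' \<Longrightarrow> U \<subseteq> U' \<Longrightarrow> U' = U \<or> U' = carrier V"
    using exists_maximal_above_twisted_span[OF \<epsilon>(1,2) l(3,4,2) v0(1) l(1) sc e1 T_ne] by blast
  have T: "subrep ?J V \<pi> ?T" unfolding subrep_def
  proof (intro conjI ballI subT)
    fix g w assume g: "g \<in> carrier ?J" and w: "w \<in> ?T"
    then have g': "g \<in> carrier Sp" "g *v e1 = e1" by (auto simp: J_carrier)
    show "\<pi> g w \<in> ?T"
    proof (rule twisted_span_stable[OF ZSp g'(1) _ w])
      fix n assume n: "n \<in> ?Z"
      have "g \<otimes>\<^bsub>Sp\<^esub> n \<otimes>\<^bsub>Sp\<^esub> inv\<^bsub>Sp\<^esub> g = n ** (g ** inv\<^bsub>Sp\<^esub> g)"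
        unfolding Sp_mult Z_commutes[OF e1 n g', symmetric] by (simp only: matrix_mul_assoc)
      then have "g \<otimes>\<^bsub>Sp\<^esub> n \<otimes>\<^bsub>Sp\<^esub> inv\<^bsub>Sp\<^esub> g = n" by (simp add: Sp_inv(2)[OF g'(1)])
      then show "g \<otimes>\<^bsub>Sp\<^esub> n \<otimes>\<^bsub>Sp\<^esub> inv\<^bsub>Sp\<^esub> g \<in> ?Z \<and> \<psi> (g \<otimes>\<^bsub>Sp\<^esub> n \<otimes>\<^bsub>Sp\<^esub> inv\<^bsub>Sp\<^esub> g) = \<psi> n"
        using n by (simp only:)
    qed
  qed
  \<comment> \<open>A vector is fixed by some \<open>cong \<delta>\<close>, so a subgroup of J
    containing its stabilizer contains a neighbourhood of 1 in J.\<close>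
  have "openin (top_of_set (carrier ?J)) S"
    if S: "subgroup S ?J" and stab: "\<exists>v\<in>carrier V. {g \<in> carrier ?J. \<pi> g v = v} \<subseteq> S" for S
  proof -
    obtain v where v: "v \<in> carrier V" "{g \<in> carrier ?J. \<pi> g v = v} \<subseteq> S" using stab by blast
    obtain \<delta> where \<delta>: "0 < \<delta>" "\<And>k. k \<in> cong \<delta> \<Longrightarrow> \<pi> k v = v" by (rule exists_cong_fixing[OF v(1)]) blast
    have "cong \<delta> \<inter> {g \<in> carrier Sp. g *v e1 = e1} \<subseteq> S" using \<delta>(2) v(2) unfolding J_carrier by blast
    then show ?thesis unfolding J_carrier
      using S \<delta>(1) by (intro subgroup_open[OF J_subgroup]) (simp_all add: J_group_eq)
  qed
  then show ?thesis unfolding twisted_jacquet_def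
    using J.has_irreducible_quotient_quot[OF T U(1-3)] U(4) by blast
qed

end

theorem proposition12p5:
  fixes B :: "'k::nonarch_local_field ^ 4 \<Rightarrow> 'k ^ 4 \<Rightarrow> 'k"
    and e1 :: "'k ^ 4"
    and V :: "(complex, 'v) module"
    and \<pi> :: "'k ^ 4 ^ 4 \<Rightarrow> 'v \<Rightarrow> 'v"
    and \<psi> :: "'k ^ 4 ^ 4 \<Rightarrow> complex"
  assumes "CHAR('k) \<noteq> 2"
    and "symplectic_form B"
    and "e1 \<noteq> 0"
    and "supercuspidal B V \<pi>"
    and "character (Z_subgroup B e1) \<psi>"
    and "\<exists>z\<in>Z_subgroup B e1. \<psi> z \<noteq> 1"
    and "carrier (twisted_jacquet V \<pi> (Z_subgroup B e1) \<psi>)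
           \<noteq> {\<zero>\<^bsub>twisted_jacquet V \<pi> (Z_subgroup B e1) \<psi>\<^esub>}"
  shows "has_irreducible_quotient (J_group B e1)
           (twisted_jacquet V \<pi> (Z_subgroup B e1) \<psi>) (quot_act \<pi>)"
proof -
  interpret symp B using assms(1,2) by (rule symp.intro)
  \<comment> \<open>The basis only fixes a lattice and a norm; no relation to \<open>e1\<close> is
    required.\<close>
  obtain P1 Q1 P2 Q2 where "sympl_basis P1 Q1 P2 Q2" by (rule exists_sympl_basis)
  then interpret symp_std B P1 Q1 P2 Q2 by unfold_locales
  interpret smooth_rep Sp V \<pi> using assms(4) by (simp add: supercuspidal_def irreducible_rep_def)
  interpret symp_rep B P1 Q1 P2 Q2 V \<pi> by unfold_locales
  show ?thesis by (rule twisted_jacquet_irreducible_quotient[OF assms(4,3,7)])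
qed

end
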